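(* Let $n\ge2$, $0<\lambda\le\Lambda$, $\kappa=\Lambda/\lambda\ge1$, and let $u\in C(\overline B_1)$ satisfy $\mathcal M^-_{\lambda,\Lambda}(D^2u)\le0$ in $B_1\subset\mathbb R^n$ in the viscosity sense. For every $0<p<\underline p_n(\kappa)$ there exists a constant $C=C(n,\kappa,p)$ (independent of $u$) such that $$\int_{B_{1/2}}\underline\Theta(u,B_1)^p\,dx\le C\,\|u\|_{L^\infty(B_1)}^p.$$ In particular, $\varepsilon_n(\kappa)\ge\underline p_n(\kappa)$.
   Context: $B_r\subset\mathbb R^n$ is the open ball of radius $r$ centered at $0$. For a symmetric $n\times n$ matrix $M$ with eigenvalues $\mu_i(M)$, the lower Pucci extremal operator is $$\mathcal M^-_{\lambda,\Lambda}(M)=\lambda\sum_{\mu_i(M)>0}\mu_i(M)+\Lambda\sum_{\mu_i(M)<0}\mu_i(M).$$ The inequality $\mathcal M^-_{\lambda,\Lambda}(D^2u)\le0$ in an open set $\Omega$ is understood in the viscosity sense: whenever $\varphi\in C^2$ and $u-\varphi$ has a local minimum at $x\in\Omega$, one has $\mathcal M^-_{\lambda,\Lambda}(D^2\varphi(x))\le0$. (Multiplying by a positive constant, this class depends only on $\kappa$.) A paraboloid of opening $-A$ is a function $y\mapsto -\frac A2|y|^2+L(y)$ with $L$ affine. For a bounded domain $\Omega$, $u\in C(\overline\Omega)$ and $x\in\Omega$, $\underline\Theta(u,\Omega)(x)\in[0,+\infty]$ is the least $A\ge0$ for which there is a paraboloid $P$ of opening $-A$ with $P\le u$ in $\overline\Omega$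 and $P(x)=u(x)$ (and $+\infty$ if there is none). $\varepsilon_n(\kappa)$ is the supremum of all $q>0$ for which there is a constant $C(n,\kappa,q)$ with $\int_{B_{1/2}}\underline\Theta(u,B_1)^q\,dx\le C(n,\kappa,q)\|u\|_{L^\infty(B_1)}^q$ for every $u\in C(\overline B_1)$ satisfying $\mathcal M^-_{\lambda,\Lambda}(D^2u)\le0$ in $B_1$ in the viscosity sense. For $1\le r\le n-1$ define $$P_{n,r,\kappa}(z):=(1-z)^r\Bigl(1+\frac{\kappa r}{n-r}z\Bigr)^{n-r},\qquad 0\le z\le1.$$ If $\kappa>1$, $p_{n,r}(\kappa)\in(0,1)$ is the unique solution $p\in(0,1)$ of $\int_0^1z^{-p}P'_{n,r,\kappa}(z)\,dz=0$; for $\kappa=1$, $p_{n,r}(1):=1$. Finally, $\underline p_n(\kappa):=\min_{1\le r\le n-1}p_{n,r}(\kappa)$. *)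

theory Defs
  imports "HOL-Analysis.Analysis" "HOL-Probability.Essential_Supremum"
begin

section \<open>Pucci operator and viscosity supersolutions\<close>

definition matrix_eigenspace :: "real^'n^'n \<Rightarrow> real \<Rightarrow> (real^'n) set" where
  "matrix_eigenspace M \<mu> = {v. M *v v = \<mu> *\<^sub>R v}"

definition matrix_eigenvalues :: "real^'n^'n \<Rightarrow> real set" where
  "matrix_eigenvalues M = {\<mu>. \<exists>v. v \<noteq> 0 \<and> v \<in> matrix_eigenspace M \<mu>}"

text \<open>
  Meant for symmetric matrices. Eigenvalues are counted with multiplicity; for a symmetric
  matrix the multiplicity of \<open>\<mu>\<close> is the dimension of its eigenspace.
\<close>

definition pucci_minus :: "real \<Rightarrow> real \<Rightarrow> real^'n^'n \<Rightarrow> real" where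
  "pucci_minus lam Lam M =
     lam * (\<Sum>\<mu> \<in> {\<mu> \<in> matrix_eigenvalues M. \<mu> > 0}. real (dim (matrix_eigenspace M \<mu>)) * \<mu>) +
     Lam * (\<Sum>\<mu> \<in> {\<mu> \<in> matrix_eigenvalues M. \<mu> < 0}. real (dim (matrix_eigenspace M \<mu>)) * \<mu>)"

text \<open>
  \<open>\<phi>\<close> is of class \<open>C\<^sup>2\<close> on the open set \<open>\<Omega>\<close>, with gradient \<open>g\<close> and Hessian matrix \<open>H\<close>.
  Both are determined on \<open>\<Omega>\<close>, and \<open>H\<close> is symmetric there by Schwarz's theorem.
\<close>

definition C2_with_hessian ::
    "(real^'n \<Rightarrow> real) \<Rightarrow> (real^'n \<Rightarrow> real^'n) \<Rightarrow> (real^'n \<Rightarrow> real^'n^'n) \<Rightarrow> (real^'n) set \<Rightarrow> bool" where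
  "C2_with_hessian \<phi> g H \<Omega> \<longleftrightarrow>
     (\<forall>x\<in>\<Omega>. (\<phi> has_derivative (\<lambda>h. g x \<bullet> h)) (at x)) \<and>
     (\<forall>x\<in>\<Omega>. (g has_derivative (\<lambda>h. H x *v h)) (at x)) \<and>
     continuous_on \<Omega> H"

definition pucci_supersolution :: "real \<Rightarrow> real \<Rightarrow> (real^'n) set \<Rightarrow> (real^'n \<Rightarrow> real) \<Rightarrow> bool" where
  "pucci_supersolution lam Lam \<Omega> u \<longleftrightarrow>
     (\<forall>\<phi> g H x. C2_with_hessian \<phi> g H \<Omega> \<and> x \<in> \<Omega> \<and>
        (\<forall>\<^sub>F y in at x within \<Omega>. u x - \<phi> x \<le> u y - \<phi> y) \<longrightarrow>
        pucci_minus lam Lam (H x) \<le> 0)"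

section \<open>Touching paraboloids\<close>

definition paraboloid :: "real \<Rightarrow> (real^'n \<Rightarrow> real) \<Rightarrow> bool" where
  "paraboloid A P \<longleftrightarrow> (\<exists>a b. P = (\<lambda>y. - (A / 2) * (norm y)\<^sup>2 + (a \<bullet> y + b)))"

text \<open>
  For \<open>\<Omega>\<close> open and bounded and \<open>u\<close> continuous on its closure, the infimum is attained whenever
  the set is nonempty, so it is the least admissible opening; the infimum of the empty set is
  \<open>\<infinity>\<close>. As a function of \<open>x \<in> \<Omega>\<close> it is then lower semicontinuous, in particular Borel, so that
  the nonnegative integrals of its powers below are genuine Lebesgue integrals.
\<close>

definition Theta_lower :: "(real^'n \<Rightarrow> real) \<Rightarrow> (real^'n) set \<Rightarrow> real^'n \<Rightarrow> ennreal" where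
  "Theta_lower u \<Omega> x =
     Inf {ennreal A | A. 0 \<le> A \<and>
       (\<exists>P. paraboloid A P \<and> (\<forall>y\<in>closure \<Omega>. P y \<le> u y) \<and> P x = u x)}"

section \<open>The integral estimate\<close>

text \<open>Powers with positive real exponent, with \<open>\<infinity>\<close> sent to \<open>\<infinity>\<close>.\<close>

definition ennreal_powr :: "ennreal \<Rightarrow> real \<Rightarrow> ennreal" where
  "ennreal_powr a p = (if a = \<infinity> then \<infinity> else ennreal (enn2real a powr p))"

definition Linf_norm :: "(real^'n) set \<Rightarrow> (real^'n \<Rightarrow> real) \<Rightarrow> ennreal" where
  "Linf_norm S u = esssup (lebesgue_on S) (\<lambda>x. ennreal \<bar>u x\<bar>)"

text \<open>
  The constant \<open>C\<close> may depend on the ellipticity constants only through their ratio \<open>\<kappa>\<close>; the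
  dimension enters through the type.
\<close>

definition eps_exponent :: "'n::finite itself \<Rightarrow> real \<Rightarrow> ereal" where
  "eps_exponent (_ :: 'n itself) \<kappa> =
     Sup {ereal q | q. q > 0 \<and>
       (\<exists>C\<ge>0. \<forall>lam Lam. \<forall>u :: real^'n \<Rightarrow> real.
          0 < lam \<and> lam \<le> Lam \<and> \<kappa> = Lam / lam \<and> continuous_on (closure (ball 0 1)) u \<and>
          pucci_supersolution lam Lam (ball 0 1) u \<longrightarrow>
          (\<integral>\<^sup>+x\<in>ball 0 (1/2). ennreal_powr (Theta_lower u (ball 0 1) x) q \<partial>lebesgue)
            \<le> ennreal C * ennreal_powr (Linf_norm (ball 0 1) u) q)}"

section \<open>The explicit exponent\<close>

definition P_poly :: "nat \<Rightarrow> nat \<Rightarrow> real \<Rightarrow> real \<Rightarrow> real" where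
  "P_poly n r \<kappa> z = (1 - z) ^ r * (1 + \<kappa> * real r / real (n - r) * z) ^ (n - r)"

definition p_root :: "nat \<Rightarrow> nat \<Rightarrow> real \<Rightarrow> real" where
  "p_root n r \<kappa> =
     (if \<kappa> = 1 then 1
      else THE p. 0 < p \<and> p < 1 \<and>
        ((\<lambda>z. z powr (- p) * deriv (P_poly n r \<kappa>) z) has_integral 0) {0..1})"

definition p_lower :: "nat \<Rightarrow> real \<Rightarrow> real" where
  "p_lower n \<kappa> = Min ((\<lambda>r. p_root n r \<kappa>) ` {1..n - 1})"

end

theory Submission
  imports Defs "HOL-Computational_Algebra.Polynomial"
begin

text \<open>
  Slide paraboloids of opening \<open>-A\<close> from below under a semiconcave supersolution \<open>w\<close>, an
  inf-convolution of \<open>u\<close>. The map \<open>x \<mapsto> x + Dw(x)/A\<close> sends the contact set \<open>T\<^sub>A = {\<Theta> \<le> A}\<close> onto the set of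
  vertices, so the area inequality gives \<open>\<integral> \<eta> \<le> \<integral>\<^bsub>T\<^sub>A\<^esub> \<eta>(x + Dw/A) det(I + D\<^sup>2w/A)\<close> for a cutoff \<open>\<eta>\<close>.
  The eigenvalues of \<open>D\<^sup>2w\<close> at \<open>x\<close> are at least \<open>-\<Theta>(x)\<close>; by the Pucci inequality and AM-GM the
  determinant is at most \<open>P(t\<Theta>(x)/A)\<close>, where \<open>P\<close> is the polynomial of index \<open>r\<close>, the number of negative
  eigenvalues, and \<open>0 \<le> t \<le> 1\<close>. Multiply by \<open>p A\<^bsup>p-1\<^esup>\<close> and integrate over \<open>A\<close>: for \<open>p\<close> below the root
  of index \<open>r\<close> the contribution of \<open>P - 1\<close> is at most \<open>c \<Theta>\<^sup>p\<close> with \<open>c < 1\<close>, uniformly in \<open>t\<close>, and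
  \<open>\<integral> \<eta> \<Theta>\<^sup>p\<close> is absorbed. The displacement \<open>|Dw|/A \<le> C \<Theta>\<^bsup>1/2\<^esup>/A\<close> in the argument of \<open>\<eta>\<close> costs only
  \<open>\<integral> \<Theta>\<^bsup>p-1/2\<^esup>\<close> on a larger ball, so two steps suffice since \<open>p < 1\<close>.

  All contact points of openings at most \<open>N\<close> lie on the graph of one envelope of class \<open>C\<^bsup>1,1\<^esup>\<close>, so
  Rademacher's theorem provides the same Hessian for all \<open>A \<le> N\<close> and Alexandrov's theorem is not
  needed.
\<close>

subsection \<open>Rademacher's theorem\<close>

text \<open>For \<open>\<kappa>\<close> > 1 the Jacobian bound P(z) exceeds 1 for small z > 0, so no
  single opening A yields decay; only the average over A does. At a point of opening
  \<open>\<theta>\<close> the weighted integral over [\<open>\<theta>\<close>, N] is at most N^p -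
  (1 - c) \<open>\<theta>\<close>^p, while the vertices contribute N^p - 1024^p. Both are weighted
  by the same cutoff, so the terms with N^p cancel exactly and (1 - c) times the integral of
  \<open>\<theta>\<close>^p remains. The threshold on p is the condition G(1) < 1, where G(1) is the
  moment of P plus 1. The inf-convolution is there for its semiconcavity: together with the
  paraboloids from below it makes the gradient of the envelope Lipschitz, which Rademacher's theorem
  and the area inequality require. That Lipschitz constant blows up with N and with the inverse of
  the regularization parameter, so it may enter qualitatively only; truncating
  \<open>\<theta>\<close> at N makes the quantities to be cancelled finite. Constants depending on
  n, \<open>\<kappa>\<close> and p alone then survive the limit, by Fatou's lemma and the stability
  of touching paraboloids.\<close>

lemma lipschitz_image_measure_le:
  fixes g :: "real \<Rightarrow> real"
  assumes E: "E \<in> sets lborel" and gE: "g ` E \<in> sets lborel"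
    and mono: "strict_mono g" and lip: "\<And>x y. \<bar>g x - g y\<bar> \<le> B * \<bar>x - y\<bar>"
    and "0 \<le> p"
    and cov: "\<And>x d. x \<in> E \<Longrightarrow> 0 < d \<Longrightarrow>
      \<exists>c r. 0 < r \<and> r < d \<and> x \<in> cball c r \<and> g (c + r) - g (c - r) \<le> p * (2 * r)"
  shows "emeasure lborel (g ` E) \<le> ennreal p * emeasure lborel E"
proof -
  have gcont: "continuous_on S g" for S
  proof (rule continuous_on_subset[of UNIV])
    have "(max B 0)-lipschitz_on UNIV g"
    proof (rule lipschitz_onI)
      show "dist (g x) (g y) \<le> max B 0 * dist x y" for x y
        using lip[of x y] mult_right_mono[of B "max B 0" "\<bar>x - y\<bar>"] by (simp add: dist_real_def)
    qed simp
    then show "continuous_on UNIV g"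
      by (rule lipschitz_on_continuous_on)
  qed simp
  have ginj: "inj g" using mono strict_mono_eq by (blast intro: injI)
  \<comment> \<open>Vitali covering: disjoint small intervals inside an open U with |U - E| < e
    cover E up to a null set, and each has an image at most p times as long. The Lipschitz bound
    makes the image of the exceptional set null.\<close>
  have main: "emeasure lborel (g ` E) \<le> ennreal p * (emeasure lborel E + ennreal e)" if "e > 0" for e
  proof -
    obtain U where U: "open U" "E \<subseteq> U" "emeasure lborel (U - E) < ennreal e"
      using outer_regular_lborel[OF _ \<open>e > 0\<close>, of E] E by auto
    define K where "K = {(c, r). 0 < r \<and> cball c r \<subseteq> U \<and> g (c + r) - g (c - r) \<le> p * (2 * r)}"
    have small: "\<exists>i. i \<in> K \<and> x \<in> cball (fst i) (snd i) \<and> snd i < d" if "x \<in> E" "0 < d" for x d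
    proof -
      obtain \<delta> where d: "\<delta> > 0" "ball x \<delta> \<subseteq> U"
        using U \<open>x \<in> E\<close> by (meson open_contains_ball subsetD)
      \<comment> \<open>The point x need not be the centre of the interval; a radius below
        \<open>\<delta>/2\<close> still keeps the interval within \<open>\<delta>\<close> of
        x.\<close>
      have "0 < min (\<delta>/2) d" using d that by simp
      from cov[OF that(1) this]
      obtain c r where cr: "0 < r" "r < min (\<delta>/2) d" "x \<in> cball c r" "g (c + r) - g (c - r) \<le> p * (2 * r)"
        by blast
      have "cball c r \<subseteq> ball x \<delta>"
      proof
        fix y assume "y \<in> cball c r"
        then show "y \<in> ball x \<delta>"
          using cr dist_triangle2[of x y c] by (simp add: dist_commute)
      qed
      then have "cball c r \<subseteq> U" using d by blast
      then have "(c, r) \<in> K" using cr by (simp add: K_def)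
      then show ?thesis using cr by (intro exI[of _ "(c, r)"]) simp
    qed
    obtain C where C: "countable C" "C \<subseteq> K"
      "pairwise (\<lambda>i j. disjnt (cball (fst i) (snd i)) (cball (fst j) (snd j))) C"
      "negligible (E - (\<Union>i\<in>C. cball (fst i) (snd i)))"
    proof (rule Vitali_covering_theorem_cballs[of K snd E fst])
      show "0 < snd i" if "i \<in> K" for i using that by (auto simp: K_def)
    qed (use small in blast)+
    let ?I = "\<lambda>i. cball (fst i) (snd i) :: real set"
    have disj: "disjoint_family_on ?I C"
      using C(3) unfolding disjoint_family_on_def pairwise_def disjnt_def by blast
    have disjg: "disjoint_family_on (\<lambda>i. g ` ?I i) C"
      using disj ginj unfolding disjoint_family_on_def by (metis image_Int image_empty)
    have gI: "g ` ?I i = {g (fst i - snd i) .. g (fst i + snd i)}" if "i \<in> C" for i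
    proof -
      have pos: "0 < snd i" using C(2) that by (auto simp: K_def)
      show ?thesis
      proof
        show "g ` ?I i \<subseteq> {g (fst i - snd i) .. g (fst i + snd i)}"
          using mono by (auto simp: dist_real_def abs_le_iff strict_mono_less_eq)
        show "{g (fst i - snd i) .. g (fst i + snd i)} \<subseteq> g ` ?I i"
        proof
          fix y assume y: "y \<in> {g (fst i - snd i) .. g (fst i + snd i)}"
          obtain x where "fst i - snd i \<le> x" "x \<le> fst i + snd i" "g x = y"
            using IVT'[of g "fst i - snd i" y "fst i + snd i"] y pos gcont by auto
          then show "y \<in> g ` ?I i" by (auto simp: dist_real_def)
        qed
      qed
    qed
    have gI_meas: "g ` ?I i \<in> sets lborel" if "i \<in> C" for i
      using gI[OF that] by simp
    have le: "emeasure lborel (g ` ?I i) \<le> ennreal p * emeasure lborel (?I i)" if "i \<in> C" for i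
    proof -
      have pos: "0 < snd i" "g (fst i + snd i) - g (fst i - snd i) \<le> p * (2 * snd i)"
        using C(2) that by (auto simp: K_def)
      have "g (fst i - snd i) \<le> g (fst i + snd i)" 
        using mono pos by (simp add: strict_mono_less_eq)
      moreover have "?I i = {fst i - snd i .. fst i + snd i}"
        by (simp add: cball_eq_atLeastAtMost)
      ultimately show ?thesis
        using pos gI[OF that] \<open>0 \<le> p\<close> by (simp add: ennreal_mult[symmetric] ennreal_leI)
    qed
    have neg: "g ` (E - (\<Union>i\<in>C. ?I i)) \<in> null_sets lebesgue"
    proof -
      have "negligible (g ` (E - (\<Union>i\<in>C. ?I i)))"
        by (rule negligible_locally_Lipschitz_image) (use C(4) lip in \<open>auto simp: intro!: exI[of _ UNIV] exI[of _ B]\<close>)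
      then show ?thesis by (simp add: negligible_iff_null_sets)
    qed
    let ?N = "g ` (E - (\<Union>i\<in>C. ?I i))"
    have mg: "(\<Union>i\<in>C. g ` ?I i) \<in> sets lborel"
      by (rule sets.countable_UN'[OF C(1)]) (use gI_meas in blast)
    then have mg': "(\<Union>i\<in>C. g ` ?I i) \<in> sets lebesgue"
      by (rule sets_completionI_sets)
    have "emeasure lborel (g ` E) = emeasure lebesgue (g ` E)"
      using gE by simp
    also have "\<dots> \<le> emeasure lebesgue ((\<Union>i\<in>C. g ` ?I i) \<union> ?N)"
    proof (rule emeasure_mono)
      show "g ` E \<subseteq> (\<Union>i\<in>C. g ` ?I i) \<union> ?N" by blast
      show "(\<Union>i\<in>C. g ` ?I i) \<union> ?N \<in> sets lebesgue" using mg' neg by (blast intro: null_setsD2)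
    qed
    also have "\<dots> = emeasure lebesgue (\<Union>i\<in>C. g ` ?I i)"
      by (rule emeasure_Un_null_set[OF mg' neg])
    also have "\<dots> = emeasure lborel (\<Union>i\<in>C. g ` ?I i)"
      using mg by simp
    also have "\<dots> = (\<integral>\<^sup>+i. emeasure lborel (g ` ?I i) \<partial>count_space C)"
      by (rule emeasure_UN_countable[OF gI_meas C(1) disjg])
    also have "\<dots> \<le> (\<integral>\<^sup>+i. ennreal p * emeasure lborel (?I i) \<partial>count_space C)"
      by (rule nn_integral_mono) (use le in simp)
    also have "\<dots> = ennreal p * (\<integral>\<^sup>+i. emeasure lborel (?I i) \<partial>count_space C)"
      by (rule nn_integral_cmult) auto
    finally have 1: "emeasure lborel (g ` E) \<le> ennreal p * (\<integral>\<^sup>+i. emeasure lborel (?I i) \<partial>count_space C)" .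
    have "(\<integral>\<^sup>+i. emeasure lborel (?I i) \<partial>count_space C) = emeasure lborel (\<Union>i\<in>C. ?I i)"
      by (rule emeasure_UN_countable[OF _ C(1) disj, symmetric]) simp
    also have "\<dots> \<le> emeasure lborel U"
    proof (rule emeasure_mono)
      have "?I i \<subseteq> U" if "i \<in> C" for i 
      proof -
        have "i \<in> K" using C(2) that by blast
        then show ?thesis unfolding K_def by (simp add: case_prod_unfold)
      qed
      then show "(\<Union>i\<in>C. ?I i) \<subseteq> U" by blast
    qed (use U in simp)
    also have "emeasure lborel U = emeasure lborel (E \<union> (U - E))"
      using U(2) by (simp add: Un_absorb1)
    also have "\<dots> \<le> emeasure lborel E + emeasure lborel (U - E)"
      by (rule emeasure_subadditive) (use E U in auto)
    also have "\<dots> \<le> emeasure lborel E + ennreal e"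
      using U(3) by (intro add_left_mono) auto
    finally have "(\<integral>\<^sup>+i. emeasure lborel (?I i) \<partial>count_space C) \<le> emeasure lborel E + ennreal e" .
    then show ?thesis by (rule order_trans[OF 1 mult_left_mono]) simp
  qed
  show ?thesis
  proof (rule ennreal_le_epsilon)
    fix e :: real assume "0 < e"
    have "emeasure lborel (g ` E) \<le> ennreal p * (emeasure lborel E + ennreal (e / (p + 1)))"
      using main[of "e / (p + 1)"] \<open>0 < e\<close> \<open>0 \<le> p\<close> by simp
    also have "\<dots> = ennreal p * emeasure lborel E + ennreal (p * (e / (p + 1)))"
      using \<open>0 < e\<close> \<open>0 \<le> p\<close> by (subst ennreal_mult) (auto simp: distrib_left)
    also have "\<dots> \<le> ennreal p * emeasure lborel E + ennreal e"
      using \<open>0 < e\<close> \<open>0 \<le> p\<close> by (intro add_left_mono ennreal_leI) (simp add: field_simps)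
    finally show "emeasure lborel (g ` E) \<le> ennreal p * emeasure lborel E + ennreal e" .
  qed
qed

text \<open>For p < q the difference quotients along v oscillate across [p, q] as h tends to 0. For
  bounded quotients, the rational pairs p < q detect every failure of convergence.\<close>

definition slope_osc :: "('a::real_normed_vector \<Rightarrow> real) \<Rightarrow> 'a \<Rightarrow> real \<Rightarrow> real \<Rightarrow> 'a set" where
  "slope_osc f v p q = {x.
     (\<forall>d>0. \<exists>h. h \<noteq> 0 \<and> \<bar>h\<bar> < d \<and> (f (x + h *\<^sub>R v) - f x) / h < p) \<and>
     (\<forall>d>0. \<exists>h. h \<noteq> 0 \<and> \<bar>h\<bar> < d \<and> q < (f (x + h *\<^sub>R v) - f x) / h)}"

text \<open>A G-delta set: for a fixed bound d each condition is a union over h of open sets, and it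
  suffices to let d run through 1/(k + 1).\<close>

lemma slope_osc_borel:
  assumes "continuous_on UNIV f"
  shows "slope_osc f v p q \<in> sets borel"
proof -
  have c: "continuous_on UNIV (\<lambda>x. (f (x + h *\<^sub>R v) - f x) / h)" if "h \<noteq> 0" for h
    by (intro continuous_intros continuous_on_compose2[OF assms] assms) (use that in auto)
  have o1: "open (\<Union>h\<in>{h. h \<noteq> 0 \<and> \<bar>h\<bar> < d}. {x. (f (x + h *\<^sub>R v) - f x) / h < p})" for d
    by (intro open_UN ballI open_Collect_less c continuous_intros) auto
  have o2: "open (\<Union>h\<in>{h. h \<noteq> 0 \<and> \<bar>h\<bar> < d}. {x. q < (f (x + h *\<^sub>R v) - f x) / h})" for d
    by (intro open_UN ballI open_Collect_less c continuous_intros) auto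
  have "slope_osc f v p q =
      (\<Inter>k::nat. (\<Union>h\<in>{h. h \<noteq> 0 \<and> \<bar>h\<bar> < inverse (Suc k)}. {x. (f (x + h *\<^sub>R v) - f x) / h < p})) \<inter>
      (\<Inter>k::nat. (\<Union>h\<in>{h. h \<noteq> 0 \<and> \<bar>h\<bar> < inverse (Suc k)}. {x. q < (f (x + h *\<^sub>R v) - f x) / h}))"
    (is "_ = ?R")
  proof
    show "slope_osc f v p q \<subseteq> ?R"
    proof
      fix x assume x: "x \<in> slope_osc f v p q"
      have "(\<exists>h. h \<noteq> 0 \<and> \<bar>h\<bar> < inverse (Suc k) \<and> (f (x + h *\<^sub>R v) - f x) / h < p) \<and>
          (\<exists>h. h \<noteq> 0 \<and> \<bar>h\<bar> < inverse (Suc k) \<and> q < (f (x + h *\<^sub>R v) - f x) / h)" for k :: nat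
      proof -
        have "0 < inverse (real (Suc k))" by simp
        with x show ?thesis unfolding slope_osc_def by blast
      qed
      then show "x \<in> ?R" by blast
    qed
    show "?R \<subseteq> slope_osc f v p q"
    proof
      fix x assume x: "x \<in> ?R"
      show "x \<in> slope_osc f v p q"
        unfolding slope_osc_def
      proof (intro CollectI conjI allI impI)
        fix d :: real assume "0 < d"
        then obtain k :: nat where k: "inverse (Suc k) < d" using reals_Archimedean by blast
        from x obtain h where "h \<noteq> 0" "\<bar>h\<bar> < inverse (Suc k)" "(f (x + h *\<^sub>R v) - f x) / h < p"
          by blast
        then show "\<exists>h. h \<noteq> 0 \<and> \<bar>h\<bar> < d \<and> (f (x + h *\<^sub>R v) - f x) / h < p"
          using k less_trans by blast
        from x obtain h where "h \<noteq> 0" "\<bar>h\<bar> < inverse (Suc k)" "q < (f (x + h *\<^sub>R v) - f x) / h"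
          by blast
        then show "\<exists>h. h \<noteq> 0 \<and> \<bar>h\<bar> < d \<and> q < (f (x + h *\<^sub>R v) - f x) / h"
          using k less_trans by blast
      qed
    qed
  qed
  then show ?thesis using o1 o2 by (auto intro!: sets.Int sets.countable_INT)
qed

lemma strict_mono_surj_inverse:
  fixes F :: "real \<Rightarrow> real"
  assumes "continuous_on UNIV F" and grow: "\<And>x y. x \<le> y \<Longrightarrow> y - x \<le> F y - F x"
  shows "\<exists>G. (\<forall>x. G (F x) = x) \<and> (\<forall>y. F (G y) = y) \<and> strict_mono G \<and> (\<forall>x y. \<bar>G x - G y\<bar> \<le> \<bar>x - y\<bar>)"
proof -
  have mono: "strict_mono F"
    by (rule strict_monoI) (use grow in \<open>smt (verit)\<close>)
  have surj: "\<exists>x. F x = y" for y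
  proof -
    \<comment> \<open>Growth at rate at least 1 reaches the level y from \<open>F 0\<close> within
      distance |y - F 0|.\<close>
    define a where "a = min 0 (y - F 0)"
    define b where "b = max 0 (y - F 0)"
    have "F a \<le> y" using grow[of a 0] by (auto simp: a_def min_def split: if_splits)
    moreover have "y \<le> F b" using grow[of 0 b] by (auto simp: b_def max_def split: if_splits)
    moreover have "a \<le> b" by (simp add: a_def b_def)
    ultimately show ?thesis
      using IVT'[of F a y b] continuous_on_subset[OF assms(1), of "{a..b}"] by blast
  qed
  define G where "G = inv F"
  have GF: "G (F x) = x" for x using mono by (simp add: G_def strict_mono_on_imp_inj_on inv_f_f)
  have FG: "F (G y) = y" for y
    using surj[of y] unfolding G_def by (auto intro: f_inv_into_f)
  have sm: "strict_mono G"
    by (rule strict_monoI) (metis FG mono strict_mono_less)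
  have "\<bar>G x - G y\<bar> \<le> \<bar>x - y\<bar>" for x y
    using grow[of "G x" "G y"] grow[of "G y" "G x"] by (cases "G x \<le> G y") (auto simp: FG)
  then show ?thesis using GF FG sm by blast
qed

text \<open>Around points of oscillation \<open>F = f + (L + 1) id\<close> stretches small intervals both by less
  than \<open>P\<close> and by more than \<open>Q > P\<close>. The image bound is applied to \<open>F\<close> and to its inverse.\<close>

lemma slope_osc_null_real:
  fixes f :: "real \<Rightarrow> real"
  assumes lip: "\<And>x y. \<bar>f x - f y\<bar> \<le> L * \<bar>x - y\<bar>" and pq: "p < q"
  shows "slope_osc f 1 p q \<in> null_sets lborel"
proof -
  have L: "0 \<le> L" using lip[of 1 0] abs_ge_zero[of "f 1 - f 0"] by (simp del: abs_ge_zero)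
  have "L-lipschitz_on UNIV f"
    by (rule lipschitz_onI) (use lip L in \<open>auto simp: dist_real_def\<close>)
  then have fc: "continuous_on UNIV f" by (rule lipschitz_on_continuous_on)
  define F where "F = (\<lambda>x. f x + (L + 1) * x)"
  have Fc: "continuous_on UNIV F" unfolding F_def by (intro continuous_intros fc)
  have grow: "y - x \<le> F y - F x" if "x \<le> y" for x y
    using lip[of x y] that unfolding F_def by (auto simp: algebra_simps abs_le_iff)
  have Flip: "\<bar>F x - F y\<bar> \<le> (2 * L + 1) * \<bar>x - y\<bar>" for x y
  proof -
    have "\<bar>F x - F y\<bar> \<le> \<bar>f x - f y\<bar> + (L + 1) * \<bar>x - y\<bar>"
    proof -
      have "F x - F y = (f x - f y) + (L + 1) * (x - y)" by (simp add: F_def algebra_simps)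
      then show ?thesis
        using L abs_triangle_ineq[of "f x - f y" "(L+1) * (x - y)"] by (simp add: abs_mult)
    qed
    then show ?thesis using lip[of x y] by (simp add: algebra_simps)
  qed
  obtain G where G: "\<And>x. G (F x) = x" "\<And>y. F (G y) = y" "strict_mono G" "\<And>x y. \<bar>G x - G y\<bar> \<le> 1 * \<bar>x - y\<bar>"
    using strict_mono_surj_inverse[OF Fc grow] by auto
  have Gc: "continuous_on UNIV G"
  proof -
    have "1-lipschitz_on UNIV G"
      by (rule lipschitz_onI) (use G(4) in \<open>auto simp: dist_real_def\<close>)
    then show ?thesis by (rule lipschitz_on_continuous_on)
  qed
  have Fm: "strict_mono F"
    by (rule strict_monoI) (use grow in \<open>smt (verit)\<close>)
  have slope: "(F (x + h) - F x) / h = (f (x + h *\<^sub>R 1) - f x) / h + (L + 1)" if "h \<noteq> 0" for x h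
    using that by (simp add: F_def field_simps)
  have slope1: "1 \<le> (F (x + h) - F x) / h" if "h \<noteq> 0" for x h
    using grow[of x "x + h"] grow[of "x + h" x] that by (cases "h > 0") (auto simp: field_simps)
  define P where "P = p + L + 1"
  define Q where "Q = q + L + 1"
  have bd: "slope_osc f 1 p q \<inter> {-real n..real n} \<in> null_sets lborel" for n
  proof (cases "slope_osc f 1 p q \<inter> {-real n..real n} = {}")
    case False
    define E where "E = slope_osc f 1 p q \<inter> {-real n..real n}"
    have E: "E \<in> sets lborel" using slope_osc_borel[OF fc] by (auto simp: E_def)
    have lo: "\<exists>h. h \<noteq> 0 \<and> \<bar>h\<bar> < d \<and> (F (x + h) - F x) / h < P" if x: "x \<in> E" "0 < d" for x d
    proof -
      obtain h where h: "h \<noteq> 0" "\<bar>h\<bar> < d" "(f (x + h *\<^sub>R 1) - f x) / h < p"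
        using x unfolding E_def slope_osc_def by blast
      then show ?thesis using slope[of h x] by (intro exI[of _ h]) (auto simp: P_def)
    qed
    have hi: "\<exists>h. h \<noteq> 0 \<and> \<bar>h\<bar> < d \<and> Q < (F (x + h) - F x) / h" if x: "x \<in> E" "0 < d" for x d
    proof -
      obtain h where h: "h \<noteq> 0" "\<bar>h\<bar> < d" "q < (f (x + h *\<^sub>R 1) - f x) / h"
        using x unfolding E_def slope_osc_def by blast
      then show ?thesis using slope[of h x] by (intro exI[of _ h]) (auto simp: Q_def)
    qed
    \<comment> \<open>All slopes of F are at least 1, so a single point of E forces 1 < P; this is
      why the empty case is split off.\<close>
    obtain x0 where x0: "x0 \<in> E" using False unfolding E_def by blast
    obtain h0 where "h0 \<noteq> 0" "(F (x0 + h0) - F x0) / h0 < P" using lo[OF x0, of 1] by auto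
    then have P1: "1 < P" using slope1[of h0 x0] by linarith
    then have Q1: "P < Q" using pq by (simp add: P_def Q_def)
    have FE: "F ` E = G -` E" using G(1,2) by (auto simp: image_iff intro!: bexI[of _ "G _"])
    have FEm: "F ` E \<in> sets lborel"
      unfolding FE using measurable_sets[OF borel_measurable_continuous_onI[OF Gc], of E] E by simp
    have GFE: "G ` (F ` E) = E" using G by (auto simp: image_image)
    have 1: "emeasure lborel (F ` E) \<le> ennreal P * emeasure lborel E"
    proof (rule lipschitz_image_measure_le[OF E FEm Fm Flip])
      show "0 \<le> P" using P1 by simp
      fix x d :: real assume "x \<in> E" "0 < d"
      then obtain h where h: "h \<noteq> 0" "\<bar>h\<bar> < d" "(F (x + h) - F x) / h < P" using lo by blast
      show "\<exists>c r. 0 < r \<and> r < d \<and> x \<in> cball c r \<and> F (c + r) - F (c - r) \<le> P * (2 * r)"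
      proof (rule exI[of _ "x + h/2"], rule exI[of _ "\<bar>h\<bar>/2"], intro conjI)
        have "x + h/2 + \<bar>h\<bar>/2 = (if h > 0 then x + h else x)" "x + h/2 - \<bar>h\<bar>/2 = (if h > 0 then x else x + h)"
          by (auto simp: field_simps)
        then show "F (x + h/2 + \<bar>h\<bar>/2) - F (x + h/2 - \<bar>h\<bar>/2) \<le> P * (2 * (\<bar>h\<bar>/2))"
          using h by (auto simp: field_simps split: if_splits)
      qed (use h in \<open>auto simp: dist_real_def\<close>)
    qed
    have 2: "emeasure lborel (G ` (F ` E)) \<le> ennreal (1/Q) * emeasure lborel (F ` E)"
    proof (rule lipschitz_image_measure_le[OF FEm _ G(3,4)])
      show "0 \<le> 1/Q" using P1 Q1 by simp
      show "G ` (F ` E) \<in> sets lborel" using GFE E by simp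
      fix y d :: real assume "y \<in> F ` E" "0 < d"
      then obtain x where x: "x \<in> E" "y = F x" by auto
      \<comment> \<open>The increment D of F over h is at most (2L + 1)|h|, so this bound on h keeps
        the image interval shorter than d.\<close>
      obtain h where h: "h \<noteq> 0" "\<bar>h\<bar> < d / (2 * L + 1)" "Q < (F (x + h) - F x) / h"
        using hi[OF x(1), of "d / (2 * L + 1)"] \<open>0 < d\<close> L by auto
      define D where "D = F (x + h) - F x"
      have Dd: "\<bar>D\<bar> < d" 
      proof -
        have "\<bar>D\<bar> \<le> (2 * L + 1) * \<bar>h\<bar>" using Flip[of "x+h" x] by (simp add: D_def)
        also have "\<dots> < d" using h(2) L by (simp add: field_simps)
        finally show ?thesis .
      qed
      have D0: "D \<noteq> 0" using h P1 Q1 by (auto simp: D_def)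
      have hD: "\<bar>h\<bar> \<le> 1/Q * \<bar>D\<bar>"
        using h P1 Q1 by (cases "h > 0") (auto simp: D_def field_simps abs_if not_less)
      have sg: "(0 < D) = (0 < h)"
        using Fm h(1) by (auto simp: D_def strict_mono_less)
      show "\<exists>c r. 0 < r \<and> r < d \<and> y \<in> cball c r \<and> G (c + r) - G (c - r) \<le> 1/Q * (2 * r)"
      proof (rule exI[of _ "y + D/2"], rule exI[of _ "\<bar>D\<bar>/2"], intro conjI)
        have yD: "y + D = F (x + h)" by (simp add: x D_def)
        have "y + D/2 + \<bar>D\<bar>/2 = (if D > 0 then y + D else y)" "y + D/2 - \<bar>D\<bar>/2 = (if D > 0 then y else y + D)"
          by (auto simp: field_simps)
        moreover have "G y = x" "G (y + D) = x + h" using G(1) x(2) yD by auto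
        ultimately have "G (y + D/2 + \<bar>D\<bar>/2) - G (y + D/2 - \<bar>D\<bar>/2) = \<bar>h\<bar>"
          using sg D0 h(1) by auto
        then show "G (y + D/2 + \<bar>D\<bar>/2) - G (y + D/2 - \<bar>D\<bar>/2) \<le> 1/Q * (2 * (\<bar>D\<bar>/2))"
          using hD by simp
      qed (use Dd D0 in \<open>auto simp: dist_real_def\<close>)
    qed
    have fin: "emeasure lborel E < \<infinity>"
    proof -
      have "emeasure lborel E \<le> emeasure lborel {-real n..real n}"
        by (rule emeasure_mono) (auto simp: E_def)
      also have "\<dots> < \<infinity>" by (simp add: emeasure_lborel_Icc_eq)
      finally show ?thesis .
    qed
    then obtain m where m: "emeasure lborel E = ennreal m" "m \<ge> 0"
      by (metis ennreal_cases infinity_ennreal_def less_irrefl)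
    \<comment> \<open>The two bounds combine to |E| <= (P/Q)|E| with P < Q. The restriction to a
      bounded interval makes |E| finite, hence zero.\<close>
    have "emeasure lborel E \<le> ennreal (1/Q) * (ennreal P * emeasure lborel E)"
      using order_trans[OF 2 mult_left_mono[OF 1]] GFE by simp
    moreover have "ennreal (1/Q) * (ennreal P * ennreal m) = ennreal (1/Q * (P * m))"
      using P1 Q1 m(2) by (simp add: ennreal_mult'[symmetric])
    ultimately have "ennreal m \<le> ennreal (1/Q * (P * m))" using m(1) by simp
    then have "m \<le> 1/Q * (P * m)" using m P1 Q1 by (subst (asm) ennreal_le_iff) auto
    then have "(Q - P) * m \<le> 0" using P1 Q1 by (simp add: field_simps)
    then have "m = 0" using Q1 m(2) mult_pos_pos[of "Q - P" m] by linarith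
    then show ?thesis unfolding E_def[symmetric] using m(1) E by (intro null_setsI) simp_all
  qed simp
  have "slope_osc f 1 p q = (\<Union>n. slope_osc f 1 p q \<inter> {-real n..real n})"
  proof -
    have "\<exists>n. x \<in> {-real n..real n}" for x
    proof -
      obtain n where "\<bar>x\<bar> \<le> real n" using real_arch_simple by blast
      then have "x \<in> {-real n..real n}" by (simp add: abs_le_iff)
      then show ?thesis ..
    qed
    then show ?thesis by blast
  qed
  also have "\<dots> \<in> null_sets lborel" by (rule null_sets_UN) (rule bd)
  finally show ?thesis .
qed

lemma lipschitz_bound_imp:
  fixes f :: "'a::euclidean_space \<Rightarrow> real"
  assumes lip: "\<And>x y. \<bar>f x - f y\<bar> \<le> L * norm (x - y)"
  shows "0 \<le> L" "continuous_on UNIV f"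
proof -
  obtain b :: 'a where b: "b \<in> Basis" using nonempty_Basis by blast
  show L: "0 \<le> L" using lip[of b 0] b abs_ge_zero[of "f b - f 0"] by (simp del: abs_ge_zero)
  have "L-lipschitz_on UNIV f"
    by (rule lipschitz_onI) (use lip L in \<open>auto simp: dist_norm\<close>)
  then show "continuous_on UNIV f" by (rule lipschitz_on_continuous_on)
qed

text \<open>By translation invariance along \<open>v\<close> and Tonelli, the bad set is null because its trace on
  every line parallel to \<open>v\<close> is.\<close>

lemma slope_osc_null:
  fixes f :: "'a::euclidean_space \<Rightarrow> real"
  assumes lip: "\<And>x y. \<bar>f x - f y\<bar> \<le> L * norm (x - y)" and pq: "p < q"
  shows "slope_osc f v p q \<in> null_sets lborel"
proof -
  have L: "0 \<le> L" and fc: "continuous_on UNIV f"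
    using lipschitz_bound_imp[OF lip] by auto
  define B where "B = slope_osc f v p q"
  have B[measurable]: "B \<in> sets borel" unfolding B_def by (rule slope_osc_borel[OF fc])
  have line: "(\<integral>\<^sup>+t. indicator {0..1} t * indicator B (t *\<^sub>R v + x) \<partial>lborel) = (0::ennreal)" for x
  proof -
    have "\<bar>f (x + s *\<^sub>R v) - f (x + t *\<^sub>R v)\<bar> \<le> (L * norm v) * \<bar>s - t\<bar>" for s t
      using lip[of "x + s *\<^sub>R v" "x + t *\<^sub>R v"]
      by (simp add: scaleR_diff_left[symmetric] mult.commute mult.left_commute)
    from slope_osc_null_real[OF this pq]
    have N: "slope_osc (\<lambda>t. f (x + t *\<^sub>R v)) 1 p q \<in> null_sets lborel" .
    have "t *\<^sub>R v + x \<in> B \<longleftrightarrow> t \<in> slope_osc (\<lambda>t. f (x + t *\<^sub>R v)) 1 p q" for t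
      unfolding B_def slope_osc_def by (simp add: algebra_simps)
    then have "AE t in lborel. t *\<^sub>R v + x \<notin> B"
      using AE_not_in[OF N] by simp
    then have "(\<integral>\<^sup>+t. indicator {0..1} t * indicator B (t *\<^sub>R v + x) \<partial>lborel) = (\<integral>\<^sup>+t. 0 \<partial>(lborel :: real measure))"
      by (intro nn_integral_cong_AE) (auto elim!: eventually_mono)
    then show ?thesis by simp
  qed
  have shift: "(\<integral>\<^sup>+x. indicator B (t *\<^sub>R v + x) \<partial>lborel) = emeasure lborel B" for t
  proof -
    have "emeasure lborel B = (\<integral>\<^sup>+x. indicator B x \<partial>distr lborel borel ((+) (t *\<^sub>R v)))"
      by (simp add: lborel_distr_plus)
    also have "\<dots> = (\<integral>\<^sup>+x. indicator B (t *\<^sub>R v + x) \<partial>lborel)"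
      by (rule nn_integral_distr) auto
    finally show ?thesis by simp
  qed
  have "emeasure lborel B = (\<integral>\<^sup>+t. indicator {0..1::real} t * emeasure lborel B \<partial>lborel)"
    by (simp add: nn_integral_multc)
  also have "\<dots> = (\<integral>\<^sup>+t. (\<integral>\<^sup>+x. indicator {0..1} t * indicator B (t *\<^sub>R v + x) \<partial>lborel) \<partial>lborel)"
    by (subst nn_integral_cmult) (auto simp: shift)
  also have "\<dots> = (\<integral>\<^sup>+x. (\<integral>\<^sup>+t. indicator {0..1} t * indicator B (t *\<^sub>R v + x) \<partial>lborel) \<partial>lborel)"
    by (rule lborel_pair.Fubini') measurable
  also have "\<dots> = 0" by (simp add: line)
  finally show ?thesis unfolding B_def[symmetric] by (intro null_setsI) auto
qed

section \<open>Directional derivatives of Lipschitz functions\<close>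

definition has_dir :: "('a::real_normed_vector \<Rightarrow> real) \<Rightarrow> 'a \<Rightarrow> 'a \<Rightarrow> real \<Rightarrow> bool" where
  "has_dir f v x l \<longleftrightarrow> ((\<lambda>h. (f (x + h *\<^sub>R v) - f x) / h) \<longlongrightarrow> l) (at 0)"

text \<open>The limit is the supremum of all eventual lower bounds of the quotients. A rational p
  above it is not such a bound, so for any rational q > p the absence of oscillation makes q an
  eventual upper bound.\<close>

lemma has_dir_of_no_osc:
  fixes f :: "'a::real_normed_vector \<Rightarrow> real"
  assumes lip: "\<And>x y. \<bar>f x - f y\<bar> \<le> L * norm (x - y)"
    and x: "\<And>p q. p \<in> \<rat> \<Longrightarrow> q \<in> \<rat> \<Longrightarrow> p < q \<Longrightarrow> x \<notin> slope_osc f v p q"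
  shows "\<exists>l. has_dir f v x l"
proof -
  define s where "s = (\<lambda>h. (f (x + h *\<^sub>R v) - f x) / h)"
  define b where "b = L * norm v"
  have bound: "\<bar>s h\<bar> \<le> b" if "h \<noteq> 0" for h
    using lip[of "x + h *\<^sub>R v" x] that by (simp add: s_def b_def abs_divide field_simps)
  have alt: "(\<forall>\<^sub>F h in at 0. p \<le> s h) \<or> (\<forall>\<^sub>F h in at 0. s h \<le> q)" if "p \<in> \<rat>" "q \<in> \<rat>" "p < q" for p q
  proof (rule ccontr)
    assume "\<not> ?thesis"
    then have "x \<in> slope_osc f v p q"
      unfolding slope_osc_def eventually_at s_def by (auto simp: dist_real_def not_le)
    with x that show False by blast
  qed
  define A where "A = {a. \<forall>\<^sub>F h in at 0. a \<le> s h}"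
  have nz: "\<forall>\<^sub>F h in at 0. h \<noteq> (0::real)" by (simp add: eventually_at_filter)
  have ne: "-b \<in> A"
  proof -
    have "\<forall>\<^sub>F h in at 0. -b \<le> s h"
      using nz by eventually_elim (use bound in \<open>simp add: abs_le_iff minus_le_iff\<close>)
    then show ?thesis by (simp add: A_def)
  qed
  have ub: "a \<le> b" if "a \<in> A" for a
  proof -
    have "\<forall>\<^sub>F h in at (0::real). a \<le> b"
      using eventually_conj[OF that[unfolded A_def mem_Collect_eq] nz]
      by (rule eventually_mono) (use bound in \<open>auto simp: abs_le_iff intro: order_trans\<close>)
    then show ?thesis by simp
  qed
  have bdd: "bdd_above A" using ub by (rule bdd_aboveI)
  define l where "l = Sup A"
  have "(s \<longlongrightarrow> l) (at 0)"
  proof (rule order_tendstoI)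
    fix a assume "a < l"
    then obtain a' where a': "a' \<in> A" "a < a'" using less_cSup_iff[of A a] ne bdd by (auto simp: l_def)
    then show "\<forall>\<^sub>F h in at 0. a < s h"
      unfolding A_def by (auto elim!: eventually_mono)
  next
    fix a assume "l < a"
    then obtain q where q: "q \<in> \<rat>" "l < q" "q < a" using Rats_dense_in_real by blast
    then obtain p where p: "p \<in> \<rat>" "l < p" "p < q" using Rats_dense_in_real by blast
    have "p \<notin> A" using cSup_upper[OF _ bdd, of p] p by (auto simp: l_def)
    then have "\<forall>\<^sub>F h in at 0. s h \<le> q" using alt[of p q] p q by (auto simp: A_def)
    then show "\<forall>\<^sub>F h in at 0. s h < a" by eventually_elim (use q in auto)
  qed
  then show ?thesis unfolding has_dir_def s_def by blast
qed

lemma AE_has_dir: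
  fixes f :: "'a::euclidean_space \<Rightarrow> real"
  assumes lip: "\<And>x y. \<bar>f x - f y\<bar> \<le> L * norm (x - y)"
  shows "AE x in lborel. \<exists>l. has_dir f v x l"
proof -
  have "AE x in lborel. \<forall>p\<in>\<rat>. \<forall>q\<in>\<rat>. p < q \<longrightarrow> x \<notin> slope_osc f v p q"
    unfolding AE_ball_countable[OF countable_rat]
    using AE_not_in[OF slope_osc_null[OF lip]] by auto
  then show ?thesis
    by (rule AE_mp) (auto intro!: AE_I2 has_dir_of_no_osc[OF lip])
qed

definition slopes :: "('a::real_normed_vector \<Rightarrow> real) \<Rightarrow> 'a \<Rightarrow> nat \<Rightarrow> 'a \<Rightarrow> real" where
  "slopes f v k x = (f (x + inverse (real (Suc k)) *\<^sub>R v) - f x) / inverse (real (Suc k))"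

text \<open>Sampling along h = 1/(k + 1) makes this Borel measurable on the whole space for
  continuous f; where the sampled quotients diverge, \<open>lim\<close> has an unspecified
  value.\<close>

definition dir_deriv :: "('a::real_normed_vector \<Rightarrow> real) \<Rightarrow> 'a \<Rightarrow> 'a \<Rightarrow> real" where
  "dir_deriv f v x = lim (\<lambda>k. slopes f v k x)"

lemma slopes_LIMSEQ:
  assumes "has_dir f v x l" shows "(\<lambda>k. slopes f v k x) \<longlonglongrightarrow> l"
proof -
  have "filterlim (\<lambda>k. inverse (real (Suc k))) (at 0) sequentially"
    unfolding filterlim_at using LIMSEQ_inverse_real_of_nat by auto
  from filterlim_compose[OF assms[unfolded has_dir_def] this]
  show ?thesis unfolding slopes_def .
qed

lemma has_dir_dir_deriv:
  assumes "has_dir f v x l" shows "dir_deriv f v x = l"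
  using slopes_LIMSEQ[OF assms] unfolding dir_deriv_def by (rule limI)

lemma slopes_bound:
  assumes lip: "\<And>x y. \<bar>f x - f y\<bar> \<le> L * norm (x - y)"
  shows "\<bar>slopes f v k x\<bar> \<le> L * norm v"
proof -
  define t where "t = inverse (real (Suc k))"
  have "0 < t" by (simp add: t_def)
  moreover have "slopes f v k x = (f (x + t *\<^sub>R v) - f x) / t" by (simp only: slopes_def t_def)
  ultimately show ?thesis
    using lip[of "x + t *\<^sub>R v" x]
    by (simp add: abs_divide divide_le_eq mult.commute mult.left_commute)
qed

lemma slopes_measurable:
  fixes f :: "'a::euclidean_space \<Rightarrow> real"
  assumes "continuous_on UNIV f" shows "slopes f v k \<in> borel_measurable borel"
proof -
  have "continuous_on UNIV (slopes f v k)"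
    unfolding slopes_def
    by (intro continuous_intros continuous_on_compose2[OF assms] assms) auto
  then show ?thesis by (rule borel_measurable_continuous_onI)
qed

text \<open>Continuous cutoffs converge to the indicator of a compact K, so h has integral zero over
  every compact set. If h > 1/(n + 1) held on a bounded set of positive measure, inner regularity
  would give a compact subset of positive measure on which h has positive integral. The conclusion
  is one-sided and is later applied to h and to -h.\<close>

lemma AE_zero_if_test_integrals_zero:
  fixes h :: "'a::euclidean_space \<Rightarrow> real"
  assumes h[measurable]: "h \<in> borel_measurable borel"
    and bd: "AE x in lborel. \<bar>h x\<bar> \<le> b"
    and test: "\<And>\<phi> R. continuous_on UNIV \<phi> \<Longrightarrow> (\<And>x. 0 \<le> \<phi> x) \<Longrightarrow> (\<And>x. \<phi> x \<le> 1) \<Longrightarrow>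
       (\<And>x. \<phi> x \<noteq> 0 \<Longrightarrow> norm x \<le> R) \<Longrightarrow> (\<integral>x. \<phi> x * h x \<partial>lborel) = 0"
  shows "AE x in lborel. h x \<le> 0"
proof -
  have cK: "(\<integral>x. indicator K x * h x \<partial>lborel) = 0" if K: "compact K" for K
  proof (cases "K = {}")
    case False
    obtain R where R: "\<And>x. x \<in> K \<Longrightarrow> norm x \<le> R" using compact_imp_bounded[OF K] by (auto simp: bounded_iff)
    have [measurable]: "K \<in> sets borel" using compact_imp_closed[OF K] by simp
    \<comment> \<open>Equal to 1 on K, supported within distance 1 of K, and tending to 0 at every
      point off K.\<close>
    define \<phi> where "\<phi> = (\<lambda>(j::nat) x. max 0 (1 - real (Suc j) * infdist x K))"
    have [measurable]: "\<phi> j \<in> borel_measurable borel" for j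
      unfolding \<phi>_def by (intro borel_measurable_continuous_onI continuous_intros)
    have supp: "norm x \<le> R + 1" if "\<phi> j x \<noteq> 0" for j x
    proof -
      have "real (Suc j) * infdist x K < 1" using that by (auto simp: \<phi>_def max_def split: if_splits)
      moreover have "1 * infdist x K \<le> real (Suc j) * infdist x K"
        by (rule mult_right_mono) (auto simp: infdist_nonneg)
      ultimately have "infdist x K < 1" by linarith
      moreover obtain y where "y \<in> K" "infdist x K = dist x y"
        using infdist_attains_inf[OF compact_imp_closed[OF K] False] by blast
      ultimately show ?thesis using R[of y] norm_triangle_ineq[of y "x - y"] by (simp add: dist_norm)
    qed
    have "(\<lambda>j. \<integral>x. \<phi> j x * h x \<partial>lborel) \<longlonglongrightarrow> (\<integral>x. indicator K x * h x \<partial>lborel)"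
    proof (rule integral_dominated_convergence[where w="\<lambda>x. indicator (cball 0 (R+1)) x * b"])
      show "integrable lborel (\<lambda>x. indicator (cball 0 (R+1)) x * b :: real)"
        using emeasure_lborel_cball_finite[of 0 "R+1"]
        by (intro integrable_mult_left integrable_real_indicator) auto
      show "AE x in lborel. (\<lambda>j. \<phi> j x * h x) \<longlonglongrightarrow> indicator K x * h x"
      proof (rule AE_I2)
        fix x :: 'a
        have "(\<lambda>j. \<phi> j x) \<longlonglongrightarrow> indicator K x"
        proof (cases "x \<in> K")
          case True then show ?thesis by (simp add: \<phi>_def)
        next
          case notin: False
          then have pos: "infdist x K > 0"
            using infdist_pos_not_in_closed[OF compact_imp_closed[OF K] False] by auto
          obtain n :: nat where n: "1 / infdist x K < n" using reals_Archimedean2 by blast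
          have "\<forall>\<^sub>F j in sequentially. \<phi> j x = 0"
            using eventually_ge_at_top[of n]
          proof eventually_elim
            case (elim j)
            have "1 < real n * infdist x K" using n pos by (simp add: field_simps)
            also have "\<dots> \<le> real (Suc j) * infdist x K" using elim pos by (intro mult_right_mono) auto
            finally show ?case by (simp add: \<phi>_def)
          qed
          then show ?thesis using notin by (simp add: tendsto_eventually)
        qed
        then show "(\<lambda>j. \<phi> j x * h x) \<longlonglongrightarrow> indicator K x * h x" by (intro tendsto_intros)
      qed
      show "AE x in lborel. norm (\<phi> j x * h x) \<le> indicator (cball 0 (R+1)) x * b" for j
        using bd
      proof eventually_elim
        case (elim x)
        have "\<phi> j x \<le> 1" "0 \<le> \<phi> j x" by (auto simp: \<phi>_def infdist_nonneg)
        then have "\<phi> j x * \<bar>h x\<bar> \<le> 1 * b" using elim by (intro mult_mono) auto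
        then show ?case using supp[of j x] \<open>0 \<le> \<phi> j x\<close>
          by (cases "\<phi> j x = 0") (auto simp: abs_mult indicator_def intro: order_trans[OF abs_ge_zero elim])
      qed
    qed measurable
    moreover have "(\<integral>x. \<phi> j x * h x \<partial>lborel) = 0" for j
    proof (rule test[where R="R+1"])
      show "continuous_on UNIV (\<phi> j)" unfolding \<phi>_def by (intro continuous_intros)
      show "norm x \<le> R + 1" if "\<phi> j x \<noteq> 0" for x using supp[OF that] .
    qed (auto simp: \<phi>_def infdist_nonneg)
    ultimately show ?thesis by (simp add: LIMSEQ_const_iff)
  qed simp
  have null: "{x. 1 / real (Suc n) < h x} \<inter> cball 0 (real n) \<in> null_sets lborel" for n
  proof (rule ccontr)
    define E where "E = {x. 1 / real (Suc n) < h x} \<inter> cball 0 (real n)"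
    assume "\<not> ?thesis"
    moreover have E[measurable]: "E \<in> sets lborel" by (simp add: E_def)
    ultimately have pos: "emeasure lborel E \<noteq> 0" by (auto simp: null_sets_def E_def)
    have fin: "emeasure lborel E < \<infinity>"
      by (rule le_less_trans[OF emeasure_mono emeasure_lborel_cball_finite[of 0 "real n"]]) (auto simp: E_def)
    define m where "m = measure lborel E"
    have m1: "emeasure lborel E = ennreal m"
      unfolding m_def using fin by (intro emeasure_eq_ennreal_measure) simp
    then have "m \<noteq> 0" using pos by auto
    then have m: "emeasure lborel E = ennreal m" "m > 0"
      using m1 measure_nonneg[of lborel E] unfolding m_def by linarith+
    \<comment> \<open>Removing less than the full mass m of E leaves a compact set of positive
      measure.\<close>
    obtain K where K: "closed K" "K \<subseteq> E" "E - K \<in> lmeasurable" "emeasure lebesgue (E - K) < ennreal m"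
      by (rule sets_lebesgue_inner_closed[OF sets_completionI_sets[OF E] m(2)])
    have cpt: "compact K"
      using K(1,2) bounded_subset[OF bounded_cball, of K 0 "real n"] by (auto simp: compact_eq_bounded_closed E_def)
    have Kb: "K \<in> sets borel" using K(1) by simp
    have "emeasure lborel E \<le> emeasure lborel K + emeasure lborel (E - K)"
      using K(2) Kb E emeasure_subadditive[of K lborel "E - K"] by (simp add: Un_absorb1)
    moreover have "emeasure lborel (E - K) < ennreal m" using K(4) Kb E by simp
    ultimately have "emeasure lborel K \<noteq> 0" using m by (metis add_0 leD)
    moreover have Kf: "emeasure lborel K < \<infinity>"
      by (rule le_less_trans[OF emeasure_mono fin]) (use K(2) E in auto)
    ultimately have mK: "measure lborel K > 0"
      by (simp add: measure_def enn2real_positive_iff zero_less_iff_neq_zero)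
    have ii: "integrable lborel (\<lambda>x. indicator K x :: real)" using Kb Kf by auto
    have "measure lborel K * (1 / real (Suc n)) = (\<integral>x. indicator K x * (1 / real (Suc n)) \<partial>lborel)"
      using Kb by simp
    also have "\<dots> \<le> (\<integral>x. indicator K x * h x \<partial>lborel)"
    proof (rule integral_mono_AE)
      show "integrable lborel (\<lambda>x. indicator K x * (1 / real (Suc n)))" using ii by (rule integrable_mult_left)
      show "integrable lborel (\<lambda>x. indicator K x * h x)"
      proof (rule Bochner_Integration.integrable_bound)
        show "integrable lborel (\<lambda>x. indicator K x * b)" using ii by (rule integrable_mult_left)
        show "AE x in lborel. norm (indicator K x * h x) \<le> norm (indicator K x * b)"
          using bd by eventually_elim (auto simp: indicator_def)
        show "(\<lambda>x. indicator K x * h x) \<in> borel_measurable lborel" using Kb by measurable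
      qed
      show "AE x in lborel. indicator K x * (1 / real (Suc n)) \<le> indicator K x * h x"
        using K(2) by (intro AE_I2) (auto simp: indicator_def E_def)
    qed
    finally show False using cK[OF cpt] mK by (simp add: field_simps)
  qed
  have "AE x in lborel. \<forall>n. x \<notin> {x. 1 / real (Suc n) < h x} \<inter> cball 0 (real n)"
    unfolding AE_all_countable using AE_not_in[OF null] by auto
  then show ?thesis
  proof eventually_elim
    case (elim x)
    show ?case
    proof (rule ccontr)
      assume "\<not> h x \<le> 0"
      then have "0 < h x" by simp
      then obtain n1 where n1: "inverse (real (Suc n1)) < h x" using reals_Archimedean by blast
      obtain n2 :: nat where n2: "norm x \<le> real n2" using real_arch_simple by blast
      have "1 / real (Suc (max n1 n2)) \<le> inverse (real (Suc n1))" by (simp add: field_simps)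
      then have "x \<in> {x. 1 / real (Suc (max n1 n2)) < h x} \<inter> cball 0 (real (max n1 n2))"
        using n1 n2 by (simp add: less_le_trans[of _ _ "h x"] le_less_trans[of _ "inverse (real (Suc n1))"])
      with elim show False by blast
    qed
  qed
qed

text \<open>Additivity in the direction is tested against compactly supported functions: the shift by a
  multiple of \<open>w\<close> in the difference quotient is moved to the test function.\<close>

lemma AE_dir_deriv_add:
  fixes f :: "'a::euclidean_space \<Rightarrow> real"
  assumes lip: "\<And>x y. \<bar>f x - f y\<bar> \<le> L * norm (x - y)"
  shows "AE x in lborel. dir_deriv f (v + w) x = dir_deriv f v x + dir_deriv f w x"
proof -
  have L: "0 \<le> L" and fc: "continuous_on UNIV f"
    using lipschitz_bound_imp[OF lip] by auto
  have sm[measurable]: "slopes f u k \<in> borel_measurable borel" for u k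
    by (rule slopes_measurable[OF fc])
  have dm[measurable]: "dir_deriv f u \<in> borel_measurable borel" for u
    unfolding dir_deriv_def by measurable
  have lims: "AE x in lborel. (\<lambda>k. slopes f u k x) \<longlonglongrightarrow> dir_deriv f u x" for u
    using AE_has_dir[OF lip, of u]
    by eventually_elim (use slopes_LIMSEQ has_dir_dir_deriv in blast)
  have dbd: "AE x in lborel. \<bar>dir_deriv f u x\<bar> \<le> L * norm u" for u
    using lims[of u]
  proof eventually_elim
    case (elim x)
    then have "(\<lambda>k. \<bar>slopes f u k x\<bar>) \<longlonglongrightarrow> \<bar>dir_deriv f u x\<bar>" by (rule tendsto_rabs)
    then show ?case by (rule LIMSEQ_le_const2) (use slopes_bound[OF lip] in blast)
  qed
  have split: "slopes f (v + w) k x = slopes f v k (x + inverse (real (Suc k)) *\<^sub>R w) + slopes f w k x" for k x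
    by (simp add: slopes_def add_divide_distrib[symmetric] diff_divide_distrib[symmetric] algebra_simps)
  define h where "h = (\<lambda>x. dir_deriv f (v + w) x - dir_deriv f v x - dir_deriv f w x)"
  have hm[measurable]: "h \<in> borel_measurable borel" unfolding h_def by measurable
  have hbd: "AE x in lborel. \<bar>h x\<bar> \<le> L * norm (v + w) + L * norm v + L * norm w"
    using dbd[of "v + w"] dbd[of v] dbd[of w]
    by eventually_elim (auto simp: h_def abs_le_iff)
  have test: "(\<integral>x. \<phi> x * h x \<partial>lborel) = 0"
    if \<phi>: "continuous_on UNIV \<phi>" "\<And>x. 0 \<le> \<phi> x" "\<And>x. \<phi> x \<le> 1" "\<And>x. \<phi> x \<noteq> 0 \<Longrightarrow> norm x \<le> R" for \<phi> R
  proof -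
    have [measurable]: "\<phi> \<in> borel_measurable borel" using \<phi>(1) by (rule borel_measurable_continuous_onI)
    have cb: "integrable lborel (\<lambda>x. indicator (cball (0::'a) S) x * b :: real)" for S b
      using emeasure_lborel_cball_finite[of 0 S]
      by (intro integrable_mult_left integrable_real_indicator) auto
    \<comment> \<open>Used with z = w for the term whose shift has been moved to the test function
      and with z = 0 for the others. The dominating function is L |u| on a ball enlarged by |z|,
      since the shifts are at most |z|.\<close>
    have conv: "(\<lambda>k. \<integral>x. \<phi> (x - inverse (real (Suc k)) *\<^sub>R z) * slopes f u k x \<partial>lborel)
                  \<longlonglongrightarrow> (\<integral>x. \<phi> x * dir_deriv f u x \<partial>lborel) \<and>
        (\<forall>k. integrable lborel (\<lambda>x. \<phi> (x - inverse (real (Suc k)) *\<^sub>R z) * slopes f u k x)) \<and>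
        integrable lborel (\<lambda>x. \<phi> x * dir_deriv f u x)" for u z
    proof -
      have t0: "(\<lambda>k. inverse (real (Suc k))) \<longlonglongrightarrow> 0" by (rule LIMSEQ_inverse_real_of_nat)
      have meas: "(\<lambda>x. \<phi> (x - inverse (real (Suc k)) *\<^sub>R z) * slopes f u k x) \<in> borel_measurable lborel" for k
        by measurable
      have meas': "(\<lambda>x. \<phi> x * dir_deriv f u x) \<in> borel_measurable lborel" by measurable
      have lim: "AE x in lborel. (\<lambda>k. \<phi> (x - inverse (real (Suc k)) *\<^sub>R z) * slopes f u k x) \<longlonglongrightarrow> \<phi> x * dir_deriv f u x"
        using lims[of u]
      proof eventually_elim
        case (elim x)
        have "(\<lambda>k. x - inverse (real (Suc k)) *\<^sub>R z) \<longlonglongrightarrow> x - 0 *\<^sub>R z"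
          by (intro tendsto_intros t0)
        then have "(\<lambda>k. \<phi> (x - inverse (real (Suc k)) *\<^sub>R z)) \<longlonglongrightarrow> \<phi> (x - 0 *\<^sub>R z)"
          using \<phi>(1) by (metis UNIV_I continuous_on_eq_continuous_at continuous_on_tendsto_compose eventually_sequentiallyI open_UNIV)
        then show ?case using elim by (auto intro!: tendsto_mult)
      qed
      have bound: "AE x in lborel. norm (\<phi> (x - inverse (real (Suc k)) *\<^sub>R z) * slopes f u k x)
           \<le> indicator (cball 0 (R + norm z)) x * (L * norm u)" for k
      proof (rule AE_I2)
        fix x
        show "norm (\<phi> (x - inverse (real (Suc k)) *\<^sub>R z) * slopes f u k x)
           \<le> indicator (cball 0 (R + norm z)) x * (L * norm u)"
        proof (cases "\<phi> (x - inverse (real (Suc k)) *\<^sub>R z) = 0")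
          case True then show ?thesis using L by simp
        next
          case False
          have "norm (inverse (real (Suc k)) *\<^sub>R z) \<le> 1 * norm z"
            unfolding norm_scaleR by (rule mult_right_mono) (auto simp: inverse_le_1_iff)
          then have "norm x \<le> R + norm z"
            using \<phi>(4)[OF False] norm_triangle_ineq[of "x - inverse (real (Suc k)) *\<^sub>R z" "inverse (real (Suc k)) *\<^sub>R z"]
            by simp
          moreover have "\<bar>\<phi> (x - inverse (real (Suc k)) *\<^sub>R z)\<bar> * \<bar>slopes f u k x\<bar> \<le> 1 * (L * norm u)"
            using \<phi>(2,3) slopes_bound[OF lip] by (intro mult_mono) auto
          ultimately show ?thesis by (simp add: abs_mult)
        qed
      qed
      show ?thesis
        using integral_dominated_convergence[OF meas' meas cb lim bound]
          integrable_dominated_convergence[OF meas' meas cb lim bound]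
          integrable_dominated_convergence2[OF meas' meas cb lim bound] by blast
    qed
    have shift: "(\<integral>x. \<phi> (x - c) * slopes f v k x \<partial>lborel) = (\<integral>x. \<phi> x * slopes f v k (x + c) \<partial>lborel)" 
      and shifti: "integrable lborel (\<lambda>x. \<phi> (x - c) * slopes f v k x) \<Longrightarrow> integrable lborel (\<lambda>x. \<phi> x * slopes f v k (x + c))" for c k
    proof -
      have [measurable]: "(\<lambda>x. \<phi> (x - c) * slopes f v k x) \<in> borel_measurable borel" by measurable
      have "(\<integral>x. \<phi> (x - c) * slopes f v k x \<partial>lborel) = (\<integral>x. \<phi> (x - c) * slopes f v k x \<partial>distr lborel borel ((+) c))"
        by (simp add: lborel_distr_plus)
      also have "\<dots> = (\<integral>x. \<phi> (c + x - c) * slopes f v k (c + x) \<partial>lborel)"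
        by (rule integral_distr) auto
      finally show "(\<integral>x. \<phi> (x - c) * slopes f v k x \<partial>lborel) = (\<integral>x. \<phi> x * slopes f v k (x + c) \<partial>lborel)"
        by (simp add: add.commute)
      assume "integrable lborel (\<lambda>x. \<phi> (x - c) * slopes f v k x)"
      then have "integrable (distr lborel borel ((+) c)) (\<lambda>x. \<phi> (x - c) * slopes f v k x)"
        by (simp add: lborel_distr_plus)
      then have "integrable lborel (\<lambda>x. \<phi> (c + x - c) * slopes f v k (c + x))"
        by (subst (asm) integrable_distr_eq) auto
      then show "integrable lborel (\<lambda>x. \<phi> x * slopes f v k (x + c))"
        by (simp add: add.commute)
    qed
    have "(\<integral>x. \<phi> x * slopes f (v + w) k x \<partial>lborel) =
        (\<integral>x. \<phi> (x - inverse (real (Suc k)) *\<^sub>R w) * slopes f v k x \<partial>lborel) + (\<integral>x. \<phi> x * slopes f w k x \<partial>lborel)" for k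
    proof -
      have i1: "integrable lborel (\<lambda>x. \<phi> x * slopes f v k (x + inverse (real (Suc k)) *\<^sub>R w))"
        by (rule shifti) (use conv[of w v] in blast)
      have i2: "integrable lborel (\<lambda>x. \<phi> x * slopes f w k x)"
        using conv[of 0 w] by simp
      show ?thesis
        unfolding split shift distrib_left by (rule Bochner_Integration.integral_add[OF i1 i2])
    qed
    then have "(\<lambda>k. \<integral>x. \<phi> x * slopes f (v + w) k x \<partial>lborel) \<longlonglongrightarrow>
       (\<integral>x. \<phi> x * dir_deriv f v x \<partial>lborel) + (\<integral>x. \<phi> x * dir_deriv f w x \<partial>lborel)"
      using tendsto_add[OF conjunct1[OF conv[of w v]] conjunct1[OF conv[of 0 w]]] by simp
    moreover have "(\<lambda>k. \<integral>x. \<phi> x * slopes f (v + w) k x \<partial>lborel) \<longlonglongrightarrow> (\<integral>x. \<phi> x * dir_deriv f (v + w) x \<partial>lborel)"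
      using conv[of 0 "v + w"] by simp
    ultimately have eq: "(\<integral>x. \<phi> x * dir_deriv f (v + w) x \<partial>lborel) =
       (\<integral>x. \<phi> x * dir_deriv f v x \<partial>lborel) + (\<integral>x. \<phi> x * dir_deriv f w x \<partial>lborel)"
      using LIMSEQ_unique by blast
    have i: "integrable lborel (\<lambda>x. \<phi> x * dir_deriv f u x)" for u using conv by blast
    show ?thesis
      unfolding h_def right_diff_distrib
      by (subst Bochner_Integration.integral_diff, (intro Bochner_Integration.integrable_diff i)+)+ (simp add: eq)
  qed
  have "AE x in lborel. h x \<le> 0"
    by (rule AE_zero_if_test_integrals_zero[OF hm hbd test])
  moreover have "AE x in lborel. - h x \<le> 0"
  proof (rule AE_zero_if_test_integrals_zero)
    show "AE x in lborel. \<bar>- h x\<bar> \<le> L * norm (v + w) + L * norm v + L * norm w" using hbd by simp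
    show "(\<integral>x. \<phi> x * - h x \<partial>lborel) = 0"
      if "continuous_on UNIV \<phi>" "\<And>x. 0 \<le> \<phi> x" "\<And>x. \<phi> x \<le> 1" "\<And>x. \<phi> x \<noteq> 0 \<Longrightarrow> norm x \<le> R" for \<phi> R
      using test[OF that] by simp
  qed measurable
  ultimately show ?thesis
    by eventually_elim (simp add: h_def)
qed

lemma has_dir_scaleR:
  assumes "has_dir f v x l" shows "has_dir f (c *\<^sub>R v) x (c * l)"
proof (cases "c = 0")
  case True then show ?thesis by (simp add: has_dir_def)
next
  case False
  have "filterlim (\<lambda>h. h * c) (at 0) (at 0)"
    unfolding filterlim_at using False
    by (auto simp: eventually_at_filter intro!: tendsto_eq_intros)
  from filterlim_compose[OF assms[unfolded has_dir_def] this]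
  have "((\<lambda>h. c * ((f (x + (h * c) *\<^sub>R v) - f x) / (h * c))) \<longlongrightarrow> c * l) (at 0)"
    by (intro tendsto_intros)
  then show ?thesis using False by (simp add: has_dir_def)
qed

text \<open>Induction over the basis vectors, adding one component at a time. The exceptional null
  set depends on v; \<open>rademacher_real\<close> uses only countably many directions.\<close>

lemma AE_has_dir_inner:
  fixes f :: "'a::euclidean_space \<Rightarrow> real"
  assumes lip: "\<And>x y. \<bar>f x - f y\<bar> \<le> L * norm (x - y)"
  shows "AE x in lborel. has_dir f v x (v \<bullet> (\<Sum>b\<in>Basis. dir_deriv f b x *\<^sub>R b))"
proof -
  have "AE x in lborel. has_dir f (\<Sum>b\<in>B. (v \<bullet> b) *\<^sub>R b) x (\<Sum>b\<in>B. (v \<bullet> b) * dir_deriv f b x)"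
    if "finite B" for B
    using that
  proof (induction B)
    case empty then show ?case by (simp add: has_dir_def)
  next
    case (insert a B)
    show ?case
      using insert.IH AE_has_dir[OF lip, of a] 
        AE_dir_deriv_add[OF lip, of "(v \<bullet> a) *\<^sub>R a" "\<Sum>b\<in>B. (v \<bullet> b) *\<^sub>R b"]
        AE_has_dir[OF lip, of "\<Sum>b\<in>insert a B. (v \<bullet> b) *\<^sub>R b"]
    proof eventually_elim
      case (elim x)
      then obtain l where l: "has_dir f (\<Sum>b\<in>insert a B. (v \<bullet> b) *\<^sub>R b) x l" by blast
      have a: "has_dir f ((v \<bullet> a) *\<^sub>R a) x ((v \<bullet> a) * dir_deriv f a x)"
        using elim(2) has_dir_dir_deriv has_dir_scaleR by blast
      have "l = (v \<bullet> a) * dir_deriv f a x + (\<Sum>b\<in>B. (v \<bullet> b) * dir_deriv f b x)"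
        using elim(3) has_dir_dir_deriv[OF l] has_dir_dir_deriv[OF a] has_dir_dir_deriv[OF elim(1)] insert.hyps
        by simp
      then show ?case using l insert.hyps by simp
    qed
  qed
  from this[OF finite_Basis]
  have "AE x in lborel. has_dir f v x (\<Sum>b\<in>Basis. (v \<bullet> b) * dir_deriv f b x)"
    unfolding euclidean_representation .
  then show ?thesis
    by (simp add: inner_sum_right mult.commute)
qed

text \<open>Almost everywhere the directional derivatives exist and are given by one vector g for a
  countable dense set of directions. Compactness of the unit sphere reduces to finitely many of them
  at each accuracy, and the Lipschitz bound controls the other directions, so the limit is uniform
  in the direction.\<close>

lemma rademacher_real:
  fixes f :: "'a::euclidean_space \<Rightarrow> real"
  assumes lip: "\<And>x y. \<bar>f x - f y\<bar> \<le> L * norm (x - y)"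
  shows "AE x in lborel. f differentiable at x"
proof -
  have L: "0 \<le> L" using lipschitz_bound_imp(1)[OF lip] .
  obtain V :: "'a set" where V: "countable V" "closure V = UNIV"
    using separable[of "UNIV :: 'a set"] by (metis UNIV_I subsetI subset_antisym)
  have "AE x in lborel. \<forall>v\<in>V. has_dir f v x (v \<bullet> (\<Sum>b\<in>Basis. dir_deriv f b x *\<^sub>R b))"
    unfolding AE_ball_countable[OF V(1)] using AE_has_dir_inner[OF lip] by blast
  then show ?thesis
  proof eventually_elim
    case (elim x)
    define g where "g = (\<Sum>b\<in>Basis. dir_deriv f b x *\<^sub>R b)"
    have "(f has_derivative (\<lambda>h. h \<bullet> g)) (at x)"
      unfolding has_derivative_at_alt
    proof (intro conjI allI impI)
      show "bounded_linear (\<lambda>h. h \<bullet> g)" by (rule bounded_linear_inner_left)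
      fix e :: real assume "0 < e"
      \<comment> \<open>Three errors add up per unit length: \<open>L * \<epsilon>\<close> from
        replacing the direction in f, \<open>\<epsilon>\<close> from the quotient, and
        \<open>\<epsilon> * norm g\<close> from replacing the direction in the linear part.\<close>
      define \<epsilon> where "\<epsilon> = e / (L + norm g + 1)"
      have \<epsilon>: "0 < \<epsilon>" "\<epsilon> * (L + norm g + 1) = e"
        using \<open>0 < e\<close> L by (auto simp: \<epsilon>_def add_nonneg_pos add_nonneg_nonneg intro!: divide_pos_pos) (smt (verit) norm_ge_zero)
      have "sphere 0 1 \<subseteq> (\<Union>v\<in>V. ball v \<epsilon>)"
      proof
        fix u :: 'a
        have "u \<in> closure V" using V by simp
        then show "u \<in> (\<Union>v\<in>V. ball v \<epsilon>)" using \<epsilon>(1) unfolding closure_approachable by auto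
      qed
      then obtain F where F: "F \<subseteq> V" "finite F" "sphere 0 1 \<subseteq> (\<Union>v\<in>F. ball v \<epsilon>)"
        using compactE_image[OF compact_sphere, of V "\<lambda>v. ball v \<epsilon>"] by (metis open_ball)
      have "\<forall>\<^sub>F h in at 0. \<forall>v\<in>F. \<bar>(f (x + h *\<^sub>R v) - f x) / h - v \<bullet> g\<bar> < \<epsilon>"
      proof (rule eventually_ball_finite[OF F(2)], rule ballI)
        fix v assume "v \<in> F"
        then have "has_dir f v x (v \<bullet> g)" using elim F(1) by (auto simp: g_def)
        then show "\<forall>\<^sub>F h in at 0. \<bar>(f (x + h *\<^sub>R v) - f x) / h - v \<bullet> g\<bar> < \<epsilon>"
          using \<epsilon>(1) unfolding has_dir_def tendsto_iff dist_real_def by blast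
      qed
      then obtain d where d: "d > 0" and dd: "\<And>h v. h \<noteq> 0 \<Longrightarrow> \<bar>h\<bar> < d \<Longrightarrow> v \<in> F \<Longrightarrow>
           \<bar>(f (x + h *\<^sub>R v) - f x) / h - v \<bullet> g\<bar> < \<epsilon>"
        unfolding eventually_at by (auto simp: dist_real_def)
      show "\<exists>d>0. \<forall>y. norm (y - x) < d \<longrightarrow> norm (f y - f x - (y - x) \<bullet> g) \<le> e * norm (y - x)"
      proof (intro exI conjI allI impI)
        fix y assume y: "norm (y - x) < d"
        show "norm (f y - f x - (y - x) \<bullet> g) \<le> e * norm (y - x)"
        proof (cases "y = x")
          case False
          define t where "t = norm (y - x)"
          define u where "u = (1 / t) *\<^sub>R (y - x)"
          have t: "t > 0" "t < d" using False y by (auto simp: t_def)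
          have u: "norm u = 1" "y = x + t *\<^sub>R u" using t False by (auto simp: u_def t_def)
          obtain v where v: "v \<in> F" "dist v u < \<epsilon>" using F(3) u(1) by (force simp: subset_iff)
          have 1: "\<bar>f y - f (x + t *\<^sub>R v)\<bar> \<le> t * (L * \<epsilon>)"
          proof -
            have "\<bar>f y - f (x + t *\<^sub>R v)\<bar> \<le> L * norm (t *\<^sub>R (u - v))"
              using lip[of y "x + t *\<^sub>R v"] by (simp add: u(2) scaleR_diff_right)
            also have "\<dots> = t * (L * dist v u)" using t by (simp add: dist_norm norm_minus_commute)
            also have "\<dots> \<le> t * (L * \<epsilon>)" using v t L by (intro mult_left_mono) auto
            finally show ?thesis .
          qed
          have 2: "\<bar>f (x + t *\<^sub>R v) - f x - t * (v \<bullet> g)\<bar> \<le> t * \<epsilon>"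
          proof -
            have "f (x + t *\<^sub>R v) - f x - t * (v \<bullet> g) = t * ((f (x + t *\<^sub>R v) - f x) / t - v \<bullet> g)"
              using t by (simp add: field_simps)
            then show ?thesis using dd[of t v] t v(1) by (simp add: abs_mult)
          qed
          have 3: "\<bar>t * (v \<bullet> g) - t * (u \<bullet> g)\<bar> \<le> t * (\<epsilon> * norm g)"
          proof -
            have "\<bar>t * (v \<bullet> g) - t * (u \<bullet> g)\<bar> = t * \<bar>(v - u) \<bullet> g\<bar>"
              using t by (simp add: abs_mult inner_diff_left right_diff_distrib[symmetric])
            also have "\<dots> \<le> t * (norm (v - u) * norm g)"
              using t by (intro mult_left_mono Cauchy_Schwarz_ineq2) auto
            also have "\<dots> \<le> t * (\<epsilon> * norm g)"
              using t v by (intro mult_left_mono mult_right_mono) (auto simp: dist_norm)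
            finally show ?thesis .
          qed
          have "\<bar>f y - f x - t * (u \<bullet> g)\<bar> \<le> t * (L * \<epsilon>) + t * \<epsilon> + t * (\<epsilon> * norm g)"
            using 1 2 3 by linarith
          also have "\<dots> = \<epsilon> * (L + norm g + 1) * t" by (simp add: algebra_simps)
          finally show ?thesis using t u \<epsilon>(2) by (simp add: t_def[symmetric])
        qed simp
      qed (rule d)
    qed
    then show ?case unfolding differentiable_def by blast
  qed
qed

theorem rademacher:
  fixes f :: "'a::euclidean_space \<Rightarrow> 'b::euclidean_space"
  assumes "L-lipschitz_on UNIV f"
  shows "AE x in lborel. f differentiable at x"
proof -
  have "AE x in lborel. (\<lambda>x. f x \<bullet> b) differentiable at x" if "b \<in> Basis" for b
  proof (rule rademacher_real)
    fix x y
    have "\<bar>f x \<bullet> b - f y \<bullet> b\<bar> \<le> norm (f x - f y)"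
      using Basis_le_norm[OF that, of "f x - f y"] by (simp add: inner_diff_left)
    then show "\<bar>f x \<bullet> b - f y \<bullet> b\<bar> \<le> L * norm (x - y)"
      using lipschitz_onD[OF assms, of x y] by (simp add: dist_norm)
  qed
  then have "AE x in lborel. \<forall>b\<in>Basis. (\<lambda>x. f x \<bullet> b) differentiable at x"
    by (subst AE_ball_countable) (auto simp: countable_finite)
  then show ?thesis
    by (simp add: differentiable_componentwise_within[symmetric])
qed

subsection \<open>Symmetric matrices and the Pucci operator\<close>

text \<open>A unit vector maximizing x . f x on the orthogonal complement of B is an eigenvector.
  Symmetry of f and the eigenvector property of the elements of B make this complement
  invariant.\<close>

lemma symmetric_eigenvector_in_orthogonal_complement:
  fixes f :: "'a::euclidean_space \<Rightarrow> 'a"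
  assumes lin: "linear f" and sym: "\<And>x y. f x \<bullet> y = x \<bullet> f y"
    and eig: "\<And>b. b \<in> B \<Longrightarrow> \<exists>c. f b = c *\<^sub>R b"
    and span: "span B \<noteq> UNIV"
  shows "\<exists>u c. norm u = 1 \<and> (\<forall>b\<in>B. u \<bullet> b = 0) \<and> f u = c *\<^sub>R u"
proof -
  define S where "S = {x. \<forall>b\<in>B. x \<bullet> b = 0}"
  have S: "subspace S" unfolding S_def subspace_def by (auto simp: inner_add_left)
  have clS: "closed S"
  proof -
    have "S = (\<Inter>b\<in>B. {x. x \<bullet> b = 0})" by (auto simp: S_def)
    then show ?thesis by (auto intro!: closed_INT closed_Collect_eq continuous_intros)
  qed
  have inv: "f x \<in> S" if "x \<in> S" for x
  proof -
    have "f x \<bullet> b = 0" if "b \<in> B" for b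
      using eig[OF that] \<open>x \<in> S\<close> that by (auto simp: sym S_def)
    then show ?thesis by (simp add: S_def)
  qed
  obtain z where z: "z \<noteq> 0" "z \<in> S"
  proof -
    have "span B \<subset> span UNIV" using span by (auto simp: psubset_eq span_UNIV)
    from orthogonal_to_subspace_exists_gen[OF this]
    obtain z where "z \<noteq> 0" "\<And>y. y \<in> span B \<Longrightarrow> orthogonal z y" by blast
    then show thesis using that[of z] span_base by (auto simp: S_def orthogonal_def)
  qed
  define C where "C = S \<inter> sphere 0 1"
  have "compact C" unfolding C_def using clS by (intro closed_Int_compact) auto
  moreover have "(1 / norm z) *\<^sub>R z \<in> C"
    using z S by (auto simp: C_def subspace_scale)
  moreover have "continuous_on C (\<lambda>x. x \<bullet> f x)"
    by (intro continuous_intros linear_continuous_on lin[unfolded linear_conv_bounded_linear])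
  ultimately obtain x where x: "x \<in> C" "\<And>y. y \<in> C \<Longrightarrow> y \<bullet> f y \<le> x \<bullet> f x"
    using continuous_attains_sup[of C "\<lambda>x. x \<bullet> f x"] by blast
  have xS: "x \<in> S" and nx: "norm x = 1" using x by (auto simp: C_def)
  define m where "m = x \<bullet> f x"
  have up: "y \<bullet> f y \<le> m * (y \<bullet> y)" if "y \<in> S" for y
  proof (cases "y = 0")
    case False
    then have "(1 / norm y) *\<^sub>R y \<in> C" using that S by (auto simp: C_def subspace_scale)
    from x(2)[OF this] have "(y \<bullet> f y) / (norm y * norm y) \<le> m"
      using linear_scale[OF lin] by (simp add: m_def)
    then show ?thesis using False
      by (simp add: divide_le_eq dot_square_norm power2_eq_square)
  qed (use linear_0[OF lin] in simp)
  \<comment> \<open>First variation: moving from x to x + t w would give 2 t c <= t^2 K for every t,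
    and t = c/K contradicts c being nonzero. The summand 1 in K makes K positive.\<close>
  have orth: "w \<bullet> f x = 0" if w: "w \<in> S" "w \<bullet> x = 0" for w
  proof (rule ccontr)
    assume ne: "w \<bullet> f x \<noteq> 0"
    define c where "c = w \<bullet> f x"
    define K where "K = \<bar>m * (w \<bullet> w) - w \<bullet> f w\<bar> + 1"
    have ineq: "2 * t * c \<le> t * t * K" for t
    proof -
      have "x + t *\<^sub>R w \<in> S" using xS w S by (simp add: subspace_add subspace_scale)
      from up[OF this] have "m + 2 * t * c + t * t * (w \<bullet> f w) \<le> m * (1 + t * t * (w \<bullet> w))"
        using w(2) nx sym[of x w] dot_square_norm[of x]
        by (simp add: linear_add[OF lin] linear_scale[OF lin] inner_add_left inner_add_right
            m_def[symmetric] c_def inner_commute algebra_simps)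
      then have "2 * t * c \<le> t * t * (m * (w \<bullet> w) - w \<bullet> f w)" by (simp add: algebra_simps)
      also have "\<dots> \<le> t * t * K" by (intro mult_left_mono) (auto simp: K_def)
      finally show ?thesis .
    qed
    have K: "K > 0" by (simp add: K_def)
    from ineq[of "c / K"] have "2 * (c * c) / K \<le> (c * c) / K" using K by (simp add: field_simps)
    moreover have "c * c > 0" using ne not_real_square_gt_zero[of c] unfolding c_def by blast
    ultimately show False using K by (simp add: field_simps)
  qed
  define w where "w = f x - m *\<^sub>R x"
  have wS: "w \<in> S" unfolding w_def using S inv[OF xS] xS by (simp add: subspace_diff subspace_scale)
  have wx: "w \<bullet> x = 0" using nx by (simp add: w_def inner_diff_left m_def inner_commute[of "f x"] norm_eq_1)
  have "w \<bullet> w = w \<bullet> f x - m * (w \<bullet> x)" by (simp add: w_def inner_diff_right)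
  then have "w = 0" using orth[OF wS wx] wx by simp
  then show ?thesis using nx xS by (intro exI[of _ x] exI[of _ m]) (auto simp: w_def S_def)
qed

definition orthonormal_family :: "('i \<Rightarrow> 'a::real_inner) \<Rightarrow> bool" where
  "orthonormal_family v \<longleftrightarrow> (\<forall>i j. v i \<bullet> v j = (if i = j then 1 else 0))"

definition eigen_family :: "real^'n^'n \<Rightarrow> ('n \<Rightarrow> real^'n) \<Rightarrow> ('n \<Rightarrow> real) \<Rightarrow> bool" where
  "eigen_family M v \<mu> \<longleftrightarrow> orthonormal_family v \<and> (\<forall>i. M *v v i = \<mu> i *\<^sub>R v i)"

text \<open>An orthonormal set of eigenvectors of largest cardinality must span, since otherwise an
  eigenvector in its orthogonal complement could be added.\<close>

theorem symmetric_matrix_eigen_family: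
  fixes M :: "real^'n^'n"
  assumes "transpose M = M"
  shows "\<exists>v \<mu>. eigen_family M v \<mu>"
proof -
  define ok where "ok = (\<lambda>B. pairwise orthogonal B \<and> (\<forall>b\<in>B. norm b = 1 \<and> (\<exists>c. M *v b = c *\<^sub>R b)))"
  have sym: "(M *v x) \<bullet> y = x \<bullet> (M *v y)" for x y
    by (metis assms dot_lmul_matrix transpose_matrix_vector)
  have indep: "independent B" if "ok B" for B
    using that by (intro pairwise_orthogonal_independent) (auto simp: ok_def)
  have cardle: "finite B \<and> card B \<le> CARD('n)" if "ok B" for B
    using independent_bound[OF indep[OF that]] by simp
  have "ok {}" by (simp add: ok_def)
  then obtain B where B: "ok B" "\<And>B'. ok B' \<Longrightarrow> card B' \<le> card B"
    using ex_has_greatest_nat[of ok "{}" card "CARD('n) + 1"] cardle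
    by (metis Suc_eq_plus1 le_imp_less_Suc)
  have "span B = UNIV"
  proof (rule ccontr)
    assume "span B \<noteq> UNIV"
    then obtain u c where u: "norm u = 1" "\<forall>b\<in>B. u \<bullet> b = 0" "M *v u = c *\<^sub>R u"
      using symmetric_eigenvector_in_orthogonal_complement[of "(*v) M" B] sym B(1)
      by (auto simp: ok_def)
    have "u \<notin> B" using u by fastforce
    moreover have "ok (insert u B)"
      using B(1) u by (auto simp: ok_def pairwise_insert orthogonal_def inner_commute)
    ultimately show False using B(2)[of "insert u B"] cardle[OF B(1)] by simp
  qed
  then have "card B = CARD('n)"
    using indep[OF B(1)] dim_span_eq_card_independent[OF indep[OF B(1)]] by simp
  then obtain v where v: "bij_betw v (UNIV :: 'n set) B"
    using cardle[OF B(1)] by (metis finite finite_same_card_bij)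
  have vB: "v i \<in> B" for i using v by (auto simp: bij_betw_def)
  have "v i \<bullet> v j = (if i = j then 1 else 0)" for i j
  proof (cases "i = j")
    case True then show ?thesis using B(1) vB[of i] by (simp add: ok_def norm_eq_1)
  next
    case False
    then have "v i \<noteq> v j" using v by (auto simp: bij_betw_def inj_on_def)
    then show ?thesis using B(1) vB[of i] vB[of j] False by (simp add: ok_def pairwise_def orthogonal_def)
  qed
  moreover have "\<forall>i. \<exists>c. M *v v i = c *\<^sub>R v i"
    using B(1) vB unfolding ok_def by blast
  then obtain \<mu> where "\<forall>i. M *v v i = \<mu> i *\<^sub>R v i"
    using choice[of "\<lambda>i c. M *v v i = c *\<^sub>R v i"] by blast
  ultimately show ?thesis unfolding eigen_family_def orthonormal_family_def by blast
qed

lemma orthonormal_family_span: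
  fixes v :: "'n::finite \<Rightarrow> real^'n"
  assumes "orthonormal_family v"
  shows "x = (\<Sum>i\<in>UNIV. (x \<bullet> v i) *\<^sub>R v i)" "inj v" "independent (range v)"
proof -
  have o: "v i \<bullet> v j = (if i = j then 1 else 0)" for i j using assms by (simp add: orthonormal_family_def)
  show inj: "inj v" 
  proof (rule injI)
    fix i j assume "v i = v j"
    then have "v i \<bullet> v j = 1" using o[of i i] by simp
    then show "i = j" using o[of i j] by (auto split: if_splits)
  qed
  show ind: "independent (range v)"
  proof (rule pairwise_orthogonal_independent)
    show "pairwise orthogonal (range v)" by (auto simp: pairwise_def orthogonal_def o)
    have "v i \<noteq> 0" for i using o[of i i] by auto
    then show "0 \<notin> range v" by force
  qed
  have "card (range v) = CARD('n)" using inj by (simp add: card_image)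
  then have "UNIV \<subseteq> span (range v)"
    by (intro card_ge_dim_independent[OF _ ind]) auto
  then have sp: "span (range v) = UNIV" by blast
  define y where "y = x - (\<Sum>i\<in>UNIV. (x \<bullet> v i) *\<^sub>R v i)"
  have "y \<bullet> v j = 0" for j
    by (simp add: y_def inner_diff_left inner_sum_left o if_distrib cong: if_cong)
  then have "orthogonal y y" 
    by (intro orthogonal_to_span[of y "range v"]) (auto simp: sp orthogonal_def)
  then show "x = (\<Sum>i\<in>UNIV. (x \<bullet> v i) *\<^sub>R v i)" by (simp add: y_def orthogonal_self)
qed

lemma eigen_family_det:
  fixes M :: "real^'n^'n"
  assumes "eigen_family M v \<mu>"
  shows "det M = (\<Prod>i\<in>UNIV. \<mu> i)"
proof -
  have o: "v i \<bullet> v j = (if i = j then 1 else 0)" and e: "M *v v i = \<mu> i *\<^sub>R v i" for i j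
    using assms by (auto simp: eigen_family_def orthonormal_family_def)
  define V where "V = (\<chi> j i. v i $ j)"
  define D where "D = (\<chi> i j. if i = j then \<mu> i else 0)"
  have "transpose V ** V = mat 1"
    using o by (simp add: V_def matrix_matrix_mult_def transpose_def mat_def vec_eq_iff inner_vec_def)
  then have "det (transpose V) * det V = 1" by (metis det_I det_mul)
  then have nz: "det V \<noteq> 0" by auto
  have "M ** V = V ** D"
  proof -
    have "(\<Sum>k\<in>UNIV. M $ i $ k * v j $ k) = \<mu> j * v j $ i" for i j
      using arg_cong[OF e[of j], of "\<lambda>x. x $ i"] by (simp add: matrix_vector_mult_def)
    then show ?thesis
      by (simp add: V_def D_def matrix_matrix_mult_def vec_eq_iff if_distrib mult.commute cong: if_cong)
  qed
  then have "det M * det V = det V * det D" by (metis det_mul)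
  then have "det M = det D" using nz by simp
  also have "det D = (\<Prod>i\<in>UNIV. \<mu> i)" by (simp add: D_def det_diagonal)
  finally show ?thesis .
qed

lemma eigen_family_affine:
  assumes "eigen_family M v \<mu>"
  shows "eigen_family (a *\<^sub>R mat 1 + b *\<^sub>R M) v (\<lambda>i. a + b * \<mu> i)"
  using assms unfolding eigen_family_def
  by (simp add: matrix_vector_mult_add_rdistrib scaleR_matrix_vector_assoc[symmetric] scaleR_add_left)

text \<open>Each eigenspace is the span of the v i that share the eigenvalue, so weighting distinct
  eigenvalues by the dimension of their eigenspaces amounts to summing over indices.\<close>

lemma eigen_family_pucci:
  fixes M :: "real^'n^'n"
  assumes "eigen_family M v \<mu>"
  shows "pucci_minus lam Lam M = (\<Sum>i\<in>UNIV. lam * max 0 (\<mu> i) + Lam * min 0 (\<mu> i))"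
proof -
  have on: "orthonormal_family v" and e: "M *v v i = \<mu> i *\<^sub>R v i" for i
    using assms by (auto simp: eigen_family_def)
  have o: "v i \<bullet> v j = (if i = j then 1 else 0)" for i j using on by (simp add: orthonormal_family_def)
  note inj = orthonormal_family_span(2)[OF on]
  have Mx: "M *v x = (\<Sum>i\<in>UNIV. (\<mu> i * (x \<bullet> v i)) *\<^sub>R v i)" for x
  proof -
    have "M *v x = M *v (\<Sum>i\<in>UNIV. (x \<bullet> v i) *\<^sub>R v i)"
      using orthonormal_family_span(1)[OF on, of x] by simp
    also have "\<dots> = (\<Sum>i\<in>UNIV. (x \<bullet> v i) *\<^sub>R (M *v v i))"
      by (simp add: linear_sum[OF matrix_vector_mul_linear] matrix_vector_mult_scaleR)
    finally show ?thesis by (simp add: e mult.commute)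
  qed
  have coef: "(M *v x) \<bullet> v j = \<mu> j * (x \<bullet> v j)" for x j
    unfolding Mx by (simp add: inner_sum_left o if_distrib cong: if_cong)
  have esp: "matrix_eigenspace M m = span (v ` {i. \<mu> i = m})" for m
  proof
    show "matrix_eigenspace M m \<subseteq> span (v ` {i. \<mu> i = m})"
    proof
      fix x assume "x \<in> matrix_eigenspace M m"
      then have "\<mu> j * (x \<bullet> v j) = m * (x \<bullet> v j)" for j
        using coef[of x j] by (simp add: matrix_eigenspace_def) (metis)
      then have z: "x \<bullet> v j = 0" if "\<mu> j \<noteq> m" for j using that by (metis mult_right_cancel)
      have "x = (\<Sum>i\<in>UNIV. (x \<bullet> v i) *\<^sub>R v i)" by (rule orthonormal_family_span(1)[OF on])
      also have "\<dots> = (\<Sum>i\<in>{i. \<mu> i = m}. (x \<bullet> v i) *\<^sub>R v i)"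
        by (rule sum.mono_neutral_right) (auto simp: z)
      also have "\<dots> \<in> span (v ` {i. \<mu> i = m})"
        by (intro span_sum span_scale span_base) auto
      finally show "x \<in> span (v ` {i. \<mu> i = m})" .
    qed
    have "subspace (matrix_eigenspace M m)"
      by (auto simp: subspace_def matrix_eigenspace_def matrix_vector_right_distrib matrix_vector_mult_scaleR scaleR_add_right)
    then show "span (v ` {i. \<mu> i = m}) \<subseteq> matrix_eigenspace M m"
      by (intro span_minimal) (auto simp: matrix_eigenspace_def e)
  qed
  have dimesp: "dim (matrix_eigenspace M m) = card {i. \<mu> i = m}" for m
  proof -
    have "independent (v ` {i. \<mu> i = m})"
      by (rule independent_mono[OF orthonormal_family_span(3)[OF on]]) auto
    then have "dim (span (v ` {i. \<mu> i = m})) = card (v ` {i. \<mu> i = m})"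
      by (rule dim_span_eq_card_independent)
    moreover have "card (v ` {i. \<mu> i = m}) = card {i. \<mu> i = m}"
      by (rule card_image) (rule inj_on_subset[OF inj], simp)
    ultimately show ?thesis unfolding esp by simp
  qed
  have vals: "matrix_eigenvalues M = range \<mu>"
  proof -
    have "m \<in> matrix_eigenvalues M \<longleftrightarrow> {i. \<mu> i = m} \<noteq> {}" for m
    proof
      assume "m \<in> matrix_eigenvalues M"
      then obtain x where "x \<noteq> 0" "x \<in> span (v ` {i. \<mu> i = m})"
        unfolding matrix_eigenvalues_def esp by blast
      then have "span (v ` {i. \<mu> i = m}) \<noteq> {0}" by blast
      then show "{i. \<mu> i = m} \<noteq> {}" by (metis image_empty span_empty)
    next
      assume "{i. \<mu> i = m} \<noteq> {}"
      then obtain i where "\<mu> i = m" by blast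
      moreover have "v i \<noteq> 0" using o[of i i] by auto
      ultimately show "m \<in> matrix_eigenvalues M"
        using e[of i] by (auto simp: matrix_eigenvalues_def matrix_eigenspace_def)
    qed
    then show ?thesis by (auto simp: set_eq_iff)
  qed
  have grp: "(\<Sum>m\<in>{m\<in>range \<mu>. Q m}. real (card {i. \<mu> i = m}) * m) = (\<Sum>i\<in>{i. Q (\<mu> i)}. \<mu> i)" for Q
  proof -
    have "(\<Sum>m\<in>{m\<in>range \<mu>. Q m}. real (card {i. \<mu> i = m}) * m) = (\<Sum>m\<in>{m\<in>range \<mu>. Q m}. \<Sum>i\<in>{i. i \<in> {i. Q (\<mu> i)} \<and> \<mu> i = m}. \<mu> i)"
    proof (rule sum.cong[OF refl])
      fix m assume "m \<in> {m\<in>range \<mu>. Q m}"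
      then have "{i. i \<in> {i. Q (\<mu> i)} \<and> \<mu> i = m} = {i. \<mu> i = m}" by auto
      moreover have "(\<Sum>i\<in>{i. \<mu> i = m}. \<mu> i) = (\<Sum>i\<in>{i. \<mu> i = m}. m)" by (rule sum.cong) auto
      ultimately show "real (card {i. \<mu> i = m}) * m = (\<Sum>i\<in>{i. i \<in> {i. Q (\<mu> i)} \<and> \<mu> i = m}. \<mu> i)"
        by simp
    qed
    also have "\<dots> = (\<Sum>i\<in>{i. Q (\<mu> i)}. \<mu> i)"
      by (rule sum.group) auto
    finally show ?thesis .
  qed
  have p: "(\<Sum>i\<in>{i. \<mu> i > 0}. \<mu> i) = (\<Sum>i\<in>UNIV. max 0 (\<mu> i))"
    by (rule sum.mono_neutral_cong_left) auto
  have n: "(\<Sum>i\<in>{i. \<mu> i < 0}. \<mu> i) = (\<Sum>i\<in>UNIV. min 0 (\<mu> i))"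
    by (rule sum.mono_neutral_cong_left) auto
  show ?thesis
    unfolding pucci_minus_def vals dimesp grp p n by (simp add: sum.distrib sum_distrib_left)
qed

lemma pucci_minus_scaleR:
  fixes M :: "real^'n^'n"
  assumes "transpose M = M" "0 < c"
  shows "pucci_minus lam Lam (c *\<^sub>R M) = c * pucci_minus lam Lam M"
proof -
  obtain v \<mu> where ev: "eigen_family M v \<mu>" using symmetric_matrix_eigen_family[OF assms(1)] by blast
  have "eigen_family (c *\<^sub>R M) v (\<lambda>i. c * \<mu> i)" using eigen_family_affine[OF ev, of 0 c] by simp
  moreover have "max 0 (c * x) = c * max 0 x" "min 0 (c * x) = c * min 0 x" for x
    using assms(2) by (auto simp: max_def min_def zero_le_mult_iff mult_le_0_iff)
  ultimately show ?thesis
    using eigen_family_pucci[OF ev] eigen_family_pucci[of "c *\<^sub>R M" v "\<lambda>i. c * \<mu> i"]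
    by (simp add: sum_distrib_left distrib_left mult.left_commute)
qed

text \<open>A second-order expansion has an error o(|h|^2), so a function with Hessian M can only be
  tested with M lowered by a multiple of the identity. The eigenvalue formula is continuous in that
  multiple, which allows the limit.\<close>

lemma pucci_minus_le_zero_limit:
  fixes M :: "real^'n^'n"
  assumes ev: "eigen_family M v \<mu>" and "0 < lam"
    and le: "\<And>\<delta>. 0 < \<delta> \<Longrightarrow> pucci_minus lam Lam (M - \<delta> *\<^sub>R mat 1) \<le> 0"
  shows "(\<Sum>i\<in>UNIV. max 0 (\<mu> i)) \<le> (Lam / lam) * (\<Sum>i\<in>UNIV. max 0 (- \<mu> i))"
proof -
  have "(\<Sum>i\<in>UNIV. lam * max 0 (\<mu> i - \<delta>) + Lam * min 0 (\<mu> i - \<delta>)) \<le> 0" if "0 < \<delta>" for \<delta>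
  proof -
    have "M - \<delta> *\<^sub>R mat 1 = (- \<delta>) *\<^sub>R mat 1 + 1 *\<^sub>R M" by simp
    then have "eigen_family (M - \<delta> *\<^sub>R mat 1) v (\<lambda>i. \<mu> i - \<delta>)"
      using eigen_family_affine[OF ev, of "- \<delta>" 1] by simp
    from eigen_family_pucci[OF this] le[OF that] show ?thesis by simp
  qed
  moreover have "((\<lambda>\<delta>. \<Sum>i\<in>UNIV. lam * max 0 (\<mu> i - \<delta>) + Lam * min 0 (\<mu> i - \<delta>)) \<longlongrightarrow>
      (\<Sum>i\<in>UNIV. lam * max 0 (\<mu> i - 0) + Lam * min 0 (\<mu> i - 0))) (at_right 0)"
    by (intro tendsto_intros)
  ultimately have "(\<Sum>i\<in>UNIV. lam * max 0 (\<mu> i) + Lam * min 0 (\<mu> i)) \<le> 0"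
    by (intro tendsto_upperbound[of "\<lambda>\<delta>. \<Sum>i\<in>UNIV. lam * max 0 (\<mu> i - \<delta>) + Lam * min 0 (\<mu> i - \<delta>)" _ "at_right 0"])
      (auto simp: eventually_at_filter)
  moreover have "max 0 (- x) = - min 0 x" for x :: real by auto
  ultimately show ?thesis using \<open>0 < lam\<close>
    by (simp add: sum.distrib sum_distrib_left[symmetric] sum_negf field_simps)
qed

subsection \<open>The area inequality\<close>

text \<open>A well-ordered type with as many elements as 'n; an enumeration of 'n by it relabels the
  coordinates of \<open>real^'n\<close> isometrically.\<close>

typedef (overloaded) 'n ranked = "{..<CARD('n::finite)}"
  by (rule exI[of _ 0]) (simp add: zero_less_card_finite)

lemma bij_betw_Rep_ranked: "bij_betw Rep_ranked (UNIV :: 'n::finite ranked set) {..<CARD('n)}"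
  using type_definition.Rep_range[OF type_definition_ranked]
  by (auto simp: bij_betw_def Rep_ranked_inject intro!: injI)

instance ranked :: (finite) finite
proof
  show "finite (UNIV :: 'a ranked set)"
    using bij_betw_finite[OF bij_betw_Rep_ranked] by simp
qed

instantiation ranked :: (finite) wellorder
begin
definition "x \<le> y \<longleftrightarrow> Rep_ranked x \<le> Rep_ranked y"
definition "x < y \<longleftrightarrow> Rep_ranked x < Rep_ranked y"
instance
proof
  fix P :: "'a ranked \<Rightarrow> bool" and a :: "'a ranked"
  assume step: "\<And>x. (\<And>y. y < x \<Longrightarrow> P y) \<Longrightarrow> P x"
  show "P a"
    by (induction a rule: measure_induct_rule[of Rep_ranked]) (use step less_ranked_def in blast)
qed (auto simp: less_eq_ranked_def less_ranked_def Rep_ranked_inject)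
end

lemma ex_bij_ranked: "\<exists>e :: 'n::finite ranked \<Rightarrow> 'n. bij e"
proof -
  have "card (UNIV :: 'n ranked set) = CARD('n)"
    using bij_betw_same_card[OF bij_betw_Rep_ranked] by simp
  then show ?thesis
    using finite_same_card_bij[of "UNIV :: 'n ranked set" "UNIV :: 'n set"] by simp
qed

section \<open>Relabelling of coordinates\<close>

definition reindex :: "('m \<Rightarrow> 'n) \<Rightarrow> real^'n \<Rightarrow> real^'m" where
  "reindex e x = (\<chi> i. x $ e i)"

lemma reindex_inverse: "bij e \<Longrightarrow> reindex (inv e) (reindex e x) = x"
  by (simp add: reindex_def vec_eq_iff bij_def surj_f_inv_f)

lemma reindex_inverse': "bij e \<Longrightarrow> reindex e (reindex (inv e) x) = x"
  by (simp add: reindex_def vec_eq_iff bij_def inv_f_f)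

lemma linear_reindex: "linear (reindex e)"
  by (auto intro!: linearI simp: reindex_def vec_eq_iff)

lemma continuous_on_reindex: "continuous_on S (reindex e)"
  by (simp add: linear_continuous_on linear_reindex linear_linear)

lemma prod_Basis_cart:
  fixes f :: "real^'n \<Rightarrow> real"
  shows "(\<Prod>b\<in>Basis. f b) = (\<Prod>i\<in>UNIV. f (axis i 1))"
proof -
  have "Basis = range (\<lambda>i. axis i 1 :: real^'n)" by (auto simp: Basis_vec_def)
  moreover have "inj (\<lambda>i. axis i 1 :: real^'n)" by (auto intro!: injI simp: axis_eq_axis)
  ultimately show ?thesis using prod.reindex[of "\<lambda>i. axis i 1 :: real^'n" UNIV f] by (simp add: o_def)
qed

text \<open>Relabelling coordinates carries boxes to boxes with the same side lengths, and boxes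
  determine Lebesgue measure.\<close>

lemma lborel_distr_reindex:
  fixes e :: "'m::finite \<Rightarrow> 'n::finite"
  assumes e: "bij e"
  shows "distr lborel borel (reindex e) = lborel"
proof (rule lborel_eqI[symmetric])
  have [measurable]: "reindex e \<in> borel_measurable borel"
    by (rule borel_measurable_continuous_onI[OF continuous_on_reindex])
  fix l u :: "real^'m"
  assume lu: "\<And>b. b \<in> Basis \<Longrightarrow> l \<bullet> b \<le> u \<bullet> b"
  have le: "l $ i \<le> u $ i" for i using lu[of "axis i 1"] by (simp add: axis_in_Basis_iff inner_axis)
  have vim: "reindex e -` box l u = box (reindex (inv e) l) (reindex (inv e) u)"
  proof -
    have "(\<forall>i. l $ i < x $ e i \<and> x $ e i < u $ i) \<longleftrightarrow> (\<forall>j. l $ inv e j < x $ j \<and> x $ j < u $ inv e j)" for x :: "real^'n"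
      using e by (metis bij_inv_eq_iff)
    then show ?thesis by (auto simp: reindex_def mem_box_cart)
  qed
  have "emeasure (distr lborel borel (reindex e)) (box l u) = emeasure lborel (box (reindex (inv e) l) (reindex (inv e) u))"
    by (subst emeasure_distr) (auto simp: vim)
  also have "\<dots> = ennreal (\<Prod>b\<in>Basis. (reindex (inv e) u - reindex (inv e) l) \<bullet> b)"
    by (rule emeasure_lborel_box) (use le in \<open>auto simp: Basis_vec_def inner_axis reindex_def\<close>)
  also have "(\<Prod>b\<in>Basis. (reindex (inv e) u - reindex (inv e) l) \<bullet> b) = (\<Prod>j\<in>UNIV. u $ inv e j - l $ inv e j)"
    by (simp add: prod_Basis_cart inner_axis reindex_def)
  also have "\<dots> = (\<Prod>i\<in>UNIV. u $ i - l $ i)"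
    by (rule prod.reindex_bij_betw) (rule bij_imp_bij_inv[OF e])
  also have "\<dots> = (\<Prod>b\<in>Basis. (u - l) \<bullet> b)"
    by (simp add: prod_Basis_cart inner_axis)
  finally show "emeasure (distr lborel borel (reindex e)) (box l u) = ennreal (\<Prod>b\<in>Basis. (u - l) \<bullet> b)" .
qed simp

lemma nn_integral_reindex:
  fixes e :: "'m::finite \<Rightarrow> 'n::finite"
  assumes e: "bij e" and [measurable]: "f \<in> borel_measurable borel"
  shows "(\<integral>\<^sup>+x. f (reindex e x) \<partial>lborel) = (\<integral>\<^sup>+y. f y \<partial>lborel)"
proof -
  have [measurable]: "reindex e \<in> borel_measurable borel"
    by (rule borel_measurable_continuous_onI[OF continuous_on_reindex])
  have "(\<integral>\<^sup>+y. f y \<partial>lborel) = (\<integral>\<^sup>+y. f y \<partial>distr lborel borel (reindex e))"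
    by (simp add: lborel_distr_reindex[OF e])
  also have "\<dots> = (\<integral>\<^sup>+x. f (reindex e x) \<partial>lborel)"
    by (rule nn_integral_distr) auto
  finally show ?thesis ..
qed

text \<open>Conjugation by e is a sign-preserving bijection between the permutations of the two
  index types, matching the Leibniz sums term by term.\<close>

lemma det_reindex:
  fixes A :: "real^'n::finite^'n" and e :: "'m::finite \<Rightarrow> 'n"
  assumes e: "bij e"
  shows "det (\<chi> i j. A $ e i $ e j) = det A"
proof -
  have ie: "inv e (e i) = i" "e (inv e j) = j" for i j
    using e by (auto simp: bij_def inv_f_f surj_f_inv_f)
  have sgn: "sign (e \<circ> q \<circ> inv e) = sign q" if "q permutes UNIV" for q
  proof -
    have "map_permutation UNIV e q = e \<circ> q \<circ> inv e"
      using e by (simp add: map_permutation_def restrict_id_def fun_eq_iff bij_is_surj)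
    then show ?thesis using sign_map_permutation[of e UNIV q] that e by (simp add: bij_is_inj)
  qed
  show ?thesis
    unfolding det_def
  proof (rule sum.reindex_bij_witness[where i="\<lambda>p. inv e \<circ> p \<circ> e" and j="\<lambda>q. e \<circ> q \<circ> inv e"])
    fix q assume "q \<in> {p. p permutes (UNIV :: 'm set)}"
    then have q: "q permutes UNIV" by simp
    show "inv e \<circ> (e \<circ> q \<circ> inv e) \<circ> e = q" by (simp add: fun_eq_iff ie)
    show "e \<circ> q \<circ> inv e \<in> {p. p permutes UNIV}"
      using bij_comp[OF bij_imp_bij_inv[OF e] bij_comp[OF permutes_bij[OF q] e]] by (auto intro: bij_imp_permutes)
    have "(\<Prod>j\<in>UNIV. A $ j $ (e \<circ> q \<circ> inv e) j) = (\<Prod>i\<in>UNIV. A $ e i $ (e \<circ> q \<circ> inv e) (e i))"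
      by (rule prod.reindex_bij_betw[OF e, symmetric])
    then show "of_int (sign (e \<circ> q \<circ> inv e)) * (\<Prod>i\<in>UNIV. A $ i $ (e \<circ> q \<circ> inv e) i) =
       of_int (sign q) * (\<Prod>i\<in>UNIV. (\<chi> i j. A $ e i $ e j) $ i $ q i)"
      by (simp add: sgn[OF q] ie)
  next
    fix p assume "p \<in> {p. p permutes (UNIV :: 'n set)}"
    then have p: "p permutes UNIV" by simp
    show "e \<circ> (inv e \<circ> p \<circ> e) \<circ> inv e = p" by (simp add: fun_eq_iff ie)
    show "inv e \<circ> p \<circ> e \<in> {p. p permutes UNIV}"
      using bij_comp[OF e bij_comp[OF permutes_bij[OF p] bij_imp_bij_inv[OF e]]] by (auto intro: bij_imp_permutes)
  qed
qed

lemma borel_measurable_det: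
  fixes D :: "'a \<Rightarrow> real^'n::finite^'n"
  assumes "\<And>i j. (\<lambda>x. D x $ i $ j) \<in> borel_measurable M"
  shows "(\<lambda>x. det (D x)) \<in> borel_measurable M"
  unfolding det_def using assms by measurable

text \<open>The bound for the integral over the image of a differentiable map is applied off Z; g is
  Lipschitz, so the image of Z is null and nothing is lost on the left. When the right side is
  finite, its integrand is integrable, as that bound requires.\<close>

lemma area_le_wellorder:
  fixes g :: "real^'n::{finite,wellorder} \<Rightarrow> real^'n::_" and D :: "real^'n::_ \<Rightarrow> real^'n::_^'n::_"
  assumes S: "compact S" and lip: "L-lipschitz_on UNIV g" and Z: "Z \<in> null_sets lborel"
    and D: "\<And>i j. (\<lambda>x. D x $ i $ j) \<in> borel_measurable borel"
    and der: "\<And>x. x \<in> S - Z \<Longrightarrow> (g has_derivative (\<lambda>h. D x *v h)) (at x)"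
    and \<phi>: "continuous_on UNIV \<phi>" "\<And>y. 0 \<le> \<phi> y"
  shows "(\<integral>\<^sup>+y. ennreal (\<phi> y) * indicator (g ` S) y \<partial>lborel) \<le>
     (\<integral>\<^sup>+x. ennreal (\<phi> (g x) * \<bar>det (D x)\<bar>) * indicator S x \<partial>lborel)" (is "_ \<le> ?R")
proof (cases "?R = \<infinity>")
  case False
  have gc: "continuous_on UNIV g" using lip by (rule lipschitz_on_continuous_on)
  have [measurable]: "g \<in> borel_measurable borel" using gc by (rule borel_measurable_continuous_onI)
  have [measurable]: "\<phi> \<in> borel_measurable borel" using \<phi>(1) by (rule borel_measurable_continuous_onI)
  have [measurable]: "(\<lambda>x. det (D x)) \<in> borel_measurable borel" using D by (rule borel_measurable_det)
  have Sb[measurable]: "S \<in> sets borel" using S by (simp add: compact_imp_closed)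
  have Zb[measurable]: "Z \<in> sets borel" using Z by auto
  let ?S = "S - Z"
  define F where "F = (\<lambda>x. \<bar>det (D x)\<bar> * \<phi> (g x))"
  have [measurable]: "F \<in> borel_measurable borel" unfolding F_def by measurable
  have F0: "0 \<le> F x" for x using \<phi>(2) by (simp add: F_def)
  have RF: "?R = (\<integral>\<^sup>+x. ennreal (F x * indicator ?S x) \<partial>lborel)"
  proof (rule nn_integral_cong_AE)
    show "AE x in lborel. ennreal (\<phi> (g x) * \<bar>det (D x)\<bar>) * indicator S x = ennreal (F x * indicator ?S x)"
      using AE_not_in[OF Z] by eventually_elim (auto simp: F_def mult.commute indicator_def)
  qed
  have "integrable lborel (\<lambda>x. F x * indicator ?S x)"
    by (rule integrableI_nonneg) (use False RF F0 in \<open>auto simp: less_top[symmetric]\<close>)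
  then have hi: "((\<lambda>x. F x * indicator ?S x) has_integral (\<integral>x. F x * indicator ?S x \<partial>lborel)) UNIV"
    by (rule has_integral_integral_lborel)
  have eqi: "(\<lambda>x. F x * indicator ?S x) = (\<lambda>x. if x \<in> ?S then F x else 0)" by (auto simp: indicator_def)
  from hi have hiS: "(F has_integral (\<integral>x. F x * indicator ?S x \<partial>lborel)) ?S"
    unfolding eqi has_integral_restrict_UNIV .
  have intF: "(\<lambda>x. \<bar>det (matrix (\<lambda>h. D x *v h))\<bar> * \<phi> (g x)) integrable_on ?S"
    using hiS by (auto simp: F_def matrix_of_matrix_vector_mul integrable_on_def)
  have ub: "\<phi> integrable_on (g ` ?S) \<and> integral (g ` ?S) \<phi> \<le> integral ?S (\<lambda>x. \<bar>det (matrix (\<lambda>h. D x *v h))\<bar> * \<phi> (g x))"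
    by (rule integral_on_image_ubound_nonneg[where f=\<phi> and g=g and g'="\<lambda>x h. D x *v h", OF \<phi>(2) _ intF])
      (use der has_derivative_at_withinI in blast)
  have "integral ?S (\<lambda>x. \<bar>det (matrix (\<lambda>h. D x *v h))\<bar> * \<phi> (g x)) = (\<integral>x. F x * indicator ?S x \<partial>lborel)"
    using integral_unique[OF hiS] by (simp add: F_def matrix_of_matrix_vector_mul)
  with ub have ub': "(\<phi> has_integral integral (g ` ?S) \<phi>) (g ` ?S)"
    "integral (g ` ?S) \<phi> \<le> (\<integral>x. F x * indicator ?S x \<partial>lborel)" by (auto simp: integrable_integral)
  have gSb[measurable]: "g ` S \<in> sets borel"
    using compact_continuous_image[OF continuous_on_subset[OF gc] S] by (simp add: compact_imp_closed)
  have gZ: "negligible (g ` Z)"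
  proof (rule negligible_locally_Lipschitz_image)
    show "negligible Z" using Z by (simp add: negligible_iff_null_sets null_sets_completionI)
    show "\<exists>T B. open T \<and> x \<in> T \<and> (\<forall>y\<in>Z \<inter> T. norm (g y - g x) \<le> B * norm (y - x))" for x
      using lipschitz_onD[OF lip] by (intro exI[of _ UNIV] exI[of _ L]) (simp add: dist_norm)
  qed simp
  have "(\<integral>\<^sup>+y. ennreal (\<phi> y) * indicator (g ` S) y \<partial>lborel) \<le> (\<integral>\<^sup>+y. ennreal (\<phi> y) * indicator (g ` ?S) y \<partial>lborel)"
  proof (rule nn_integral_mono_AE)
    have "AE y in lebesgue. y \<notin> g ` Z" using gZ by (simp only: AE_not_in negligible_iff_null_sets)
    then have "AE y in lborel. y \<notin> g ` Z" by (simp only: AE_completion_iff)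
    then show "AE y in lborel. ennreal (\<phi> y) * indicator (g ` S) y \<le> ennreal (\<phi> y) * indicator (g ` ?S) y"
      by eventually_elim (auto simp: indicator_def)
  qed
  also have "\<dots> = ennreal (integral (g ` ?S) \<phi>)"
    by (rule nn_integral_has_integral_lebesgue'[OF \<phi>(2) ub'(1)])
  also have "\<dots> \<le> ennreal (\<integral>x. F x * indicator ?S x \<partial>lborel)"
    using ub'(2) by (rule ennreal_leI)
  also have "\<dots> = (\<integral>\<^sup>+x. ennreal (F x * indicator ?S x) \<partial>lborel)"
    by (rule nn_integral_eq_integral[symmetric]) (use \<open>integrable lborel _\<close> F0 in auto)
  finally show ?thesis using RF by simp
qed simp

text \<open>The library's area inequality needs a well-ordered index type; it is transported along a
  bijection between the index type and an initial segment of the natural numbers.\<close>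

theorem area_le:
  fixes g :: "real^'n \<Rightarrow> real^'n" and D :: "real^'n \<Rightarrow> real^'n^'n"
  assumes S: "compact S" and lip: "L-lipschitz_on UNIV g" and Z: "Z \<in> null_sets lborel"
    and D: "\<And>i j. (\<lambda>x. D x $ i $ j) \<in> borel_measurable borel"
    and der: "\<And>x. x \<in> S - Z \<Longrightarrow> (g has_derivative (\<lambda>h. D x *v h)) (at x)"
    and \<phi>: "continuous_on UNIV \<phi>" "\<And>y. 0 \<le> \<phi> y"
  shows "(\<integral>\<^sup>+y. ennreal (\<phi> y) * indicator (g ` S) y \<partial>lborel) \<le>
     (\<integral>\<^sup>+x. ennreal (\<phi> (g x) * \<bar>det (D x)\<bar>) * indicator S x \<partial>lborel)"
proof -
  obtain e :: "'n ranked \<Rightarrow> 'n" where e: "bij e" using ex_bij_ranked by blast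
  let ?T = "reindex e :: real^'n \<Rightarrow> real^'n ranked" and ?U = "reindex (inv e) :: real^'n ranked \<Rightarrow> real^'n"
  have TU: "?T (?U y) = y" and UT: "?U (?T x) = x" for x y
    using reindex_inverse[OF e] reindex_inverse'[OF e] by auto
  have e': "bij (inv e)" using e by (rule bij_imp_bij_inv)
  note cT = continuous_on_reindex[of _ e] and cU = continuous_on_reindex[of _ "inv e"]
  have [measurable]: "?T \<in> borel_measurable borel" "?U \<in> borel_measurable borel"
    using borel_measurable_continuous_onI[OF continuous_on_reindex] by blast+
  have nT: "norm (?T x) = norm x" for x :: "real^'n"
    unfolding norm_vec_def L2_set_def reindex_def
    using sum.reindex_bij_betw[OF e, of "\<lambda>j. (norm (x $ j))\<^sup>2"] by simp
  have nU: "norm (?U y) = norm y" for y using nT[of "?U y"] TU by simp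
  have dU: "?U a - ?U b = ?U (a - b)" and dT: "?T x - ?T z = ?T (x - z)" for a b x z
    by (simp_all add: reindex_def vec_eq_iff)
  define g' where "g' = (\<lambda>y. ?T (g (?U y)))"
  define D' where "D' = (\<lambda>y. (\<chi> i j. D (?U y) $ e i $ e j) :: real^'n ranked^'n ranked)"
  have gc: "continuous_on UNIV g" using lip by (rule lipschitz_on_continuous_on)
  have Sb[measurable]: "S \<in> sets borel" using S by (simp add: compact_imp_closed)
  have [measurable]: "g \<in> borel_measurable borel" using gc by (rule borel_measurable_continuous_onI)
  have [measurable]: "\<phi> \<in> borel_measurable borel" using \<phi>(1) by (rule borel_measurable_continuous_onI)
  have [measurable]: "(\<lambda>x. det (D x)) \<in> borel_measurable borel" using D by (rule borel_measurable_det)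
  have gSb[measurable]: "g ` S \<in> sets borel"
    using compact_continuous_image[OF continuous_on_subset[OF gc] S] by (simp add: compact_imp_closed)
  have mem: "y \<in> ?T ` A \<longleftrightarrow> ?U y \<in> A" for y A
  proof
    assume "?U y \<in> A"
    then show "y \<in> ?T ` A" using TU[of y] by (intro image_eqI[of _ _ "?U y"]) simp_all
  qed (auto simp: UT)
  have Z': "?U -` Z \<in> null_sets lborel"
  proof -
    have Zb: "Z \<in> sets borel" using Z by auto
    have "emeasure lborel (?U -` Z) = emeasure (distr lborel borel ?U) Z"
      using Zb by (subst emeasure_distr) auto
    also have "\<dots> = 0" using Z by (simp add: lborel_distr_reindex[OF e'] null_sets_def)
    finally show ?thesis using measurable_sets[of ?U borel borel Z] Zb by (intro null_setsI) auto
  qed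
  have "(\<integral>\<^sup>+y. ennreal (\<phi> (?U y)) * indicator (g' ` (?T ` S)) y \<partial>lborel) \<le>
     (\<integral>\<^sup>+y. ennreal (\<phi> (?U (g' y)) * \<bar>det (D' y)\<bar>) * indicator (?T ` S) y \<partial>lborel)"
  proof (rule area_le_wellorder[OF _ _ Z'])
    show "compact (?T ` S)" by (rule compact_continuous_image[OF cT S])
    show "L-lipschitz_on UNIV g'"
    proof (rule lipschitz_onI)
      fix x y
      show "dist (g' x) (g' y) \<le> L * dist x y"
        using lipschitz_onD[OF lip, of "?U x" "?U y"] by (simp add: g'_def dist_norm dT dU nT nU)
    qed (use lipschitz_on_nonneg[OF lip] in simp)
    show "(\<lambda>x. D' x $ i $ j) \<in> borel_measurable borel" for i j
      unfolding D'_def using measurable_compose[OF _ D, of ?U borel] by simp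
    show "continuous_on UNIV (\<lambda>y. \<phi> (?U y))"
      by (rule continuous_on_compose2[OF \<phi>(1) cU]) simp
    show "0 \<le> \<phi> (?U y)" for y by (rule \<phi>(2))
    fix y assume "y \<in> ?T ` S - ?U -` Z"
    then have "?U y \<in> S - Z" by (auto simp: UT)
    from der[OF this] have 1: "(g has_derivative (\<lambda>h. D (?U y) *v h)) (at (?U y))" .
    have 2: "(?U has_derivative ?U) (at y)" "(?T has_derivative ?T) (at (g (?U y)))"
      by (simp_all add: linear_imp_has_derivative linear_reindex)
    have "(g' has_derivative (\<lambda>h. ?T (D (?U y) *v (?U h)))) (at y)"
      unfolding g'_def
      using has_derivative_compose[OF has_derivative_compose[OF 2(1) 1] 2(2)] .
    moreover have "?T (D (?U y) *v (?U h)) = D' y *v h" for h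
      unfolding D'_def reindex_def matrix_vector_mult_def
      using sum.reindex_bij_betw[OF e, of "\<lambda>j. D (\<chi> i. y $ inv e i) $ e _ $ j * h $ inv e j"] e
      by (simp add: vec_eq_iff bij_is_inj inv_f_f)
    ultimately show "(g' has_derivative (\<lambda>h. D' y *v h)) (at y)" by simp
  qed
  also have "(\<integral>\<^sup>+y. ennreal (\<phi> (?U y)) * indicator (g' ` (?T ` S)) y \<partial>lborel) =
     (\<integral>\<^sup>+y. ennreal (\<phi> (?U y)) * indicator (g ` S) (?U y) \<partial>lborel)"
  proof (rule nn_integral_cong)
    fix y
    have "g' ` (?T ` S) = ?T ` (g ` S)" by (simp add: g'_def image_image UT)
    then show "ennreal (\<phi> (?U y)) * indicator (g' ` (?T ` S)) y = ennreal (\<phi> (?U y)) * indicator (g ` S) (?U y)"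
      by (simp add: indicator_def mem)
  qed
  also have "\<dots> = (\<integral>\<^sup>+x. ennreal (\<phi> x) * indicator (g ` S) x \<partial>lborel)"
    by (rule nn_integral_reindex[OF e', of "\<lambda>x. ennreal (\<phi> x) * indicator (g ` S) x"]) measurable
  also have "(\<integral>\<^sup>+y. ennreal (\<phi> (?U (g' y)) * \<bar>det (D' y)\<bar>) * indicator (?T ` S) y \<partial>lborel) =
     (\<integral>\<^sup>+y. ennreal (\<phi> (g (?U y)) * \<bar>det (D (?U y))\<bar>) * indicator S (?U y) \<partial>lborel)"
    by (rule nn_integral_cong) (simp add: g'_def D'_def UT det_reindex[OF e] indicator_def mem)
  also have "\<dots> = (\<integral>\<^sup>+x. ennreal (\<phi> (g x) * \<bar>det (D x)\<bar>) * indicator S x \<partial>lborel)"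
    by (rule nn_integral_reindex[OF e', of "\<lambda>x. ennreal (\<phi> (g x) * \<bar>det (D x)\<bar>) * indicator S x"]) measurable
  finally show ?thesis .
qed

subsection \<open>Second-order expansions\<close>

lemma has_dir_of_has_derivative:
  fixes f :: "'a::euclidean_space \<Rightarrow> real"
  assumes "(f has_derivative f') (at x)"
  shows "has_dir f v x (f' v)"
proof -
  have lin: "linear f'" using assms by (rule has_derivative_linear)
  have "((\<lambda>h. x + h *\<^sub>R v) has_derivative (\<lambda>h. h *\<^sub>R v)) (at 0)"
    by (auto intro!: derivative_eq_intros)
  from has_derivative_compose[OF this, of f f'] assms
  have "((\<lambda>h. f (x + h *\<^sub>R v)) has_derivative (\<lambda>h. f' (h *\<^sub>R v))) (at 0)" by simp
  moreover have "(\<lambda>h. f' (h *\<^sub>R v)) = (*) (f' v)"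
    by (simp add: fun_eq_iff linear_scale[OF lin] mult.commute)
  ultimately have "((\<lambda>h. f (x + h *\<^sub>R v)) has_field_derivative f' v) (at 0)"
    by (simp add: has_field_derivative_def)
  then show ?thesis unfolding has_dir_def DERIV_def by simp
qed

text \<open>Taking the entries of M to be \<open>dir_deriv\<close> of the components makes them
  Borel on the whole space, including Z, where they carry no meaning.\<close>

theorem lipschitz_jacobian:
  fixes q :: "real^'n \<Rightarrow> real^'n"
  assumes lip: "L-lipschitz_on UNIV q"
  obtains M :: "real^'n \<Rightarrow> real^'n^'n" and Z where "Z \<in> null_sets lborel"
    "\<And>i j. (\<lambda>x. M x $ i $ j) \<in> borel_measurable borel"
    "\<And>x. x \<notin> Z \<Longrightarrow> (q has_derivative (\<lambda>h. M x *v h)) (at x)"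
proof -
  obtain Z where Z: "Z \<in> null_sets lborel" "{x \<in> space lborel. \<not> q differentiable at x} \<subseteq> Z"
    using rademacher[OF lip] by (auto elim: AE_E simp: null_sets_def)
  define M where "M = (\<lambda>x. (\<chi> i j. dir_deriv (\<lambda>x. q x $ i) (axis j 1) x) :: real^'n^'n)"
  have qc: "continuous_on UNIV q" using lip by (rule lipschitz_on_continuous_on)
  show thesis
  proof
    show "Z \<in> null_sets lborel" by (rule Z)
    show "(\<lambda>x. M x $ i $ j) \<in> borel_measurable borel" for i j
    proof -
      have "slopes (\<lambda>x. q x $ i) (axis j 1) k \<in> borel_measurable borel" for k
        by (rule slopes_measurable) (intro continuous_intros qc)
      then show ?thesis unfolding M_def dir_deriv_def by simp
    qed
    fix x assume "x \<notin> Z"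
    then have "q differentiable at x" using Z(2) by auto
    then obtain f' where f': "(q has_derivative f') (at x)" by (auto simp: differentiable_def)
    have lin: "linear f'" using f' by (rule has_derivative_linear)
    have "((\<lambda>x. q x $ i) has_derivative (\<lambda>h. f' h $ i)) (at x)" for i
      using bounded_linear.has_derivative[OF bounded_linear_vec_nth f'] .
    from has_dir_dir_deriv[OF has_dir_of_has_derivative[OF this]]
    have "M x $ i $ j = f' (axis j 1) $ i" for i j by (simp add: M_def)
    then have "M x = matrix f'" by (simp add: matrix_def vec_eq_iff)
    then have "(\<lambda>h. M x *v h) = f'" using lin by (simp add: matrix_works fun_eq_iff)
    then show "(q has_derivative (\<lambda>h. M x *v h)) (at x)" using f' by simp
  qed
qed

lemma gradient_remainder:
  fixes q :: "'a::euclidean_space \<Rightarrow> 'a"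
  assumes "(q has_derivative f) (at x)" "0 < e"
  obtains d where "0 < d" "\<And>h. norm h < d \<Longrightarrow> norm (q (x + h) - q x - f h) \<le> e * norm h"
proof -
  obtain d where "0 < d" "\<And>y. norm (y - x) < d \<Longrightarrow> norm (q y - q x - f (y - x)) \<le> e * norm (y - x)"
    using assms unfolding has_derivative_at_alt by blast
  from this(1) this(2)[of "x + _"] show thesis by (intro that) auto
qed

lemma segment_mvt:
  fixes G :: "'a::euclidean_space \<Rightarrow> real"
  assumes "\<And>x. (G has_derivative (\<lambda>h. q x \<bullet> h)) (at x)"
  shows "((\<lambda>t. G (x + t *\<^sub>R h)) has_real_derivative q (x + t *\<^sub>R h) \<bullet> h) (at t)"
proof -
  have "((\<lambda>t. x + t *\<^sub>R h) has_derivative (\<lambda>s. s *\<^sub>R h)) (at t)"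
    by (auto intro!: derivative_eq_intros)
  from has_derivative_compose[OF this assms]
  have "((\<lambda>t. G (x + t *\<^sub>R h)) has_derivative (\<lambda>s. q (x + t *\<^sub>R h) \<bullet> (s *\<^sub>R h))) (at t)" .
  moreover have "(\<lambda>s. q (x + t *\<^sub>R h) \<bullet> (s *\<^sub>R h)) = (*) (q (x + t *\<^sub>R h) \<bullet> h)"
    by (simp add: fun_eq_iff mult.commute)
  ultimately show ?thesis by (simp add: has_field_derivative_def)
qed

text \<open>The gradient is assumed differentiable at the single point x. The mean value theorem on
  the segment, applied to G minus its quadratic model, reduces the claim to the first-order
  remainder of the gradient at an intermediate point.\<close>

lemma second_order_taylor:
  fixes G :: "real^'n \<Rightarrow> real"
  assumes G: "\<And>x. (G has_derivative (\<lambda>h. q x \<bullet> h)) (at x)"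
    and q: "(q has_derivative (\<lambda>h. M *v h)) (at x)" and e: "0 < e"
  obtains d where "0 < d"
    "\<And>h. norm h < d \<Longrightarrow> \<bar>G (x + h) - G x - q x \<bullet> h - (h \<bullet> (M *v h)) / 2\<bar> \<le> e * (norm h)\<^sup>2"
proof -
  obtain d where d: "0 < d" "\<And>h. norm h < d \<Longrightarrow> norm (q (x + h) - q x - M *v h) \<le> e * norm h"
    using gradient_remainder[OF q e] by blast
  show thesis
  proof (rule that[OF d(1)])
    fix h :: "real^'n" assume h: "norm h < d"
    define \<psi> where "\<psi> = (\<lambda>t. G (x + t *\<^sub>R h) - t * (q x \<bullet> h) - t\<^sup>2 * (h \<bullet> (M *v h)) / 2)"
    have D: "(\<psi> has_real_derivative (q (x + t *\<^sub>R h) \<bullet> h - q x \<bullet> h - t * (h \<bullet> (M *v h)))) (at t)" for t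
      unfolding \<psi>_def by (auto intro!: derivative_eq_intros segment_mvt[OF G])
    obtain t where t: "0 < t" "t < 1" "\<psi> 1 - \<psi> 0 = (1 - 0) * (q (x + t *\<^sub>R h) \<bullet> h - q x \<bullet> h - t * (h \<bullet> (M *v h)))"
      using MVT2[of 0 1 \<psi>, OF _ D] by auto
    have th: "norm (t *\<^sub>R h) \<le> norm h" using t by (simp add: mult_left_le_one_le)
    have "q (x + t *\<^sub>R h) \<bullet> h - q x \<bullet> h - t * (h \<bullet> (M *v h)) = (q (x + t *\<^sub>R h) - q x - M *v (t *\<^sub>R h)) \<bullet> h"
      by (simp add: inner_diff_left matrix_vector_mult_scaleR inner_commute[of h "M *v h"])
    then have "\<bar>\<psi> 1 - \<psi> 0\<bar> \<le> norm (q (x + t *\<^sub>R h) - q x - M *v (t *\<^sub>R h)) * norm h"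
      using t(3) Cauchy_Schwarz_ineq2 by simp
    also have "\<dots> \<le> (e * norm (t *\<^sub>R h)) * norm h"
      using d(2)[of "t *\<^sub>R h"] th h by (intro mult_right_mono) auto
    also have "\<dots> \<le> (e * norm h) * norm h"
      using th e by (intro mult_right_mono mult_left_mono) auto
    finally show "\<bar>G (x + h) - G x - q x \<bullet> h - (h \<bullet> (M *v h)) / 2\<bar> \<le> e * (norm h)\<^sup>2"
      by (simp add: \<psi>_def power2_eq_square algebra_simps)
  qed
qed

text \<open>The second difference of G over the parallelogram spanned by s v and s w is symmetric in
  v and w, and it equals s^2 (M v) . w up to o(s^2), by the mean value theorem along one
  side.\<close>

lemma hessian_symmetric:
  fixes G :: "real^'n \<Rightarrow> real"
  assumes G: "\<And>x. (G has_derivative (\<lambda>h. q x \<bullet> h)) (at x)"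
    and q: "(q has_derivative (\<lambda>h. M *v h)) (at x)"
  shows "transpose M = M"
proof -
  have key: "\<bar>(M *v v) \<bullet> w - (M *v w) \<bullet> v\<bar> \<le> e * (2 * (norm v + norm w) * (norm v + norm w) * 2)" if "0 < e" for e v w
  proof -
    obtain d where d: "0 < d" "\<And>h. norm h < d \<Longrightarrow> norm (q (x + h) - q x - M *v h) \<le> e * norm h"
      using gradient_remainder[OF q \<open>0 < e\<close>] by blast
    define N where "N = norm v + norm w"
    have N0: "0 \<le> N" by (simp add: N_def)
    \<comment> \<open>Keeps the whole parallelogram within distance d of x, also when v and w
      vanish.\<close>
    define s where "s = d / (2 * (N + 1))"
    have s: "0 < s" "s * N < d"
      using d(1) N0 mult_nonneg_nonneg[of N d] by (auto simp: s_def field_simps intro: add_nonneg_pos)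
    define F where "F = G (x + s *\<^sub>R v + s *\<^sub>R w) - G (x + s *\<^sub>R v) - G (x + s *\<^sub>R w) + G x"
    have est: "\<bar>F - s\<^sup>2 * ((M *v a) \<bullet> b)\<bar> \<le> s\<^sup>2 * (e * (2 * N * N))"
      if F: "F = G (x + s *\<^sub>R a + s *\<^sub>R b) - G (x + s *\<^sub>R a) - G (x + s *\<^sub>R b) + G x" and ab: "norm a + norm b = N" for a b
    proof -
      define \<psi> where "\<psi> = (\<lambda>t. G (x + s *\<^sub>R a + t *\<^sub>R (s *\<^sub>R b)) - G (x + t *\<^sub>R (s *\<^sub>R b)))"
      have D: "(\<psi> has_real_derivative (q (x + s *\<^sub>R a + t *\<^sub>R (s *\<^sub>R b)) \<bullet> (s *\<^sub>R b) - q (x + t *\<^sub>R (s *\<^sub>R b)) \<bullet> (s *\<^sub>R b))) (at t)" for t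
        unfolding \<psi>_def by (intro DERIV_diff segment_mvt[OF G])
      obtain t where t: "0 < t" "t < 1" and "\<psi> 1 - \<psi> 0 = (1 - 0) * (q (x + s *\<^sub>R a + t *\<^sub>R (s *\<^sub>R b)) \<bullet> (s *\<^sub>R b) - q (x + t *\<^sub>R (s *\<^sub>R b)) \<bullet> (s *\<^sub>R b))"
        using MVT2[of 0 1 \<psi>, OF _ D] by auto
      then have F2: "F = (q (x + (s *\<^sub>R a + t *\<^sub>R (s *\<^sub>R b))) - q (x + t *\<^sub>R (s *\<^sub>R b))) \<bullet> (s *\<^sub>R b)"
        by (simp add: F \<psi>_def inner_diff_left right_diff_distrib add.assoc)
      define h1 where "h1 = s *\<^sub>R a + t *\<^sub>R (s *\<^sub>R b)"
      define h2 where "h2 = t *\<^sub>R (s *\<^sub>R b)"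
      have n2: "norm h2 \<le> s * norm b" using t s by (simp add: h2_def mult_left_le_one_le)
      have n1: "norm h1 \<le> s * N"
        using norm_triangle_ineq[of "s *\<^sub>R a" h2] n2 s ab[symmetric] by (simp add: h1_def h2_def distrib_left)
      have n2': "norm h2 \<le> s * N"
        using n2 s ab[symmetric] by (smt (verit) mult_left_mono norm_ge_zero)
      define r1 where "r1 = q (x + h1) - q x - M *v h1"
      define r2 where "r2 = q (x + h2) - q x - M *v h2"
      have "norm r1 \<le> e * norm h1" unfolding r1_def using d(2) n1 s by simp
      also have "\<dots> \<le> e * (s * N)" using n1 \<open>0 < e\<close> by (intro mult_left_mono) auto
      finally have r1: "norm r1 \<le> e * (s * N)" .
      have "norm r2 \<le> e * norm h2" unfolding r2_def using d(2) n2' s by simp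
      also have "\<dots> \<le> e * (s * N)" using n2' \<open>0 < e\<close> by (intro mult_left_mono) auto
      finally have r2: "norm r2 \<le> e * (s * N)" .
      have "M *v h1 - M *v h2 = s *\<^sub>R (M *v a)"
        by (simp add: h1_def h2_def matrix_vector_right_distrib matrix_vector_mult_scaleR)
      then have eqq: "q (x + h1) - q (x + h2) = s *\<^sub>R (M *v a) + (r1 - r2)"
        by (simp add: r1_def r2_def algebra_simps)
      have "F = (q (x + h1) - q (x + h2)) \<bullet> (s *\<^sub>R b)" unfolding F2 h1_def h2_def ..
      then have "F - s\<^sup>2 * ((M *v a) \<bullet> b) = s * ((r1 - r2) \<bullet> b)"
        unfolding eqq by (simp add: inner_add_left power2_eq_square algebra_simps)
      then have "\<bar>F - s\<^sup>2 * ((M *v a) \<bullet> b)\<bar> = s * \<bar>(r1 - r2) \<bullet> b\<bar>" using s by (simp add: abs_mult)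
      also have "\<dots> \<le> s * (norm (r1 - r2) * norm b)"
        using s by (intro mult_left_mono Cauchy_Schwarz_ineq2) auto
      also have "\<dots> \<le> s * ((2 * (e * (s * N))) * N)"
      proof -
        have "norm (r1 - r2) \<le> 2 * (e * (s * N))" using norm_triangle_ineq4[of r1 r2] r1 r2 by linarith
        moreover have "norm b \<le> N" using ab norm_ge_zero[of a] by linarith
        ultimately show ?thesis using s N0 \<open>0 < e\<close> by (intro mult_left_mono mult_mono) auto
      qed
      finally show ?thesis by (simp add: power2_eq_square algebra_simps)
    qed
    have e1: "\<bar>F - s\<^sup>2 * ((M *v v) \<bullet> w)\<bar> \<le> s\<^sup>2 * (e * (2 * N * N))"
      by (rule est) (simp_all add: F_def N_def)
    have e2: "\<bar>F - s\<^sup>2 * ((M *v w) \<bullet> v)\<bar> \<le> s\<^sup>2 * (e * (2 * N * N))"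
      by (rule est) (simp_all add: F_def N_def add.commute add.left_commute)
    have "\<bar>s\<^sup>2 * ((M *v v) \<bullet> w) - s\<^sup>2 * ((M *v w) \<bullet> v)\<bar> \<le> 2 * (s\<^sup>2 * (e * (2 * N * N)))"
      using e1 e2 by linarith
    then have "s\<^sup>2 * \<bar>(M *v v) \<bullet> w - (M *v w) \<bullet> v\<bar> \<le> s\<^sup>2 * (e * (2 * N * N * 2))"
      by (simp add: right_diff_distrib[symmetric] abs_mult)
    then have "\<bar>(M *v v) \<bullet> w - (M *v w) \<bullet> v\<bar> \<le> e * (2 * N * N * 2)" using s by simp
    then show ?thesis unfolding N_def .
  qed
  have "(M *v v) \<bullet> w = (M *v w) \<bullet> v" for v w
  proof -
    define K where "K = 2 * (norm v + norm w) * (norm v + norm w) * 2"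
    have K: "0 \<le> K" by (simp add: K_def)
    have "\<bar>(M *v v) \<bullet> w - (M *v w) \<bullet> v\<bar> \<le> 0 + \<epsilon>" if "0 < \<epsilon>" for \<epsilon>
    proof -
      have "\<bar>(M *v v) \<bullet> w - (M *v w) \<bullet> v\<bar> \<le> \<epsilon> / (K + 1) * K"
      proof -
        have "0 < \<epsilon> / (K + 1)" using that K by simp
        from key[OF this, of v w] show ?thesis unfolding K_def .
      qed
      also have "\<dots> \<le> \<epsilon>" using K that by (simp add: field_simps)
      finally show ?thesis by simp
    qed
    from field_le_epsilon[OF this] show ?thesis by simp
  qed
  from this[of "axis _ 1" "axis _ 1"] show ?thesis
    by (simp add: vec_eq_iff transpose_def inner_axis matrix_vector_mul_component)
qed

subsection \<open>The exponent\<close>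

text \<open>If \<open>P(0) = 1\<close> and \<open>p < 1\<close>, these are the closed forms of \<open>p s\<^sup>p \<integral>\<^sub>0\<^sup>s z\<^bsup>-p-1\<^esup> (P(z) - 1) dz\<close> and of
  \<open>\<integral>\<^sub>0\<^sup>1 z\<^bsup>-p\<^esup> P'(z) dz\<close>, the integral defining the exponent.\<close>

definition gain :: "real \<Rightarrow> real poly \<Rightarrow> real \<Rightarrow> real" where
  "gain p P s = p * (\<Sum>k=1..degree P. coeff P k / (real k - p) * s ^ k)"

definition moment :: "real \<Rightarrow> real poly \<Rightarrow> real" where
  "moment p P = (\<Sum>k=1..degree P. real k * coeff P k / (real k - p))"

lemma poly_split_0: "poly P (z::real) = coeff P 0 + (\<Sum>k=1..degree P. coeff P k * z ^ k)"
proof -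
  have "poly P z = (\<Sum>k=0..degree P. coeff P k * z ^ k)"
    by (simp add: poly_altdef atMost_atLeast0)
  then show ?thesis by (simp add: sum.atLeast_Suc_atMost)
qed

text \<open>From k/(k - p) = 1 + p/(k - p). When P vanishes at 1 this says that the gain at 1 is the
  moment plus 1, so a negative moment is the same as a gain below 1.\<close>

lemma gain_one:
  assumes "p < 1" "coeff P 0 = 1"
  shows "gain p P 1 = moment p P - poly P 1 + 1"
proof -
  have "moment p P = (\<Sum>k=1..degree P. coeff P k + p * (coeff P k / (real k - p)))"
    unfolding moment_def
  proof (rule sum.cong[OF refl])
    fix k assume "k \<in> {1..degree P}"
    then have "real k - p \<noteq> 0" using assms(1) by auto
    then show "real k * coeff P k / (real k - p) = coeff P k + p * (coeff P k / (real k - p))"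
      by (simp add: field_simps)
  qed
  then show ?thesis using poly_split_0[of P 1] assms(2)
    by (simp add: gain_def sum.distrib sum_distrib_left)
qed

text \<open>Coefficientwise, s d/ds multiplies s^k by k = p + (k - p), and the factor k - p cancels
  the denominator. This is the differentiated form of the integral representation.\<close>

lemma gain_ode:
  assumes "p < 1" "coeff P 0 = 1"
  shows "\<exists>d. (gain p P has_real_derivative d) (at s) \<and> s * d = p * gain p P s + p * (poly P s - 1)"
proof (intro exI conjI)
  let ?d = "p * (\<Sum>k=1..degree P. coeff P k / (real k - p) * (real k * s ^ (k - 1)))"
  show "(gain p P has_real_derivative ?d) (at s)"
    unfolding gain_def[abs_def] using DERIV_pow by (intro DERIV_cmult DERIV_sum) auto
  have "s * ?d = p * (\<Sum>k=1..degree P. s * (coeff P k / (real k - p) * (real k * s ^ (k - 1))))"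
    by (simp add: sum_distrib_left mult_ac)
  also have "(\<Sum>k=1..degree P. s * (coeff P k / (real k - p) * (real k * s ^ (k - 1)))) =
     (\<Sum>k=1..degree P. p * (coeff P k / (real k - p) * s ^ k) + coeff P k * s ^ k)"
  proof (rule sum.cong[OF refl])
    fix k assume k: "k \<in> {1..degree P}"
    then have nz: "real k - p \<noteq> 0" using assms(1) by auto
    have sk: "s * s ^ (k - 1) = s ^ k" using k by (simp add: power_eq_if)
    have "s * (coeff P k / (real k - p) * (real k * s ^ (k - 1))) = coeff P k / (real k - p) * real k * (s * s ^ (k - 1))"
      by simp
    also have "\<dots> = (p * (coeff P k / (real k - p)) + coeff P k) * s ^ k"
      unfolding sk using nz by (simp add: field_simps)
    finally show "s * (coeff P k / (real k - p) * (real k * s ^ (k - 1))) = p * (coeff P k / (real k - p) * s ^ k) + coeff P k * s ^ k"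
      by (simp add: algebra_simps)
  qed
  also have "p * \<dots> = p * gain p P s + p * (poly P s - 1)"
    using poly_split_0[of P s] assms(2)
    by (simp add: gain_def sum.distrib sum_distrib_left algebra_simps)
  finally show "s * ?d = p * gain p P s + p * (poly P s - 1)" .
qed

lemma powr_power: "0 \<le> z \<Longrightarrow> z powr a * z ^ k = (if k = 0 \<or> z \<noteq> 0 then z powr (a + real k) else 0)" for z :: real
  by (auto simp: powr_add powr_realpow)

text \<open>Subtracting the constant coefficient 1 leaves powers with exponents k - p - 1 > -1, so
  the singularity at 0 is integrable. Up to the positive factor p s^p this is the gain, whose sign
  can thus be read off from that of P - 1.\<close>

lemma gain_integral:
  assumes p: "p < 1" and s: "0 < s" and c0: "coeff P 0 = 1"
  shows "((\<lambda>z. z powr (- p - 1) * (poly P z - 1)) has_integral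
     (\<Sum>k=1..degree P. coeff P k / (real k - p) * s powr (real k - p))) {0..s}"
proof -
  have I: "((\<lambda>z. \<Sum>k=1..degree P. coeff P k * z powr (real k - p - 1)) has_integral
     (\<Sum>k=1..degree P. coeff P k * (s powr (real k - p - 1 + 1) / (real k - p - 1 + 1)))) {0..s}"
    by (intro has_integral_sum finite_atLeastAtMost has_integral_mult_right has_integral_powr_from_0)
      (use p s in auto)
  have "(\<Sum>k=1..degree P. coeff P k * z powr (real k - p - 1)) = z powr (- p - 1) * (poly P z - 1)"
    if z: "z \<in> {0..s}" for z
  proof -
    have "z powr (- p - 1) * (poly P z - 1) = (\<Sum>k=1..degree P. coeff P k * (z powr (- p - 1) * z ^ k))"
      by (simp add: poly_split_0 c0 sum_distrib_left mult.left_commute)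
    also have "\<dots> = (\<Sum>k=1..degree P. coeff P k * z powr (real k - p - 1))"
    proof (rule sum.cong[OF refl])
      fix k assume "k \<in> {1..degree P}"
      then have "z powr (- p - 1) * z ^ k = z powr (- p - 1 + real k)"
        using z by (simp add: powr_power)
      moreover have "- p - 1 + real k = real k - p - 1" by simp
      ultimately show "coeff P k * (z powr (- p - 1) * z ^ k) = coeff P k * z powr (real k - p - 1)"
        by (simp only:)
    qed
    finally show ?thesis ..
  qed
  from has_integral_eq[OF this I] show ?thesis by simp
qed

lemma gain_nonneg:
  assumes p: "0 < p" "p < 1" and s: "0 \<le> s" and c0: "coeff P 0 = 1"
    and ge: "\<And>z. 0 \<le> z \<Longrightarrow> z \<le> s \<Longrightarrow> 1 \<le> poly P z"
  shows "0 \<le> gain p P s"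
proof (cases "s = 0")
  case True then show ?thesis by (simp add: gain_def power_0_left)
next
  case False
  then have s: "0 < s" using s by simp
  have "0 \<le> (\<Sum>k=1..degree P. coeff P k / (real k - p) * s powr (real k - p))"
    by (rule has_integral_nonneg[OF gain_integral[OF p(2) s c0]]) (use ge in auto)
  also have "\<dots> = (\<Sum>k=1..degree P. coeff P k / (real k - p) * s ^ k) * s powr (- p)"
    unfolding sum_distrib_right using s by (intro sum.cong refl) (simp add: powr_diff powr_minus powr_realpow field_simps)
  finally have "0 \<le> (\<Sum>k=1..degree P. coeff P k / (real k - p) * s ^ k)"
    using s by (simp add: zero_le_mult_iff)
  then show ?thesis using p by (simp add: gain_def)
qed

text \<open>The shape shared by the polynomials of all indices: from the value 1 at 0 up to a peak
  and then down to 0 at 1, so that the level 1 is crossed downwards once. A peak at 0, for a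
  decreasing polynomial, is allowed and occurs for \<open>\<kappa>\<close> = 1.\<close>

definition hump :: "real poly \<Rightarrow> real \<Rightarrow> bool" where
  "hump P z0 \<longleftrightarrow> 0 \<le> z0 \<and> z0 < 1 \<and> coeff P 0 = 1 \<and> poly P 1 = 0 \<and> (\<forall>z. 0 \<le> z \<and> z < 1 \<longrightarrow> 0 < poly P z) \<and>
     (\<forall>z. 0 \<le> z \<and> z \<le> z0 \<longrightarrow> 0 \<le> poly (pderiv P) z) \<and> (\<forall>z. z0 \<le> z \<and> z \<le> 1 \<longrightarrow> poly (pderiv P) z \<le> 0)"

lemma poly_le_of_pderiv_nonneg:
  fixes P :: "real poly"
  assumes "a \<le> b" and d: "\<And>z. a \<le> z \<Longrightarrow> z \<le> b \<Longrightarrow> 0 \<le> poly (pderiv P) z"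
  shows "poly P a \<le> poly P b"
proof (rule DERIV_nonneg_imp_nondecreasing[OF assms(1)])
  fix x assume "a \<le> x" "x \<le> b"
  then show "\<exists>y. (poly P has_real_derivative y) (at x) \<and> 0 \<le> y"
    using d[of x] poly_DERIV[of P x] by (intro exI[of _ "poly (pderiv P) x"]) simp
qed

lemma poly_ge_of_pderiv_nonpos:
  fixes P :: "real poly"
  assumes "a \<le> b" and d: "\<And>z. a \<le> z \<Longrightarrow> z \<le> b \<Longrightarrow> poly (pderiv P) z \<le> 0"
  shows "poly P b \<le> poly P a"
  using poly_le_of_pderiv_nonneg[of a b "- P"] assms by (simp add: pderiv_minus)

text \<open>Up to the peak P is at least its initial value 1, so a value below 1 places s beyond the
  peak.\<close>

lemma hump_after_peak:
  assumes h: "hump P z0" and s: "0 \<le> s" "s \<le> w" "w \<le> 1" and lt: "poly P s < 1"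
  shows "poly P w \<le> poly P s"
proof -
  have P0: "poly P 0 = 1" using h by (simp add: hump_def poly_0_coeff_0)
  have "z0 < s"
  proof (rule ccontr)
    assume "\<not> z0 < s"
    then have "poly P 0 \<le> poly P s"
      using h s by (intro poly_le_of_pderiv_nonneg) (simp_all add: hump_def)
    with lt P0 show False by simp
  qed
  then show ?thesis
    using h s by (intro poly_ge_of_pderiv_nonpos) (simp_all add: hump_def)
qed

lemma hump_le_one_persists:
  assumes "hump P z0" "0 \<le> s" "s \<le> w" "w \<le> 1" "poly P s < 1"
  shows "poly P w \<le> 1"
  using hump_after_peak[OF assms] assms(5) by simp

lemma hump_ge_one_before:
  assumes "hump P z0" "0 \<le> z" "z \<le> s" "s \<le> 1" "1 \<le> poly P s"
  shows "1 \<le> poly P z"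
  using hump_after_peak[OF assms(1-4)] assms(5) by (cases "poly P z < 1") auto

text \<open>At an interior maximum \<open>s\<close> the equation \<open>s G' = p G + p (P - 1)\<close> for \<open>G = gain p P\<close> gives
  \<open>G(s) = 1 - P(s) < 1\<close>, so only the endpoint \<open>s = 1\<close> imposes a condition on \<open>p\<close>.\<close>

lemma gain_sup_bound:
  assumes h: "hump P z0" and p: "0 < p" "p < 1" and g1: "gain p P 1 < 1"
  shows "\<exists>c. 0 \<le> c \<and> c < 1 \<and> (\<forall>s. 0 \<le> s \<and> s \<le> 1 \<longrightarrow> gain p P s \<le> c)"
proof -
  have c0: "coeff P 0 = 1" using h by (simp add: hump_def)
  have "continuous_on {0..1} (gain p P)"
    unfolding gain_def[abs_def] by (intro continuous_intros)
  then obtain s where s: "s \<in> {0..1}" "\<And>t. t \<in> {0..1} \<Longrightarrow> gain p P t \<le> gain p P s"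
    using continuous_attains_sup[of "{0..1::real}" "gain p P"] by auto
  have "gain p P s < 1"
  proof -
    consider "s = 0" | "s = 1" | "0 < s" "s < 1" using s(1) by force
    then show ?thesis
    proof cases
      case 1 then show ?thesis by (simp add: gain_def power_0_left)
    next
      case 2 then show ?thesis using g1 by simp
    next
      case 3
      obtain d where d: "(gain p P has_real_derivative d) (at s)" "s * d = p * gain p P s + p * (poly P s - 1)"
        using gain_ode[OF p(2) c0] by blast
      have "d = 0"
      proof (rule DERIV_local_max[OF d(1)])
        show "0 < min s (1 - s)" using 3 by simp
        show "\<forall>y. \<bar>s - y\<bar> < min s (1 - s) \<longrightarrow> gain p P y \<le> gain p P s"
          by (intro allI impI s(2)) (auto simp: abs_less_iff)
      qed
      then have "p * (gain p P s + poly P s - 1) = 0" using d(2) by (simp add: algebra_simps)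
      then have "gain p P s = 1 - poly P s" using p by simp
      then show ?thesis using h 3 by (simp add: hump_def)
    qed
  qed
  then show ?thesis using s by (intro exI[of _ "max 0 (gain p P s)"]) (auto intro: max.coboundedI2)
qed

text \<open>By \<open>gain_ode\<close> the function A^p - \<open>\<Psi>\<close> A is an
  antiderivative of the integrand, so the integral is explicit and the claim becomes
  \<open>\<Psi> \<theta> - \<Psi> N \<le> c * \<theta> powr p\<close>. The value at
  \<open>\<theta>\<close> is controlled by the bound c on the gain; the issue is the sign of the
  value at N.\<close>

lemma weighted_integral_bound:
  assumes h: "hump P z0" and p: "0 < p" "p < 1"
    and c: "0 \<le> c" "\<And>s. 0 \<le> s \<Longrightarrow> s \<le> 1 \<Longrightarrow> gain p P s \<le> c"
    and t: "0 \<le> t" "t \<le> 1" and \<theta>: "0 < \<theta>" "\<theta> \<le> N"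
  shows "(\<integral>\<^sup>+A. ennreal (p * A powr (p - 1) * poly P (t * \<theta> / A)) * indicator {\<theta>..N} A \<partial>lborel)
      \<le> ennreal (N powr p - (1 - c) * \<theta> powr p)"
proof -
  have c0: "coeff P 0 = 1" using h by (simp add: hump_def)
  define \<Psi> where "\<Psi> = (\<lambda>A. A powr p * gain p P (t * \<theta> / A))"
  have D\<Psi>: "(\<Psi> has_real_derivative - (p * A powr (p - 1) * (poly P (t * \<theta> / A) - 1))) (at A)" if "0 < A" for A
  proof -
    define s where "s = t * \<theta> / A"
    obtain d where d: "(gain p P has_real_derivative d) (at s)" "s * d = p * gain p P s + p * (poly P s - 1)"
      using gain_ode[OF p(2) c0] by blast
    have "((\<lambda>A. t * \<theta> / A) has_real_derivative - s / A) (at A)"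
      using that by (auto intro!: derivative_eq_intros simp: s_def field_simps power2_eq_square)
    from DERIV_chain2[OF d(1)[unfolded s_def] this]
    have "((\<lambda>A. gain p P (t * \<theta> / A)) has_real_derivative d * (- s / A)) (at A)" .
    from DERIV_mult[OF has_real_derivative_powr[OF that, of p] this]
    have "(\<Psi> has_real_derivative (A powr p * (d * (- s / A)) + p * A powr (p - 1) * gain p P s)) (at A)"
      unfolding \<Psi>_def s_def by (simp add: algebra_simps)
    moreover have "A powr p = A * A powr (p - 1)" using that by (simp add: powr_diff)
    then have eq: "A powr p * (d * (- s / A)) + p * A powr (p - 1) * gain p P s = A powr (p - 1) * (- (s * d) + p * gain p P s)"
      using that by (simp add: field_simps)
    moreover have "A powr (p - 1) * (- (s * d) + p * gain p P s) = - (p * A powr (p - 1) * (poly P s - 1))" unfolding d(2) by (simp add: algebra_simps)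
    ultimately show ?thesis unfolding eq by (simp add: s_def)
  qed
  have Dp: "((\<lambda>A. A powr p) has_real_derivative p * A powr (p - 1)) (at A)" if "0 < A" for A
    using that by (rule has_real_derivative_powr)
  have le1: "t * \<theta> / A \<le> 1" "0 \<le> t * \<theta> / A" if "\<theta> \<le> A" for A
  proof -
    have "t * \<theta> \<le> A" using mult_right_mono[OF t(2), of \<theta>] \<theta> that by linarith
    then show "t * \<theta> / A \<le> 1" using that \<theta> by (simp add: divide_le_eq)
    show "0 \<le> t * \<theta> / A" using t \<theta> that by simp
  qed
  have pos: "0 \<le> poly P (t * \<theta> / A)" if "\<theta> \<le> A" for A
  proof (cases "t * \<theta> / A = 1")
    case True
    then show ?thesis using h unfolding hump_def by (simp only:)
  next
    case False
    then have "t * \<theta> / A < 1" using le1(1)[OF that] by linarith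
    then have "0 < poly P (t * \<theta> / A)" using h le1(2)[OF that] unfolding hump_def by blast
    then show ?thesis by simp
  qed
  have "(\<integral>\<^sup>+A. ennreal (p * A powr (p - 1) * poly P (t * \<theta> / A)) * indicator {\<theta>..N} A \<partial>lborel)
      = ennreal ((N powr p - \<Psi> N) - (\<theta> powr p - \<Psi> \<theta>))"
  proof (rule nn_integral_FTC_Icc)
    show "(\<lambda>A. p * A powr (p - 1) * poly P (t * \<theta> / A)) \<in> borel_measurable borel"
      unfolding poly_altdef by measurable
    fix A assume "A \<in> {\<theta>..N}"
    then have A: "\<theta> \<le> A" "A \<le> N" by auto
    show "((\<lambda>A. A powr p - \<Psi> A) has_real_derivative p * A powr (p - 1) * poly P (t * \<theta> / A)) (at A)"
      using DERIV_diff[OF Dp D\<Psi>, of A] A \<theta> by (simp add: algebra_simps)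
    show "0 \<le> p * A powr (p - 1) * poly P (t * \<theta> / A)" using pos[OF A(1)] p by simp
  qed (rule \<theta>)
  also have "\<dots> \<le> ennreal (N powr p - (1 - c) * \<theta> powr p)"
  proof (rule ennreal_leI)
    have "\<Psi> \<theta> - \<Psi> N \<le> c * \<theta> powr p"
    proof (cases "0 \<le> gain p P (t * \<theta> / N)")
      case True
      have "\<Psi> \<theta> \<le> c * \<theta> powr p" using c(2)[OF t] \<theta> by (simp add: \<Psi>_def)
      moreover have "0 \<le> \<Psi> N" using True by (simp add: \<Psi>_def)
      ultimately show ?thesis by simp
    next
      case False
      \<comment> \<open>A negative gain at t \<open>\<theta>\<close>/N means that P is already below
        1 there. Then P <= 1 at all the larger arguments that occur, so \<open>\<Psi>\<close>
        increases on [\<open>\<theta>\<close>, N] and the difference is at most 0.\<close>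
      have ltN: "poly P (t * \<theta> / N) < 1"
      proof (rule ccontr)
        assume ge: "\<not> poly P (t * \<theta> / N) < 1"
        have "1 \<le> poly P z" if z: "0 \<le> z" "z \<le> t * \<theta> / N" for z
          by (rule hump_ge_one_before[OF h z le1(1)[OF \<theta>(2)]]) (use ge in simp)
        then show False using gain_nonneg[OF p le1(2)[OF \<theta>(2)] c0] False by simp
      qed
      have le: "poly P (t * \<theta> / A) \<le> 1" if "\<theta> \<le> A" "A \<le> N" for A
      proof (rule hump_le_one_persists[OF h le1(2)[OF \<theta>(2)] _ _ ltN])
        show "t * \<theta> / N \<le> t * \<theta> / A" using that \<theta> t by (intro divide_left_mono) auto
        show "t * \<theta> / A \<le> 1" using le1[OF that(1)] by simp
      qed
      have "\<Psi> \<theta> \<le> \<Psi> N"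
      proof (rule DERIV_nonneg_imp_nondecreasing[OF \<theta>(2)])
        fix A assume A: "\<theta> \<le> A" "A \<le> N"
        have "0 \<le> - (p * A powr (p - 1) * (poly P (t * \<theta> / A) - 1))"
          using le[OF A] p by (simp add: mult_nonneg_nonpos)
        then show "\<exists>y. (\<Psi> has_real_derivative y) (at A) \<and> 0 \<le> y"
          using D\<Psi>[of A] A \<theta> by auto
      qed
      moreover have "0 \<le> c * \<theta> powr p" using c(1) by simp
      ultimately show ?thesis by linarith
    qed
    then show "N powr p - \<Psi> N - (\<theta> powr p - \<Psi> \<theta>) \<le> N powr p - (1 - c) * \<theta> powr p"
      by (simp add: algebra_simps)
  qed
  finally show ?thesis .
qed


section \<open>The polynomials of index r and their roots\<close>

definition pucci_poly :: "nat \<Rightarrow> nat \<Rightarrow> real \<Rightarrow> real poly" where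
  "pucci_poly n r \<kappa> = [:1, -1:] ^ r * [:1, \<kappa> * real r / real (n - r):] ^ (n - r)"

lemma poly_pucci_poly: "poly (pucci_poly n r \<kappa>) z = P_poly n r \<kappa> z"
  by (simp add: pucci_poly_def P_poly_def algebra_simps)

lemma deriv_P_poly: "deriv (P_poly n r \<kappa>) z = poly (pderiv (pucci_poly n r \<kappa>)) z"
proof -
  have "P_poly n r \<kappa> = poly (pucci_poly n r \<kappa>)" by (simp add: fun_eq_iff poly_pucci_poly)
  then show ?thesis by (simp add: DERIV_imp_deriv)
qed

text \<open>The slope of the second factor times its exponent is \<open>\<kappa>\<close> r, so r
  splits off from both terms of the product rule and a linear factor remains that alone decides the
  sign on [0, 1).\<close>

lemma pderiv_pucci_poly:
  assumes "1 \<le> r" "r < n"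
  shows "poly (pderiv (pucci_poly n r \<kappa>)) z =
    real r * (1 - z) ^ (r - 1) * (1 + \<kappa> * real r / real (n - r) * z) ^ (n - r - 1) *
      ((\<kappa> - 1) - (\<kappa> * real r / real (n - r) + \<kappa>) * z)"
proof -
  define m where "m = n - r"
  define c where "c = \<kappa> * real r / real m"
  have m: "1 \<le> m" using assms by (simp add: m_def)
  have mc: "real m * c = \<kappa> * real r" using m by (simp add: c_def)
  obtain r' where r': "r = Suc r'" using assms(1) by (cases r) auto
  obtain m' where m': "m = Suc m'" using m by (cases m) auto
  have eq: "pucci_poly n r \<kappa> = [:1, -1:] ^ Suc r' * [:1, c:] ^ Suc m'"
    unfolding pucci_poly_def c_def m_def[symmetric] by (simp only: r'[symmetric] m'[symmetric])
  have "poly (pderiv (pucci_poly n r \<kappa>)) z =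
     (1 - z) ^ r' * (1 + c * z) ^ m' * ((real (Suc m') * c) * (1 - z) - real (Suc r') * (1 + c * z))"
    unfolding eq pderiv_mult pderiv_power_Suc by (simp add: pderiv_pCons algebra_simps)
  then have "poly (pderiv (pucci_poly n r \<kappa>)) z =
     (1 - z) ^ r' * (1 + c * z) ^ m' * ((real m * c) * (1 - z) - real r * (1 + c * z))"
    by (simp only: r' m')
  also have "\<dots> = real r * (1 - z) ^ r' * (1 + c * z) ^ m' * ((\<kappa> - 1) - (c + \<kappa>) * z)"
    unfolding mc by (simp add: algebra_simps)
  finally have "poly (pderiv (pucci_poly n r \<kappa>)) z =
     real r * (1 - z) ^ (r - 1) * (1 + c * z) ^ (m - 1) * ((\<kappa> - 1) - (c + \<kappa>) * z)"
    by (simp only: r' m' diff_Suc_1)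
  then show ?thesis by (simp only: m_def c_def)
qed

text \<open>The zero of the linear factor of the derivative; for 1 <= r < n it equals
  (\<open>\<kappa>\<close> - 1)(n - r)/(\<open>\<kappa>\<close> n).\<close>

definition pucci_peak :: "nat \<Rightarrow> nat \<Rightarrow> real \<Rightarrow> real" where
  "pucci_peak n r \<kappa> = (\<kappa> - 1) / (\<kappa> * real r / real (n - r) + \<kappa>)"

lemma pucci_peak_sign:
  assumes "1 \<le> r" "r < n" "1 \<le> \<kappa>"
  shows "0 \<le> pucci_peak n r \<kappa>" "pucci_peak n r \<kappa> < 1" "1 < \<kappa> \<Longrightarrow> 0 < pucci_peak n r \<kappa>"
    "0 \<le> z \<Longrightarrow> z < pucci_peak n r \<kappa> \<Longrightarrow> 0 < poly (pderiv (pucci_poly n r \<kappa>)) z"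
    "0 \<le> z \<Longrightarrow> z \<le> pucci_peak n r \<kappa> \<Longrightarrow> 0 \<le> poly (pderiv (pucci_poly n r \<kappa>)) z"
    "pucci_peak n r \<kappa> \<le> z \<Longrightarrow> z \<le> 1 \<Longrightarrow> poly (pderiv (pucci_poly n r \<kappa>)) z \<le> 0"
proof -
  define c where "c = \<kappa> * real r / real (n - r)"
  have c: "0 < c" using assms by (simp add: c_def)
  have pk: "pucci_peak n r \<kappa> = (\<kappa> - 1) / (c + \<kappa>)" by (simp add: pucci_peak_def c_def)
  have ck: "0 < c + \<kappa>" using c assms by simp
  show 1: "0 \<le> pucci_peak n r \<kappa>" and 2: "pucci_peak n r \<kappa> < 1" and "1 < \<kappa> \<Longrightarrow> 0 < pucci_peak n r \<kappa>"
    unfolding pk using ck c assms by (auto simp: divide_less_eq)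
  have d: "poly (pderiv (pucci_poly n r \<kappa>)) z = real r * (1 - z) ^ (r - 1) * (1 + c * z) ^ (n - r - 1) * ((\<kappa> - 1) - (c + \<kappa>) * z)" for z
    using pderiv_pucci_poly[OF assms(1,2)] by (simp add: c_def)
  have f: "0 \<le> real r * (1 - z) ^ (r - 1) * (1 + c * z) ^ (n - r - 1)" if "0 \<le> z" "z \<le> 1" for z
    using that c by simp
  show "0 < poly (pderiv (pucci_poly n r \<kappa>)) z" if "0 \<le> z" "z < pucci_peak n r \<kappa>"
  proof -
    have "z < 1" using that 2 by simp
    moreover have "0 < (\<kappa> - 1) - (c + \<kappa>) * z" using that(2) ck by (simp add: pk field_simps)
    moreover have "0 < 1 + c * z" using c that(1) by (simp add: add_pos_nonneg)
    ultimately show ?thesis unfolding d using assms(1) by (intro mult_pos_pos zero_less_power) auto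
  qed
  show "0 \<le> poly (pderiv (pucci_poly n r \<kappa>)) z" if "0 \<le> z" "z \<le> pucci_peak n r \<kappa>"
  proof -
    have "z \<le> 1" using that(2) 2 by linarith
    moreover have "0 \<le> (\<kappa> - 1) - (c + \<kappa>) * z" using that(2) ck by (simp add: pk field_simps)
    ultimately show ?thesis unfolding d by (intro mult_nonneg_nonneg[OF f[OF that(1)]])
  qed
  show "poly (pderiv (pucci_poly n r \<kappa>)) z \<le> 0" if "pucci_peak n r \<kappa> \<le> z" "z \<le> 1"
  proof -
    have "0 \<le> z" using that(1) 1 by linarith
    moreover have "(\<kappa> - 1) - (c + \<kappa>) * z \<le> 0" using that(1) ck by (simp add: pk field_simps)
    ultimately show ?thesis unfolding d using that(2) by (intro mult_nonneg_nonpos[OF f])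
  qed
qed

lemma hump_pucci_poly:
  assumes "1 \<le> r" "r < n" "1 \<le> \<kappa>"
  shows "hump (pucci_poly n r \<kappa>) (pucci_peak n r \<kappa>)"
  unfolding hump_def
proof (intro conjI allI impI)
  show "coeff (pucci_poly n r \<kappa>) 0 = 1"
    by (simp add: poly_0_coeff_0[symmetric] poly_pucci_poly P_poly_def)
  show "poly (pucci_poly n r \<kappa>) 1 = 0" using assms by (simp add: poly_pucci_poly P_poly_def)
  show "0 < poly (pucci_poly n r \<kappa>) z" if "0 \<le> z \<and> z < 1" for z
    using that assms by (simp add: poly_pucci_poly P_poly_def add_pos_nonneg)
qed (use pucci_peak_sign[OF assms] in auto)

lemma moment_integral:
  assumes p: "p < 1"
  shows "((\<lambda>z. z powr (- p) * poly (pderiv P) z) has_integral moment p P) {0..1}"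
proof -
  have I: "((\<lambda>z. \<Sum>k=1..degree P. real k * coeff P k * z powr (real k - 1 - p)) has_integral
     (\<Sum>k=1..degree P. real k * coeff P k * (1 powr (real k - 1 - p + 1) / (real k - 1 - p + 1)))) {0..1}"
    by (intro has_integral_sum finite_atLeastAtMost has_integral_mult_right has_integral_powr_from_0)
      (use p in auto)
  have pd: "poly (pderiv P) z = (\<Sum>k=1..degree P. real k * coeff P k * z ^ (k - 1))" for z
  proof -
    have D: "(poly P has_real_derivative (\<Sum>k=1..degree P. coeff P k * (real k * z ^ (k - 1)))) (at z)"
    proof -
      have "((\<lambda>z. coeff P 0 + (\<Sum>k=1..degree P. coeff P k * z ^ k)) has_real_derivative
         0 + (\<Sum>k=1..degree P. coeff P k * (real k * z ^ (k - 1)))) (at z)"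
        using DERIV_pow by (intro DERIV_add DERIV_const DERIV_cmult DERIV_sum) auto
      moreover have "poly P = (\<lambda>z. coeff P 0 + (\<Sum>k=1..degree P. coeff P k * z ^ k))"
        using poly_split_0 by blast
      ultimately show ?thesis by simp
    qed
    then show ?thesis using DERIV_unique[OF poly_DERIV D] by (simp add: mult_ac)
  qed
  have "(\<Sum>k=1..degree P. real k * coeff P k * z powr (real k - 1 - p)) = z powr (- p) * poly (pderiv P) z"
    if z: "z \<in> {0..1}" for z
    unfolding pd sum_distrib_left
  proof (rule sum.cong[OF refl])
    fix k assume k: "k \<in> {1..degree P}"
    have "z powr (- p) * z ^ (k - 1) = z powr (real k - 1 - p)"
    \<comment> \<open>At 0 both sides vanish because \<open>0 powr a = 0\<close> for every
      a.\<close>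
    proof (cases "z = 0")
      case False
      then have "z powr (- p) * z ^ (k - 1) = z powr (- p + real (k - 1))"
        unfolding powr_add using z powr_realpow[of z "k - 1"] by simp
      moreover have "- p + real (k - 1) = real k - 1 - p" using k by (simp add: of_nat_diff)
      ultimately show ?thesis by (simp only:)
    qed simp
    then show "real k * coeff P k * z powr (real k - 1 - p) = z powr (- p) * (real k * coeff P k * z ^ (k - 1))"
      by (simp add: mult_ac)
  qed
  from has_integral_eq[OF this I] show ?thesis by (simp add: moment_def algebra_simps)
qed

lemma moment_zero: "moment 0 P = poly P 1 - coeff P 0"
  using poly_split_0[of P 1] by (simp add: moment_def)

text \<open>The weight (z0/z)^p increases with p for z < z0 and decreases for z > z0, and the
  derivative of P is positive on the first side and nonpositive on the second. After normalization
  by z0^p the integrand therefore increases with p at every point.\<close>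

lemma moment_strict_mono:
  assumes h: "hump P z0" and z0: "0 < z0" and pos: "\<And>z. 0 \<le> z \<Longrightarrow> z < z0 \<Longrightarrow> 0 < poly (pderiv P) z"
    and pq: "p < q" "q < 1"
  shows "z0 powr p * moment p P < z0 powr q * moment q P"
proof -
  define D where "D = (\<lambda>z. (z0 powr q * z powr (- q) - z0 powr p * z powr (- p)) * poly (pderiv P) z)"
  have ratio: "z0 powr q * z powr (- q) - z0 powr p * z powr (- p) = (z0 / z) powr q - (z0 / z) powr p" if "0 < z" for z
    using that z0 by (simp add: powr_divide powr_minus_divide)
  have D1: "0 < D z" if "0 < z" "z < z0" for z
  proof -
    have "1 < z0 / z" using that by simp
    then have "(z0 / z) powr p < (z0 / z) powr q" using pq(1) by (rule powr_less_mono[rotated])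
    then show ?thesis using pos[of z] that unfolding D_def ratio[OF that(1)] by simp
  qed
  have D0: "0 \<le> D z" if "0 \<le> z" "z \<le> 1" for z
  proof -
    have "z = 0 \<or> 0 < z \<and> z < z0 \<or> 0 < z \<and> z0 \<le> z" using that by linarith
    then consider "z = 0" | "0 < z" "z < z0" | "0 < z" "z0 \<le> z" by blast
    then show ?thesis
    proof cases
      case 3
      then have "(z0 / z) powr q \<le> (z0 / z) powr p"
        using z0 pq(1) by (intro powr_mono') auto
      then show ?thesis using h 3 that unfolding D_def ratio[OF 3(1)]
        by (intro mult_nonpos_nonpos) (auto simp: hump_def)
    qed (use D1 in \<open>auto simp: D_def intro: less_imp_le\<close>)
  qed
  have DI: "(D has_integral (z0 powr q * moment q P - z0 powr p * moment p P)) {0..1}"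
  proof -
    have "((\<lambda>z. z0 powr q * (z powr (- q) * poly (pderiv P) z) - z0 powr p * (z powr (- p) * poly (pderiv P) z))
       has_integral (z0 powr q * moment q P - z0 powr p * moment p P)) {0..1}"
      by (intro has_integral_diff has_integral_mult_right moment_integral) (use pq in auto)
    then show ?thesis by (simp add: D_def algebra_simps)
  qed
  \<comment> \<open>A compact interval inside (0, z0), away from the singularity at 0, on which D
    has a positive minimum; it supplies the strict inequality.\<close>
  let ?a = "z0/4" and ?b = "z0/2"
  have "continuous_on {?a..?b} D"
    unfolding D_def using z0 by (intro continuous_intros) auto
  then obtain w where w: "w \<in> {?a..?b}" "\<And>z. z \<in> {?a..?b} \<Longrightarrow> D w \<le> D z"
    using continuous_attains_inf[of "{?a..?b}" D] z0 by auto
  have Dw: "0 < D w" using D1[of w] w(1) z0 by auto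
  have z01: "z0 < 1" using h by (simp add: hump_def)
  have DI': "D integrable_on {?a..?b}"
    by (rule integrable_on_subinterval[of D "{0..1}"]) (use DI z0 z01 in auto)
  have "D w * (?b - ?a) = integral {?a..?b} (\<lambda>_. D w)" using z0 by simp
  also have "\<dots> \<le> integral {?a..?b} D"
    by (rule integral_le) (use DI' w in auto)
  also have "\<dots> \<le> integral {0..1} D"
    by (rule integral_subset_le) (use DI DI' D0 z0 z01 in auto)
  also have "\<dots> = z0 powr q * moment q P - z0 powr p * moment p P"
    using DI by (rule integral_unique)
  finally have "D w * (?b - ?a) \<le> z0 powr q * moment q P - z0 powr p * moment p P" .
  moreover have "0 < D w * (?b - ?a)" using Dw z0 by simp
  ultimately show ?thesis by linarith
qed

text \<open>At p = 0 the moment is P(1) - P(0) = -1, and as p tends to 1 the term k = 1 tends to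
  infinity because the derivative of P at 0 is positive. The intermediate value theorem applies in
  between.\<close>

lemma moment_root:
  assumes h: "hump P z0" and z0: "0 < z0" and pos: "\<And>z. 0 \<le> z \<Longrightarrow> z < z0 \<Longrightarrow> 0 < poly (pderiv P) z"
  shows "\<exists>p. 0 < p \<and> p < 1 \<and> moment p P = 0"
proof -
  have m0: "moment 0 P = -1" using h by (simp add: moment_zero hump_def)
  have c1: "0 < coeff P 1"
    using pos[of 0] z0 by (simp add: poly_0_coeff_0 coeff_pderiv)
  then have deg: "1 \<le> degree P" by (intro le_degree) simp
  define B where "B = (\<Sum>k=2..degree P. 2 * \<bar>coeff P k\<bar>)"
  have B0: "0 \<le> B" unfolding B_def by (intro sum_nonneg) auto
  \<comment> \<open>At q = 1 - \<open>\<delta>\<close> the term k = 1 is at least B + 1, while the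
    others are bounded by B because k/(k - q) <= 2 for k >= 2. The cap 1/2 keeps q positive.\<close>
  define \<delta> where "\<delta> = min (1/2) (coeff P 1 / (B + 1))"
  have \<delta>le: "\<delta> \<le> coeff P 1 / (B + 1)" unfolding \<delta>_def by (rule min.cobounded2)
  have \<delta>: "0 < \<delta>" "\<delta> \<le> 1/2" "\<delta> * (B + 1) \<le> coeff P 1"
  proof -
    show "0 < \<delta>" using c1 B0 by (simp add: \<delta>_def)
    show "\<delta> \<le> 1/2" unfolding \<delta>_def by (rule min.cobounded1)
    from \<delta>le show "\<delta> * (B + 1) \<le> coeff P 1" using B0 by (simp add: pos_le_divide_eq)
  qed
  define q where "q = 1 - \<delta>"
  have split: "moment q P = coeff P 1 / \<delta> + (\<Sum>k=2..degree P. real k * coeff P k / (real k - q))"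
    using deg by (simp add: moment_def sum.atLeast_Suc_atMost q_def numeral_2_eq_2)
  have "\<bar>\<Sum>k=2..degree P. real k * coeff P k / (real k - q)\<bar> \<le> (\<Sum>k=2..degree P. \<bar>real k * coeff P k / (real k - q)\<bar>)"
    by (rule sum_abs)
  also have "\<dots> \<le> B"
    unfolding B_def
  proof (rule sum_mono)
    fix k assume k: "k \<in> {2..degree P}"
    then have kq: "0 < real k - q" "real k \<le> 2 * (real k - q)" using \<delta> by (auto simp: q_def)
    have "\<bar>real k * coeff P k / (real k - q)\<bar> = (real k / (real k - q)) * \<bar>coeff P k\<bar>"
      using kq by (simp add: abs_mult)
    also have "\<dots> \<le> 2 * \<bar>coeff P k\<bar>"
      using kq by (intro mult_right_mono) (auto simp: divide_le_eq)
    finally show "\<bar>real k * coeff P k / (real k - q)\<bar> \<le> 2 * \<bar>coeff P k\<bar>" .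
  qed
  finally have "- B \<le> (\<Sum>k=2..degree P. real k * coeff P k / (real k - q))" by simp
  moreover have "B + 1 \<le> coeff P 1 / \<delta>" using \<delta> by (simp add: le_divide_eq mult.commute)
  ultimately have mq: "0 \<le> moment q P" using split by simp
  have "continuous_on {0..q} (\<lambda>p. moment p P)"
    unfolding moment_def using \<delta> by (intro continuous_intros) (auto simp: q_def)
  then obtain p where p: "0 \<le> p" "p \<le> q" "moment p P = 0"
    using IVT'[of "\<lambda>p. moment p P" 0 0 q] m0 mq \<delta> by (auto simp: q_def)
  then show ?thesis using m0 \<delta> by (intro exI[of _ p]) (auto simp: q_def less_le)
qed

text \<open>Monotonicity of the normalized moment gives both uniqueness of the root and negativity
  of the moment below it. For \<open>\<kappa>\<close> = 1 the polynomial is decreasing and the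
  moment is negative for all p in (0, 1), in accordance with the convention that the root is
  1.\<close>

lemma p_root_properties:
  assumes "1 \<le> r" "r < n" "1 \<le> \<kappa>"
  shows "0 < p_root n r \<kappa>" "p_root n r \<kappa> \<le> 1"
    "0 < p \<Longrightarrow> p < p_root n r \<kappa> \<Longrightarrow> gain p (pucci_poly n r \<kappa>) 1 < 1"
proof -
  let ?P = "pucci_poly n r \<kappa>" and ?z = "pucci_peak n r \<kappa>"
  note h = hump_pucci_poly[OF assms]
  have g: "gain p ?P 1 = moment p ?P + 1" if "p < 1" for p
    using gain_one[OF that, of ?P] h by (simp add: hump_def)
  have "0 < p_root n r \<kappa> \<and> p_root n r \<kappa> \<le> 1 \<and> (\<forall>p. 0 < p \<and> p < p_root n r \<kappa> \<longrightarrow> moment p ?P < 0)"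
  proof (cases "\<kappa> = 1")
    case True
    have le: "moment p ?P < 0" if p: "0 < p" "p < 1" for p
    proof -
      have neg: "poly (pderiv ?P) z \<le> 0" if "z \<in> {0..1}" for z
        using pucci_peak_sign(6)[OF assms, of z] that True by (simp add: pucci_peak_def)
      have "moment p ?P \<le> moment 0 ?P"
      proof (rule has_integral_le[OF moment_integral moment_integral])
        fix z :: real assume z: "z \<in> {0..1}"
        have "z powr 0 \<le> z powr (- p)" using powr_mono'[of "- p" 0 z] z p by (cases "z = 0") auto
        then show "z powr (- p) * poly (pderiv ?P) z \<le> z powr (- 0) * poly (pderiv ?P) z"
          using neg[OF z] by (simp add: mult_right_mono_neg)
      qed (use p in auto)
      then show ?thesis using h by (simp add: moment_zero hump_def)
    qed
    then show ?thesis using True by (simp add: p_root_def)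
  next
    case False
    then have k: "1 < \<kappa>" using assms by simp
    note pk = pucci_peak_sign(3)[OF assms k]
    note sm = moment_strict_mono[OF h pk pucci_peak_sign(4)[OF assms]]
    obtain p0 where p0: "0 < p0" "p0 < 1" "moment p0 ?P = 0"
      using moment_root[OF h pk pucci_peak_sign(4)[OF assms]] by blast
    have uniq: "p = p0" if "0 < p" "p < 1" "moment p ?P = 0" for p
      using sm[of p p0] sm[of p0 p] that p0 by (cases p p0 rule: linorder_cases) auto
    have char: "((\<lambda>z. z powr (- p) * deriv (P_poly n r \<kappa>) z) has_integral 0) {0..1} \<longleftrightarrow> moment p ?P = 0"
      if "p < 1" for p
      unfolding deriv_P_poly
    proof
      assume "((\<lambda>z. z powr (- p) * poly (pderiv ?P) z) has_integral 0) {0..1}"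
      from has_integral_unique[OF moment_integral[OF that] this] show "moment p ?P = 0" .
    qed (use moment_integral[OF that, of ?P] in simp)
    have "p_root n r \<kappa> = p0"
    proof -
      have "(THE p. 0 < p \<and> p < 1 \<and> ((\<lambda>z. z powr (- p) * deriv (P_poly n r \<kappa>) z) has_integral 0) {0..1}) = p0"
        by (rule the_equality) (use p0 char uniq in blast)+
      then show ?thesis using False by (simp add: p_root_def)
    qed
    moreover have "moment p ?P < 0" if "0 < p" "p < p0" for p
    proof -
      have "?z powr p * moment p ?P < 0" using sm[of p p0] that p0 by simp
      then show ?thesis using pk by (simp add: mult_less_0_iff)
    qed
    ultimately show ?thesis using p0 by auto
  qed
  then show "0 < p_root n r \<kappa>" and le: "p_root n r \<kappa> \<le> 1"
    and "0 < p \<Longrightarrow> p < p_root n r \<kappa> \<Longrightarrow> gain p ?P 1 < 1"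
    using g[of p] by auto
qed

lemma p_lower_properties:
  assumes "2 \<le> n" "1 \<le> \<kappa>"
  shows "0 < p_lower n \<kappa>" "p_lower n \<kappa> \<le> 1"
    "1 \<le> r \<Longrightarrow> r < n \<Longrightarrow> p_lower n \<kappa> \<le> p_root n r \<kappa>"
proof -
  let ?S = "(\<lambda>r. p_root n r \<kappa>) ` {1..n - 1}"
  have S: "finite ?S" "?S \<noteq> {}" using assms by auto
  have "p_lower n \<kappa> \<in> ?S" unfolding p_lower_def by (rule Min_in[OF S])
  then obtain s where s: "1 \<le> s" "s < n" "p_lower n \<kappa> = p_root n s \<kappa>" using assms by auto
  show "0 < p_lower n \<kappa>" "p_lower n \<kappa> \<le> 1"
    using p_root_properties(1,2)[OF s(1,2) assms(2)] s(3) by simp_all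
  show "p_lower n \<kappa> \<le> p_root n r \<kappa>" if "1 \<le> r" "r < n"
    unfolding p_lower_def by (rule Min_le[OF S(1)]) (use that in auto)
qed

section \<open>Jacobian bounds from the Pucci inequality\<close>

lemma prod_le_mean_power:
  fixes x :: "'a \<Rightarrow> real"
  assumes "finite S" "S \<noteq> {}" "\<And>i. i \<in> S \<Longrightarrow> 0 \<le> x i"
  shows "(\<Prod>i\<in>S. x i) \<le> ((\<Sum>i\<in>S. x i) / real (card S)) ^ card S"
proof -
  have c: "0 < card S" using assms by (simp add: card_gt_0_iff)
  have P: "0 \<le> (\<Prod>i\<in>S. x i)" using assms by (simp add: prod_nonneg)
  show ?thesis
  proof (cases "(\<Prod>i\<in>S. x i) = 0")
    case True
    have "0 \<le> (\<Sum>i\<in>S. x i) / real (card S)" using assms(3) by (intro divide_nonneg_nonneg sum_nonneg) auto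
    then show ?thesis unfolding True by (rule zero_le_power)
  next
    case False
    then have pos: "0 < (\<Prod>i\<in>S. x i)" using P by simp
    have "(\<Prod>i\<in>S. x i) = ((\<Prod>i\<in>S. x i) powr (1 / real (card S))) ^ card S"
      using pos c by (simp add: powr_realpow[symmetric] powr_powr)
    also have "\<dots> \<le> (\<Sum>i\<in>S. x i / real (card S)) ^ card S"
      using arith_geom_mean[OF assms(1,2), of x] assms(3) by (intro power_mono) auto
    finally show ?thesis by (simp add: sum_divide_distrib)
  qed
qed

text \<open>The arithmetic-geometric mean inequality is applied separately to the negative and the
  nonnegative eigenvalues. Here t \<open>\<theta>\<close> is the mean size of the r negative ones,
  and the Pucci inequality bounds the sum of the others by \<open>\<kappa>\<close> r t
  \<open>\<theta>\<close>. Without negative eigenvalues all of them vanish; if all are negative, the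
  product is at most 1. The numbers r and t do not depend on A, so the bound can be integrated in
  A.\<close>

lemma eigenvalue_prod_le:
  fixes \<mu> :: "'n::finite \<Rightarrow> real"
  assumes \<theta>: "0 < \<theta>" and low: "\<And>i. - \<theta> \<le> \<mu> i" and k: "1 \<le> \<kappa>"
    and puc: "(\<Sum>i\<in>UNIV. max 0 (\<mu> i)) \<le> \<kappa> * (\<Sum>i\<in>UNIV. max 0 (- \<mu> i))"
  shows "(\<forall>A\<ge>\<theta>. (\<Prod>i\<in>UNIV. 1 + \<mu> i / A) \<le> 1) \<or>
    (\<exists>r t. 1 \<le> r \<and> r < CARD('n) \<and> 0 \<le> t \<and> t \<le> 1 \<and>
      (\<forall>A\<ge>\<theta>. (\<Prod>i\<in>UNIV. 1 + \<mu> i / A) \<le> poly (pucci_poly CARD('n) r \<kappa>) (t * \<theta> / A)))"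
proof -
  define Ng where "Ng = {i. \<mu> i < 0}"
  define r where "r = card Ng"
  have fac: "0 \<le> 1 + \<mu> i / A" if "\<theta> \<le> A" for i A
    using low[of i] that \<theta> by (simp add: field_simps) 
  have negsum: "(\<Sum>i\<in>UNIV. max 0 (- \<mu> i)) = - (\<Sum>i\<in>Ng. \<mu> i)"
    unfolding sum_negf[symmetric] by (rule sum.mono_neutral_cong_right) (auto simp: Ng_def)
  have possum: "(\<Sum>i\<in>UNIV. max 0 (\<mu> i)) = (\<Sum>i\<in>- Ng. \<mu> i)"
    by (rule sum.mono_neutral_cong_right) (auto simp: Ng_def)
  have rle: "r \<le> CARD('n)" unfolding r_def by (intro card_mono) auto
  consider "r = 0" | "r = CARD('n)" | "1 \<le> r" "r < CARD('n)" using rle by linarith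
  then show ?thesis
  proof cases
    case 1
    then have "Ng = {}" by (simp add: r_def)
    then have nn: "0 \<le> \<mu> i" for i by (auto simp: Ng_def not_less)
    have "(\<Sum>i\<in>UNIV. \<mu> i) \<le> 0" using puc \<open>Ng = {}\<close> unfolding negsum possum by simp
    then have "\<mu> i = 0" for i using nn sum_nonneg_eq_0_iff[of UNIV \<mu>] sum_nonneg[of UNIV \<mu>] by (simp add: antisym)
    then show ?thesis by simp
  next
    case 2
    then have "Ng = UNIV" by (metis card_subset_eq finite r_def subset_UNIV)
    then have "\<mu> i < 0" for i by (auto simp: Ng_def)
    then have "(\<Prod>i\<in>UNIV. 1 + \<mu> i / A) \<le> 1" if "\<theta> \<le> A" for A
      using fac[OF that] \<theta> that by (intro prod_le_1) (auto simp: divide_nonpos_pos less_imp_le)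
    then show ?thesis by blast
  next
    case 3
    define t where "t = - (\<Sum>i\<in>Ng. \<mu> i) / (real r * \<theta>)"
    have St: "(\<Sum>i\<in>Ng. \<mu> i) = - (real r * \<theta> * t)" using 3 \<theta> by (simp add: t_def)
    have t0: "0 \<le> t" unfolding t_def using \<theta> by (intro divide_nonneg_nonneg) (auto simp: Ng_def intro!: sum_nonpos)
    have "- (\<Sum>i\<in>Ng. \<mu> i) \<le> (\<Sum>i\<in>Ng. \<theta>)" unfolding sum_negf[symmetric] using low by (intro sum_mono) (simp add: minus_le_iff)
    then have "- (\<Sum>i\<in>Ng. \<mu> i) \<le> real r * \<theta>" by (simp add: r_def)
    moreover have "0 < real r * \<theta>" using 3 \<theta> by simp
    ultimately have t1: "t \<le> 1" unfolding t_def by (subst divide_le_eq_1_pos)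
    have cP: "card (- Ng) = CARD('n) - r" by (simp add: r_def Compl_eq_Diff_UNIV card_Diff_subset)
    have ne: "Ng \<noteq> {}" "- Ng \<noteq> {}" using 3 cP by (auto simp: r_def)
    have "(\<Prod>i\<in>UNIV. 1 + \<mu> i / A) \<le> poly (pucci_poly CARD('n) r \<kappa>) (t * \<theta> / A)" if A: "\<theta> \<le> A" for A
    proof -
      have A0: "0 < A" using A \<theta> by simp
      have "(\<Prod>i\<in>UNIV. 1 + \<mu> i / A) = (\<Prod>i\<in>Ng. 1 + \<mu> i / A) * (\<Prod>i\<in>- Ng. 1 + \<mu> i / A)"
        by (subst prod.union_disjoint[symmetric]) (auto simp: Un_commute)
      also have "\<dots> \<le> (1 - t * \<theta> / A) ^ r * (1 + \<kappa> * real r / real (CARD('n) - r) * (t * \<theta> / A)) ^ (CARD('n) - r)"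
      proof (rule mult_mono)
        have "(\<Sum>i\<in>Ng. 1 + \<mu> i / A) / real r = 1 - t * \<theta> / A"
          using 3 A0 by (simp add: sum.distrib sum_divide_distrib[symmetric] St r_def[symmetric] field_simps)
        then show "(\<Prod>i\<in>Ng. 1 + \<mu> i / A) \<le> (1 - t * \<theta> / A) ^ r"
          using prod_le_mean_power[of Ng "\<lambda>i. 1 + \<mu> i / A"] fac[OF A] ne by (simp add: r_def)
        have "(\<Sum>i\<in>- Ng. \<mu> i) \<le> \<kappa> * (real r * \<theta> * t)" using puc unfolding negsum possum St by simp
        then have "(\<Sum>i\<in>- Ng. \<mu> i) / A / real (CARD('n) - r) \<le> \<kappa> * (real r * \<theta> * t) / A / real (CARD('n) - r)"
          using A0 by (intro divide_right_mono) auto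
        moreover have "(\<Sum>i\<in>- Ng. 1 + \<mu> i / A) / real (CARD('n) - r) = 1 + (\<Sum>i\<in>- Ng. \<mu> i) / A / real (CARD('n) - r)"
          using 3 by (simp add: sum.distrib sum_divide_distrib[symmetric] cP add_divide_distrib)
        ultimately have "(\<Sum>i\<in>- Ng. 1 + \<mu> i / A) / real (CARD('n) - r) \<le> 1 + \<kappa> * real r / real (CARD('n) - r) * (t * \<theta> / A)"
          by (simp add: mult_ac)
        moreover have "0 \<le> (\<Sum>i\<in>- Ng. 1 + \<mu> i / A) / real (CARD('n) - r)"
          using fac[OF A] by (intro divide_nonneg_nonneg sum_nonneg) auto
        ultimately have "((\<Sum>i\<in>- Ng. 1 + \<mu> i / A) / real (CARD('n) - r)) ^ (CARD('n) - r) \<le>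
            (1 + \<kappa> * real r / real (CARD('n) - r) * (t * \<theta> / A)) ^ (CARD('n) - r)"
          by (intro power_mono) auto
        then show "(\<Prod>i\<in>- Ng. 1 + \<mu> i / A) \<le> (1 + \<kappa> * real r / real (CARD('n) - r) * (t * \<theta> / A)) ^ (CARD('n) - r)"
          using prod_le_mean_power[of "- Ng" "\<lambda>i. 1 + \<mu> i / A"] fac[OF A] ne by (simp add: cP)
        have "t * \<theta> \<le> A" using mult_right_mono[OF t1, of \<theta>] \<theta> A by linarith
        then show "0 \<le> (1 - t * \<theta> / A) ^ r" using A0 by simp
        show "0 \<le> (\<Prod>i\<in>- Ng. 1 + \<mu> i / A)" using fac[OF A] by (intro prod_nonneg) auto
      qed
      finally show ?thesis by (simp add: poly_pucci_poly P_poly_def)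
    qed
    then show ?thesis using 3 t0 t1 by blast
  qed
qed

text \<open>The constant c is the largest of 0 and the bounds on the gain over the finitely many
  indices r, hence uniform in the eigenvalues, in \<open>\<theta>\<close> and in N. A Jacobian
  bounded by 1 yields N^p - \<open>\<theta>\<close>^p, which is covered because c >= 0.\<close>

theorem weighted_eigenvalue_integral:
  fixes \<kappa> p :: real
  assumes n: "2 \<le> CARD('n::finite)" and k: "1 \<le> \<kappa>" and p: "0 < p" "p < p_lower CARD('n) \<kappa>"
  shows "\<exists>c. 0 \<le> c \<and> c < 1 \<and> (\<forall>(\<mu> :: 'n \<Rightarrow> real) \<theta> N. 0 < \<theta> \<and> \<theta> \<le> N \<and> (\<forall>i. - \<theta> \<le> \<mu> i) \<and>
      (\<Sum>i\<in>UNIV. max 0 (\<mu> i)) \<le> \<kappa> * (\<Sum>i\<in>UNIV. max 0 (- \<mu> i)) \<longrightarrow>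
      (\<integral>\<^sup>+A. ennreal (p * A powr (p - 1) * (\<Prod>i\<in>UNIV. 1 + \<mu> i / A)) * indicator {\<theta>..N} A \<partial>lborel)
        \<le> ennreal (N powr p - (1 - c) * \<theta> powr p))"
proof -
  let ?P = "\<lambda>r. pucci_poly CARD('n) r \<kappa>"
  have p1: "p < 1" using p p_lower_properties(2)[OF n k] by simp
  have "\<exists>c. 0 \<le> c \<and> c < 1 \<and> (\<forall>s. 0 \<le> s \<and> s \<le> 1 \<longrightarrow> gain p (?P r) s \<le> c)" if "r \<in> {1..<CARD('n)}" for r
  proof -
    have r: "1 \<le> r" "r < CARD('n)" using that by auto
    have "gain p (?P r) 1 < 1"
      using p_root_properties(3)[OF r k p(1)] p_lower_properties(3)[OF n k r] p(2) by simp
    then show ?thesis by (rule gain_sup_bound[OF hump_pucci_poly[OF r k] p(1) p1])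
  qed
  then obtain c where c: "\<And>r. r \<in> {1..<CARD('n)} \<Longrightarrow> 0 \<le> c r \<and> c r < 1 \<and> (\<forall>s. 0 \<le> s \<and> s \<le> 1 \<longrightarrow> gain p (?P r) s \<le> c r)"
    using bchoice[of "{1..<CARD('n)}" "\<lambda>r c. 0 \<le> c \<and> c < 1 \<and> (\<forall>s. 0 \<le> s \<and> s \<le> 1 \<longrightarrow> gain p (?P r) s \<le> c)"] by blast
  define C where "C = Max (insert 0 (c ` {1..<CARD('n)}))"
  have C: "0 \<le> C" "C < 1" "\<And>r. r \<in> {1..<CARD('n)} \<Longrightarrow> c r \<le> C"
  proof -
    have fin: "finite (insert 0 (c ` {1..<CARD('n)}))" by simp
    show "0 \<le> C" unfolding C_def by (rule Max_ge[OF fin]) simp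
    show "C < 1" unfolding C_def by (subst Max_less_iff[OF fin]) (use c in auto)
    show "c r \<le> C" if "r \<in> {1..<CARD('n)}" for r
      unfolding C_def by (rule Max_ge[OF fin]) (use that in auto)
  qed
  have "(\<integral>\<^sup>+A. ennreal (p * A powr (p - 1) * (\<Prod>i\<in>UNIV. 1 + \<mu> i / A)) * indicator {\<theta>..N} A \<partial>lborel)
        \<le> ennreal (N powr p - (1 - C) * \<theta> powr p)"
    if \<theta>: "0 < \<theta>" "\<theta> \<le> N" and low: "\<And>i. - \<theta> \<le> \<mu> i"
      and puc: "(\<Sum>i\<in>UNIV. max 0 (\<mu> i)) \<le> \<kappa> * (\<Sum>i\<in>UNIV. max 0 (- \<mu> i))" for \<mu> :: "'n \<Rightarrow> real" and \<theta> N
    using eigenvalue_prod_le[OF \<theta>(1) low k puc]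
  proof
    assume le: "\<forall>A\<ge>\<theta>. (\<Prod>i\<in>UNIV. 1 + \<mu> i / A) \<le> 1"
    have "(\<integral>\<^sup>+A. ennreal (p * A powr (p - 1) * (\<Prod>i\<in>UNIV. 1 + \<mu> i / A)) * indicator {\<theta>..N} A \<partial>lborel)
        \<le> (\<integral>\<^sup>+A. ennreal (p * A powr (p - 1)) * indicator {\<theta>..N} A \<partial>lborel)"
      using le p by (intro nn_integral_mono) (auto simp: indicator_def intro!: ennreal_leI mult_left_le)
    also have "\<dots> = ennreal (N powr p - \<theta> powr p)"
      by (rule nn_integral_FTC_Icc) (use \<theta> p in \<open>auto intro!: has_real_derivative_powr\<close>)
    also have "\<dots> \<le> ennreal (N powr p - (1 - C) * \<theta> powr p)"
      using C(1) by (intro ennreal_leI) (simp add: algebra_simps)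
    finally show ?thesis .
  next
    assume "\<exists>r t. 1 \<le> r \<and> r < CARD('n) \<and> 0 \<le> t \<and> t \<le> 1 \<and>
      (\<forall>A\<ge>\<theta>. (\<Prod>i\<in>UNIV. 1 + \<mu> i / A) \<le> poly (?P r) (t * \<theta> / A))"
    then obtain r t where r: "1 \<le> r" "r < CARD('n)" and t: "0 \<le> t" "t \<le> 1"
      and le: "\<And>A. \<theta> \<le> A \<Longrightarrow> (\<Prod>i\<in>UNIV. 1 + \<mu> i / A) \<le> poly (?P r) (t * \<theta> / A)" by blast
    have "(\<integral>\<^sup>+A. ennreal (p * A powr (p - 1) * (\<Prod>i\<in>UNIV. 1 + \<mu> i / A)) * indicator {\<theta>..N} A \<partial>lborel)
        \<le> (\<integral>\<^sup>+A. ennreal (p * A powr (p - 1) * poly (?P r) (t * \<theta> / A)) * indicator {\<theta>..N} A \<partial>lborel)"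
      using le p by (intro nn_integral_mono) (auto simp: indicator_def intro!: ennreal_leI mult_left_mono)
    also have "\<dots> \<le> ennreal (N powr p - (1 - C) * \<theta> powr p)"
    proof (rule weighted_integral_bound[OF hump_pucci_poly[OF r k] p(1) p1 C(1) _ t \<theta>])
      show "gain p (?P r) s \<le> C" if "0 \<le> s" "s \<le> 1" for s
        using c[of r] C(3)[of r] r that by force
    qed
    finally show ?thesis .
  qed
  then show ?thesis using C by blast
qed

subsection \<open>Envelopes by paraboloids\<close>

text \<open>The absorption in the Lipschitz estimate of \<open>affine_envelope\<close>, with D = |q
  x - q y|^2 and X = |x - y|^2.\<close>

lemma quarter_absorb:
  fixes k D X :: real
  assumes k: "0 < k" and le: "D / (4 * k) \<le> k * (2 * X + 2 * (D / (16 * k\<^sup>2)))"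
  shows "D \<le> 16 * k\<^sup>2 * X"
proof -
  have "k * (2 * X + 2 * (D / (16 * k\<^sup>2))) = 2 * k * X + D / (8 * k)"
    using k by (simp add: field_simps power2_eq_square)
  moreover have "D / (4 * k) = D / (8 * k) + D / (8 * k)" by simp
  ultimately have "D / (8 * k) \<le> 2 * k * X" using le by linarith
  then show ?thesis using k by (simp add: pos_divide_le_eq power2_eq_square mult_ac)
qed

text \<open>G is the convex envelope of w + N/2 |x|^2, realized as the largest affine minorant at
  each point. It inherits an upper bound on second differences, and a convex function with such a
  bound is differentiable with Lipschitz gradient.\<close>

theorem affine_envelope:
  fixes w :: "real^'n \<Rightarrow> real"
  assumes wc: "continuous_on UNIV w" and lower: "\<And>y. m \<le> w y" and N: "0 \<le> N" and K: "0 \<le> K"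
    and semi: "\<And>x h. w (x + h) + w (x - h) \<le> 2 * w x + K * (norm h)\<^sup>2"
  obtains G q L where "\<And>x. (G has_derivative (\<lambda>h. q x \<bullet> h)) (at x)" "L-lipschitz_on UNIV q"
    "\<And>x. G x \<le> w x + N / 2 * (norm x)\<^sup>2"
    "\<And>a c x. (\<And>y. c + a \<bullet> y \<le> w y + N / 2 * (norm y)\<^sup>2) \<Longrightarrow> c + a \<bullet> x \<le> G x"
proof -
  define g where "g = (\<lambda>y. w y + N / 2 * (norm y)\<^sup>2)"
  define minor where "minor = (\<lambda>(c, a). \<forall>y. c + a \<bullet> y \<le> g y)"
  have gc: "continuous_on UNIV g" unfolding g_def by (intro continuous_intros wc)
  have m0: "minor (m, 0)"
    unfolding minor_def g_def using lower N by (auto intro: add_increasing2)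
  \<comment> \<open>Only minorants with value at least m at x compete, the constant m being one of
    them. With B bounding g on the unit ball around x, stepping a unit length along the slope gives
    |a| <= B - m; so the competitors form a compact set.\<close>
  have att: "\<exists>z. minor (fst z, snd z) \<and> (\<forall>c' a'. minor (c', a') \<longrightarrow> c' + a' \<bullet> x \<le> fst z + snd z \<bullet> x)" for x
  proof -
    define T where "T = {(c, a). minor (c, a) \<and> m \<le> c + a \<bullet> x}"
    have mT: "(m, 0) \<in> T" using m0 by (simp add: T_def)
    have "bounded (g ` cball x 1)"
      by (intro compact_imp_bounded compact_continuous_image continuous_on_subset[OF gc]) auto
    then obtain B where "\<forall>v\<in>g ` cball x 1. norm v \<le> B" unfolding bounded_iff by blast
    then have B: "g y \<le> B" if "y \<in> cball x 1" for y using that by (auto simp: abs_le_iff)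
    have Ta: "norm a \<le> B - m" and Tv: "\<bar>c + a \<bullet> x\<bar> \<le> \<bar>m\<bar> + \<bar>B\<bar>" if "(c, a) \<in> T" for c a
    proof -
      have mi: "\<And>y. c + a \<bullet> y \<le> g y" and mx: "m \<le> c + a \<bullet> x" using that by (auto simp: T_def minor_def)
      have gx: "c + a \<bullet> x \<le> B" using mi[of x] B[of x] by simp
      then show "\<bar>c + a \<bullet> x\<bar> \<le> \<bar>m\<bar> + \<bar>B\<bar>" using mx by linarith
      show "norm a \<le> B - m"
      proof (cases "a = 0")
        case False
        define y where "y = x + (1 / norm a) *\<^sub>R a"
        have "y \<in> cball x 1" using False by (simp add: y_def dist_norm)
        moreover have "a \<bullet> y = a \<bullet> x + norm a"
          using False by (simp add: y_def inner_add_right dot_square_norm power2_eq_square)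
        ultimately show ?thesis using mi[of y] B[of y] mx by linarith
      qed (use gx mx in simp)
    qed
    have "bounded T"
      unfolding bounded_iff
    proof (intro exI ballI)
      fix z assume "z \<in> T"
      then obtain c a where z: "z = (c, a)" "(c, a) \<in> T" by (cases z) auto
      have "norm z \<le> \<bar>c\<bar> + norm a" unfolding z using norm_Pair_le[of c a] by simp
      moreover have "\<bar>c\<bar> \<le> \<bar>c + a \<bullet> x\<bar> + \<bar>a \<bullet> x\<bar>" by linarith
      moreover have "\<bar>a \<bullet> x\<bar> \<le> (B - m) * norm x"
        using Cauchy_Schwarz_ineq2[of a x] mult_right_mono[OF Ta[OF z(2)], of "norm x"] by simp
      ultimately show "norm z \<le> \<bar>m\<bar> + \<bar>B\<bar> + (B - m) * norm x + (B - m)"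
        using Ta[OF z(2)] Tv[OF z(2)] by linarith
    qed
    moreover have "closed T"
    proof -
      have "T = (\<Inter>y. {z. fst z + snd z \<bullet> y \<le> g y}) \<inter> {z. m \<le> fst z + snd z \<bullet> x}"
        by (auto simp: T_def minor_def)
      then show ?thesis by (auto intro!: closed_Int closed_INT closed_Collect_le continuous_intros)
    qed
    ultimately have "compact T" by (simp add: compact_eq_bounded_closed)
    moreover have "continuous_on T (\<lambda>z. fst z + snd z \<bullet> x)" by (intro continuous_intros)
    ultimately obtain z where z: "z \<in> T" "\<And>z'. z' \<in> T \<Longrightarrow> fst z' + snd z' \<bullet> x \<le> fst z + snd z \<bullet> x"
      using continuous_attains_sup[of T "\<lambda>z. fst z + snd z \<bullet> x"] mT by blast
    have "c' + a' \<bullet> x \<le> fst z + snd z \<bullet> x" if "minor (c', a')" for c' a'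
      using z(2)[of "(c', a')"] z(2)[OF mT] that by (cases "m \<le> c' + a' \<bullet> x") (auto simp: T_def)
    moreover have "minor (fst z, snd z)" using z(1) by (auto simp: T_def case_prod_beta)
    ultimately show ?thesis by blast
  qed
  define z where "z = (\<lambda>x. SOME z. minor (fst z, snd z) \<and> (\<forall>c' a'. minor (c', a') \<longrightarrow> c' + a' \<bullet> x \<le> fst z + snd z \<bullet> x))"
  define c where "c = (\<lambda>x. fst (z x))"
  define q where "q = (\<lambda>x. snd (z x))"
  have "minor (fst (z x), snd (z x)) \<and> (\<forall>c' a'. minor (c', a') \<longrightarrow> c' + a' \<bullet> x \<le> fst (z x) + snd (z x) \<bullet> x)" for x
    unfolding z_def by (rule someI_ex[OF att])
  then have cq0: "minor (c x, q x) \<and> (\<forall>c' a'. minor (c', a') \<longrightarrow> c' + a' \<bullet> x \<le> c x + q x \<bullet> x)" for x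
    unfolding c_def q_def .
  have cq: "minor (c x, q x)" for x using cq0[of x] by (rule conjunct1)
  have cq2: "c' + a' \<bullet> x \<le> c x + q x \<bullet> x" if "minor (c', a')" for x c' a'
    using cq0[of x] that by simp
  define G where "G = (\<lambda>x. c x + q x \<bullet> x)"
  have Gg: "G x \<le> g x" for x using cq[of x] by (auto simp: G_def minor_def)
  have sub: "G x + q x \<bullet> (y - x) \<le> G y" for x y
    using cq2[OF cq[of x], of y] by (simp add: G_def inner_diff_right)
  define k where "k = K + N"
  have k0: "0 \<le> k" using K N by (simp add: k_def)
  have gsemi: "g (y + h) + g (y - h) \<le> 2 * g y + k * (norm h)\<^sup>2" for y h
  proof -
    have "(norm (y + h))\<^sup>2 + (norm (y - h))\<^sup>2 = 2 * (norm y)\<^sup>2 + 2 * (norm h)\<^sup>2"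
      by (simp add: power2_norm_eq_inner inner_add_left inner_add_right inner_diff_left inner_diff_right inner_commute)
    then have "N / 2 * ((norm (y + h))\<^sup>2 + (norm (y - h))\<^sup>2) = N / 2 * (2 * (norm y)\<^sup>2 + 2 * (norm h)\<^sup>2)"
      by (rule arg_cong)
    then have "N / 2 * (norm (y + h))\<^sup>2 + N / 2 * (norm (y - h))\<^sup>2 = 2 * (N / 2 * (norm y)\<^sup>2) + N * (norm h)\<^sup>2"
      by (simp add: field_simps)
    then show ?thesis using semi[of y h] by (simp add: g_def k_def distrib_right)
  qed
  \<comment> \<open>The average of the affine minorants touching at \<open>x + h\<close> and \<open>x - h\<close>, translated to \<open>x\<close> and
    lowered by \<open>k |h|\<^sup>2 / 2\<close>, is again an affine minorant.\<close>
  have Gsemi: "G (x + h) + G (x - h) \<le> 2 * G x + k * (norm h)\<^sup>2" for x h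
  proof -
    define a where "a = (1/2) *\<^sub>R (q (x + h) + q (x - h))"
    define b where "b = (c (x + h) + c (x - h) + q (x + h) \<bullet> h - q (x - h) \<bullet> h - k * (norm h)\<^sup>2) / 2"
    have "b + a \<bullet> y \<le> g y" for y
    proof -
      have "c (x + h) + q (x + h) \<bullet> (y + h) \<le> g (y + h)" "c (x - h) + q (x - h) \<bullet> (y - h) \<le> g (y - h)"
        using cq[of "x + h"] cq[of "x - h"] by (auto simp: minor_def)
      then show ?thesis using gsemi[of y h]
        by (simp add: a_def b_def inner_add_left inner_add_right inner_diff_right field_simps)
    qed
    then have "b + a \<bullet> x \<le> G x" using cq2[of b a x] by (simp add: minor_def G_def)
    then show ?thesis
      by (simp add: a_def b_def G_def inner_add_left inner_add_right inner_diff_right field_simps)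
  qed
  \<comment> \<open>The subgradient inequality at the reflected point 2x - y turns the
    second-difference bound into a one-sided one.\<close>
  have up: "G y \<le> G x + q x \<bullet> (y - x) + k * (norm (y - x))\<^sup>2" for x y
    using Gsemi[of x "y - x"] sub[of x "x - (y - x)"] by (simp add: inner_diff_right algebra_simps)
  show thesis
  proof (rule that)
    show "(G has_derivative (\<lambda>h. q x \<bullet> h)) (at x)" for x
      unfolding has_derivative_at_alt
    proof (intro conjI allI impI)
      show "bounded_linear (\<lambda>h. q x \<bullet> h)" by (rule bounded_linear_inner_right)
      fix e :: real assume e: "0 < e"
      show "\<exists>d>0. \<forall>y. norm (y - x) < d \<longrightarrow> norm (G y - G x - q x \<bullet> (y - x)) \<le> e * norm (y - x)"
      proof (intro exI[of _ "e / (k + 1)"] conjI allI impI)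
        fix y assume y: "norm (y - x) < e / (k + 1)"
        have "norm (G y - G x - q x \<bullet> (y - x)) \<le> k * (norm (y - x))\<^sup>2"
          using up[of y x] sub[of x y] by (simp add: abs_le_iff)
        also have "\<dots> = (k * norm (y - x)) * norm (y - x)" by (simp add: power2_eq_square)
        also have "\<dots> \<le> e * norm (y - x)"
        proof (rule mult_right_mono)
          have "k * norm (y - x) \<le> (k + 1) * norm (y - x)" by (intro mult_right_mono) auto
          also have "\<dots> \<le> e" using y k0 by (simp add: pos_less_divide_eq mult.commute)
          finally show "k * norm (y - x) \<le> e" .
        qed simp
        finally show "norm (G y - G x - q x \<bullet> (y - x)) \<le> e * norm (y - x)" .
      qed (use e k0 in simp)
    qed
    show "(4 * (k + 1))-lipschitz_on UNIV q"
    proof (rule lipschitz_onI)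
      fix x y
      define d where "d = q x - q y"
      define k1 where "k1 = k + 1"
      have k1: "0 < k1" using k0 by (simp add: k1_def)
      \<comment> \<open>At this point the upper parabola from y is compared with the tangent at x.
        With the factor 1/(4 k1) the quadratic term in d on the right is half of the left side and
        can be absorbed.\<close>
      define z where "z = x + (1 / (4 * k1)) *\<^sub>R d"
      have "d \<bullet> (z - x) \<le> k * (norm (z - y))\<^sup>2"
        using sub[of x z] up[of z y] sub[of y x] by (simp add: d_def inner_diff_left inner_diff_right)
      also have "\<dots> \<le> k1 * (norm (z - y))\<^sup>2" by (intro mult_right_mono) (auto simp: k1_def)
      also have "(norm (z - y))\<^sup>2 \<le> 2 * (norm (x - y))\<^sup>2 + 2 * (norm ((1 / (4 * k1)) *\<^sub>R d))\<^sup>2"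
      proof -
        have "norm (z - y) \<le> norm (x - y) + norm ((1 / (4 * k1)) *\<^sub>R d)"
          using norm_triangle_ineq[of "x - y" "(1 / (4 * k1)) *\<^sub>R d"] by (simp add: z_def algebra_simps)
        then have "(norm (z - y))\<^sup>2 \<le> (norm (x - y) + norm ((1 / (4 * k1)) *\<^sub>R d))\<^sup>2"
          by (rule power_mono) simp
        also have "\<dots> \<le> 2 * (norm (x - y))\<^sup>2 + 2 * (norm ((1 / (4 * k1)) *\<^sub>R d))\<^sup>2"
          using sum_squares_bound[of "norm (x - y)" "norm ((1 / (4 * k1)) *\<^sub>R d)"] by (simp add: power2_sum)
        finally show ?thesis .
      qed
      finally have "d \<bullet> (z - x) \<le> k1 * (2 * (norm (x - y))\<^sup>2 + 2 * (norm ((1 / (4 * k1)) *\<^sub>R d))\<^sup>2)"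
        using k1 by (simp add: mult_left_mono)
      moreover have "d \<bullet> (z - x) = (norm d)\<^sup>2 / (4 * k1)" by (simp add: z_def power2_norm_eq_inner)
      moreover have "(norm ((1 / (4 * k1)) *\<^sub>R d))\<^sup>2 = (norm d)\<^sup>2 / (16 * k1\<^sup>2)"
        using k1 by (simp add: power_divide power_mult_distrib)
      ultimately have "(norm d)\<^sup>2 / (4 * k1) \<le> k1 * (2 * (norm (x - y))\<^sup>2 + 2 * ((norm d)\<^sup>2 / (16 * k1\<^sup>2)))"
        by simp
      from quarter_absorb[OF k1 this] have "(norm d)\<^sup>2 \<le> (4 * k1 * norm (x - y))\<^sup>2"
        by (simp add: power_mult_distrib)
      then have "norm d \<le> 4 * k1 * norm (x - y)" by (rule power2_le_imp_le) (use k1 in simp)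
      then show "dist (q x) (q y) \<le> 4 * (k + 1) * dist x y" by (simp add: d_def k1_def dist_norm)
    qed (use k0 in simp)
    show "G x \<le> w x + N / 2 * (norm x)\<^sup>2" for x using Gg[of x] by (simp add: g_def)
    show "c + a \<bullet> x \<le> G x" if "\<And>y. c + a \<bullet> y \<le> w y + N / 2 * (norm y)\<^sup>2" for a c x
      using cq2[of c a x] that by (simp add: minor_def g_def G_def)
  qed
qed

text \<open>In contrast to \<open>paraboloid\<close>, the gradient p at the contact point is
  explicit, because the contact map x + p/A is built from it. The comparison extends over the whole
  space, on which the inf-convolution lives.\<close>

definition touches :: "(real^'n \<Rightarrow> real) \<Rightarrow> real \<Rightarrow> real^'n \<Rightarrow> real^'n \<Rightarrow> bool" where
  "touches w A x p \<longleftrightarrow> (\<forall>y. w x + p \<bullet> (y - x) - A / 2 * (norm (y - x))\<^sup>2 \<le> w y)"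

text \<open>Adding N/2 |y|^2 turns a touching paraboloid with A <= N into a convex function below w
  + N/2 |y|^2. It is the supremum of its tangents, each an affine minorant, and so lies below the
  convex envelope; hence envelope and w agree at the contact point, to first order as well.\<close>

theorem paraboloid_envelope:
  fixes w :: "real^'n \<Rightarrow> real"
  assumes wc: "continuous_on UNIV w" and lower: "\<And>y. m \<le> w y" and N: "0 \<le> N" and K: "0 \<le> K"
    and semi: "\<And>x h. w (x + h) + w (x - h) \<le> 2 * w x + K * (norm h)\<^sup>2"
  obtains \<gamma> s L where "\<And>x. (\<gamma> has_derivative (\<lambda>h. s x \<bullet> h)) (at x)" "L-lipschitz_on UNIV s"
    "\<And>x. \<gamma> x \<le> w x"
    "\<And>A x p. A \<le> N \<Longrightarrow> touches w A x p \<Longrightarrow> \<gamma> x = w x \<and> s x = p \<and> touches \<gamma> A x p"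
proof -
  obtain G q L where G: "\<And>x. (G has_derivative (\<lambda>h. q x \<bullet> h)) (at x)" "L-lipschitz_on UNIV q"
    "\<And>x. G x \<le> w x + N / 2 * (norm x)\<^sup>2"
    "\<And>a c x. (\<And>y. c + a \<bullet> y \<le> w y + N / 2 * (norm y)\<^sup>2) \<Longrightarrow> c + a \<bullet> x \<le> G x"
    using affine_envelope[OF assms] by blast
  define \<gamma> where "\<gamma> = (\<lambda>x. G x - N / 2 * (norm x)\<^sup>2)"
  define s where "s = (\<lambda>x. q x - N *\<^sub>R x)"
  have D: "(\<gamma> has_derivative (\<lambda>h. s x \<bullet> h)) (at x)" for x
  proof -
    have "((\<lambda>x. G x - N / 2 * (x \<bullet> x)) has_derivative (\<lambda>h. q x \<bullet> h - N / 2 * (x \<bullet> h + h \<bullet> x))) (at x)"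
      by (intro derivative_intros G(1))
    then show ?thesis
      by (simp add: \<gamma>_def s_def power2_norm_eq_inner inner_diff_left inner_diff_right inner_commute)
  qed
  have le: "\<gamma> x \<le> w x" for x using G(3)[of x] by (simp add: \<gamma>_def)
  show thesis
  proof (rule that[OF D _ le])
    show "(L + N)-lipschitz_on UNIV s"
    proof (rule lipschitz_onI)
      fix x y
      have "s x - s y = (q x - q y) - N *\<^sub>R (x - y)" by (simp add: s_def algebra_simps)
      then have "norm (s x - s y) \<le> norm (q x - q y) + N * norm (x - y)"
        using norm_triangle_ineq4[of "q x - q y" "N *\<^sub>R (x - y)"] N by (simp only: norm_scaleR abs_of_nonneg)
      then show "dist (s x) (s y) \<le> (L + N) * dist x y"
        using lipschitz_onD[OF G(2), of x y] N by (simp add: dist_norm algebra_simps)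
    qed (use lipschitz_on_nonneg[OF G(2)] N in simp)
    fix A x p assume A: "A \<le> N" and t: "touches w A x p"
    have low: "w x + p \<bullet> (y - x) - A / 2 * (norm (y - x))\<^sup>2 \<le> \<gamma> y" for y
    proof -
      define Q where "Q = (\<lambda>z. w x + p \<bullet> (z - x) - A / 2 * (norm (z - x))\<^sup>2 + N / 2 * (norm z)\<^sup>2)"
      \<comment> \<open>The gradient of Q at y. The remainder (N - A)/2 |z - y|^2 is nonnegative, so
        the tangent at y is an affine minorant.\<close>
      define a where "a = p - A *\<^sub>R (y - x) + N *\<^sub>R y"
      have exp: "Q z = Q y + a \<bullet> (z - y) + (N - A) / 2 * (norm (z - y))\<^sup>2" for z
        unfolding Q_def a_def power2_norm_eq_inner
        by (simp add: inner_diff_left inner_diff_right inner_add_left inner_add_right inner_commute field_simps)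
      have "(Q y - a \<bullet> y) + a \<bullet> z \<le> w z + N / 2 * (norm z)\<^sup>2" for z
      proof -
        have "0 \<le> (N - A) / 2 * (norm (z - y))\<^sup>2" using A by simp
        then have "(Q y - a \<bullet> y) + a \<bullet> z \<le> Q z" using exp[of z] by (simp add: inner_diff_right)
        also have "\<dots> \<le> w z + N / 2 * (norm z)\<^sup>2" using t by (simp add: Q_def touches_def)
        finally show ?thesis .
      qed
      from G(4)[OF this, of y] show ?thesis by (simp add: Q_def \<gamma>_def)
    qed
    have eq: "\<gamma> x = w x" using low[of x] le[of x] by simp
    have "((\<lambda>y. \<gamma> y - (w x + p \<bullet> (y - x) - A / 2 * ((y - x) \<bullet> (y - x)))) has_derivative
       (\<lambda>h. s x \<bullet> h - (0 + p \<bullet> (h - 0) - A / 2 * ((x - x) \<bullet> (h - 0) + (h - 0) \<bullet> (x - x))))) (at x)"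
      by (intro derivative_intros D)
    then have d: "((\<lambda>y. \<gamma> y - (w x + p \<bullet> (y - x) - A / 2 * (norm (y - x))\<^sup>2)) has_derivative (\<lambda>h. (s x - p) \<bullet> h)) (at x)"
      by (simp add: power2_norm_eq_inner inner_diff_left)
    have "(\<lambda>h. (s x - p) \<bullet> h) = (\<lambda>h. 0)"
      by (rule differential_zero_maxmin[OF _ open_UNIV d]) (use low eq in auto)
    then have "(s x - p) \<bullet> (s x - p) = 0" by metis
    then have "s x = p" by simp
    then show "\<gamma> x = w x \<and> s x = p \<and> touches \<gamma> A x p"
      using eq low by (simp add: touches_def)
  qed
qed

text \<open>The viscosity condition tested with quadratic polynomials only; these can be translated
  and rescaled freely, as inf-convolution and normalization require.\<close>

definition quad_supersolution :: "real \<Rightarrow> real \<Rightarrow> (real^'n) set \<Rightarrow> (real^'n \<Rightarrow> real) \<Rightarrow> bool" where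
  "quad_supersolution lam Lam U w \<longleftrightarrow> (\<forall>x\<in>U. \<forall>p H. transpose H = H \<longrightarrow>
     (\<forall>\<^sub>F y in at x. w x + p \<bullet> (y - x) + (y - x) \<bullet> (H *v (y - x)) / 2 \<le> w y) \<longrightarrow> pucci_minus lam Lam H \<le> 0)"

text \<open>The paraboloid below the envelope bounds the eigenvalues of M from below. Since the
  envelope lies below w with equality at x, its second-order expansion, lowered by
  \<open>\<delta>\<close>/2 |h|^2, is a quadratic test function for w; then \<open>\<delta>\<close>
  tends to 0.\<close>

lemma envelope_hessian:
  fixes w \<gamma> :: "real^'n \<Rightarrow> real"
  assumes D: "\<And>x. (\<gamma> has_derivative (\<lambda>h. s x \<bullet> h)) (at x)" and le: "\<And>x. \<gamma> x \<le> w x"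
    and eq: "\<gamma> x = w x" and t: "touches \<gamma> A x (s x)"
    and M: "(s has_derivative (\<lambda>h. M *v h)) (at x)"
    and sup: "quad_supersolution lam Lam U w" "x \<in> U" "0 < lam"
  shows "\<exists>v \<mu>. eigen_family M v \<mu> \<and> (\<forall>i. - A \<le> \<mu> i) \<and>
     (\<Sum>i\<in>UNIV. max 0 (\<mu> i)) \<le> (Lam / lam) * (\<Sum>i\<in>UNIV. max 0 (- \<mu> i))"
proof -
  have sym: "transpose M = M" by (rule hessian_symmetric[OF D M])
  obtain v \<mu> where ev: "eigen_family M v \<mu>" using symmetric_matrix_eigen_family[OF sym] by blast
  have "- A \<le> \<mu> i" for i
  proof -
    have vi: "norm (v i) = 1" "v i \<bullet> (M *v v i) = \<mu> i"
      using ev by (auto simp: eigen_family_def orthonormal_family_def norm_eq_1)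
    have "- A \<le> \<mu> i + \<epsilon>" if "0 < \<epsilon>" for \<epsilon>
    proof -
      obtain d where d: "0 < d" "\<And>h. norm h < d \<Longrightarrow> \<bar>\<gamma> (x + h) - \<gamma> x - s x \<bullet> h - (h \<bullet> (M *v h)) / 2\<bar> \<le> \<epsilon>/2 * (norm h)\<^sup>2"
        using second_order_taylor[OF D M half_gt_zero[OF \<open>0 < \<epsilon>\<close>]] by blast
      define r where "r = d / 2"
      have r: "0 < r" "r < d" using d(1) by (auto simp: r_def)
      have q: "(r *\<^sub>R v i) \<bullet> (M *v (r *\<^sub>R v i)) = r\<^sup>2 * \<mu> i"
        using vi(2) by (simp add: matrix_vector_mult_scaleR power2_eq_square)
      have nr: "norm (r *\<^sub>R v i) = r" using vi(1) r by simp
      have "\<bar>\<gamma> (x + r *\<^sub>R v i) - \<gamma> x - s x \<bullet> (r *\<^sub>R v i) - (r *\<^sub>R v i) \<bullet> (M *v (r *\<^sub>R v i)) / 2\<bar> \<le> \<epsilon>/2 * (norm (r *\<^sub>R v i))\<^sup>2"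
        by (rule d(2)) (use nr r in simp)
      from abs_le_D1[OF this, unfolded q nr]
      have "\<gamma> (x + r *\<^sub>R v i) - \<gamma> x - s x \<bullet> (r *\<^sub>R v i) - r\<^sup>2 * \<mu> i / 2 \<le> \<epsilon>/2 * r\<^sup>2" .
      moreover have "\<gamma> x + s x \<bullet> (r *\<^sub>R v i) - A / 2 * r\<^sup>2 \<le> \<gamma> (x + r *\<^sub>R v i)"
        using t[unfolded touches_def, rule_format, of "x + r *\<^sub>R v i"] nr by simp
      ultimately have "r\<^sup>2 * (- A) \<le> r\<^sup>2 * (\<mu> i + \<epsilon>)" by (simp add: algebra_simps)
      moreover have "0 < r\<^sup>2" using r by simp
      ultimately show ?thesis by (simp only: mult_le_cancel_left_pos)
    qed
    then show ?thesis by (rule field_le_epsilon)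
  qed
  moreover have "pucci_minus lam Lam (M - \<delta> *\<^sub>R mat 1) \<le> 0" if "0 < \<delta>" for \<delta>
  proof -
    have sym': "transpose (M - \<delta> *\<^sub>R mat 1) = M - \<delta> *\<^sub>R mat 1"
      using sym by (simp add: transpose_def vec_eq_iff mat_def)
    obtain d where d: "0 < d" "\<And>h. norm h < d \<Longrightarrow> \<bar>\<gamma> (x + h) - \<gamma> x - s x \<bullet> h - (h \<bullet> (M *v h)) / 2\<bar> \<le> \<delta>/2 * (norm h)\<^sup>2"
      using second_order_taylor[OF D M half_gt_zero[OF \<open>0 < \<delta>\<close>]] by blast
    have "\<forall>\<^sub>F y in at x. w x + s x \<bullet> (y - x) + (y - x) \<bullet> ((M - \<delta> *\<^sub>R mat 1) *v (y - x)) / 2 \<le> w y"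
      unfolding eventually_at
    proof (intro exI[of _ d] conjI ballI impI d(1))
      fix y assume "y \<noteq> x \<and> dist y x < d"
      then have n: "norm (y - x) < d" by (simp add: dist_norm)
      have "(y - x) \<bullet> ((M - \<delta> *\<^sub>R mat 1) *v (y - x)) = (y - x) \<bullet> (M *v (y - x)) - \<delta> * (norm (y - x))\<^sup>2"
        by (simp add: matrix_vector_mult_diff_rdistrib scaleR_matrix_vector_assoc[symmetric] inner_diff_right power2_norm_eq_inner)
      moreover have "x + (y - x) = y" by simp
      ultimately show "w x + s x \<bullet> (y - x) + (y - x) \<bullet> ((M - \<delta> *\<^sub>R mat 1) *v (y - x)) / 2 \<le> w y"
        using abs_le_D2[OF d(2)[OF n]] le[of y] eq by (simp add: diff_divide_distrib)
    qed
    then show ?thesis using sup sym' unfolding quad_supersolution_def by blast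
  qed
  then have "(\<Sum>i\<in>UNIV. max 0 (\<mu> i)) \<le> (Lam / lam) * (\<Sum>i\<in>UNIV. max 0 (- \<mu> i))"
    by (rule pucci_minus_le_zero_limit[OF ev sup(3)])
  ultimately show ?thesis using ev by blast
qed

subsection \<open>Inf-convolutions of supersolutions\<close>

lemma quad_C2:
  fixes H :: "real^'n^'n"
  assumes "transpose H = H"
  shows "C2_with_hessian (\<lambda>y. a + p \<bullet> (y - x) + (y - x) \<bullet> (H *v (y - x)) / 2) (\<lambda>y. p + H *v (y - x)) (\<lambda>_. H) \<Omega>"
  unfolding C2_with_hessian_def
proof (intro conjI ballI)
  have bl: "bounded_linear ((*v) H)" by (rule matrix_vector_mul_bounded_linear)
  have dl: "((\<lambda>y. H *v (y - x)) has_derivative (\<lambda>h. H *v h)) (at y)" for y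
  proof -
    have "((\<lambda>y. y - x) has_derivative (\<lambda>h. h)) (at y)" by (auto intro!: derivative_eq_intros)
    from bounded_linear.has_derivative[OF bl this] show ?thesis .
  qed
  have sym: "h \<bullet> (H *v z) = (H *v h) \<bullet> z" for h z
    by (metis assms dot_lmul_matrix transpose_matrix_vector)
  fix y
  have "((\<lambda>y. (y - x) \<bullet> (H *v (y - x))) has_derivative (\<lambda>h. (y - x) \<bullet> (H *v h) + (h - 0) \<bullet> (H *v (y - x)))) (at y)"
    by (intro derivative_intros dl has_derivative_inner)
  from bounded_linear.has_derivative[OF bounded_linear_divide[of 2] this]
  have "((\<lambda>y. a + p \<bullet> (y - x) + (y - x) \<bullet> (H *v (y - x)) / 2) has_derivative
     (\<lambda>h. 0 + p \<bullet> (h - 0) + ((y - x) \<bullet> (H *v h) + (h - 0) \<bullet> (H *v (y - x))) / 2)) (at y)"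
    by (intro derivative_intros)
  moreover have "(y - x) \<bullet> (H *v h) = (H *v (y - x)) \<bullet> h" "h \<bullet> (H *v (y - x)) = (H *v (y - x)) \<bullet> h" for h
    by (rule sym, rule inner_commute)
  ultimately show "((\<lambda>y. a + p \<bullet> (y - x) + (y - x) \<bullet> (H *v (y - x)) / 2) has_derivative (\<lambda>h. (p + H *v (y - x)) \<bullet> h)) (at y)"
    by (simp add: inner_add_left)
  show "((\<lambda>y. p + H *v (y - x)) has_derivative (*v) H) (at y)"
    using has_derivative_add[OF has_derivative_const[of p] dl] by simp
qed simp

lemma quad_supersolution_of_viscosity:
  fixes u :: "real^'n \<Rightarrow> real"
  assumes "pucci_supersolution lam Lam \<Omega> u" "open \<Omega>"
  shows "quad_supersolution lam Lam \<Omega> u"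
  unfolding quad_supersolution_def
proof (intro ballI allI impI)
  fix x p and H :: "real^'n^'n"
  assume x: "x \<in> \<Omega>" and H: "transpose H = H"
    and ev: "\<forall>\<^sub>F y in at x. u x + p \<bullet> (y - x) + (y - x) \<bullet> (H *v (y - x)) / 2 \<le> u y"
  let ?\<phi> = "\<lambda>y. u x + p \<bullet> (y - x) + (y - x) \<bullet> (H *v (y - x)) / 2"
  have "\<forall>\<^sub>F y in at x within \<Omega>. u x - ?\<phi> x \<le> u y - ?\<phi> y"
    unfolding at_within_open[OF x assms(2)] using ev by eventually_elim simp
  then show "pucci_minus lam Lam H \<le> 0"
    using assms(1) quad_C2[OF H, of "u x" p x \<Omega>] x unfolding pucci_supersolution_def by blast
qed

lemma quad_supersolution_scale:
  fixes u :: "real^'n \<Rightarrow> real"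
  assumes sup: "quad_supersolution lam Lam \<Omega> u" and c: "0 < c"
  shows "quad_supersolution lam Lam \<Omega> (\<lambda>x. c * u x)"
  unfolding quad_supersolution_def
proof (intro ballI allI impI)
  fix x p and H :: "real^'n^'n"
  assume x: "x \<in> \<Omega>" and H: "transpose H = H"
    and ev: "\<forall>\<^sub>F y in at x. c * u x + p \<bullet> (y - x) + (y - x) \<bullet> (H *v (y - x)) / 2 \<le> c * u y"
  have "\<forall>\<^sub>F y in at x. u x + ((1/c) *\<^sub>R p) \<bullet> (y - x) + (y - x) \<bullet> (((1/c) *\<^sub>R H) *v (y - x)) / 2 \<le> u y"
    using ev
  proof eventually_elim
    case (elim y)
    then have "(c * u x + p \<bullet> (y - x) + (y - x) \<bullet> (H *v (y - x)) / 2) / c \<le> u y"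
      using c by (simp add: divide_le_eq mult.commute)
    then show ?case using c
      by (simp add: add_divide_distrib scaleR_matrix_vector_assoc[symmetric])
  qed
  moreover have "transpose ((1/c) *\<^sub>R H) = (1/c) *\<^sub>R H"
    using H by (simp add: transpose_def vec_eq_iff)
  ultimately have "pucci_minus lam Lam ((1/c) *\<^sub>R H) \<le> 0"
    using sup x unfolding quad_supersolution_def by blast
  then show "pucci_minus lam Lam H \<le> 0"
    using pucci_minus_scaleR[OF H, of "1/c" lam Lam] c by (simp add: divide_le_0_iff)
qed

text \<open>The minimizer is sought in the closed unit ball, where u is controlled, but x ranges
  over the whole space: the result is globally defined, continuous and semiconcave.\<close>

definition inf_conv :: "real \<Rightarrow> (real^'n \<Rightarrow> real) \<Rightarrow> real^'n \<Rightarrow> real" where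
  "inf_conv \<epsilon> u x = (INF z\<in>cball 0 1. u z + (norm (x - z))\<^sup>2 / (2 * \<epsilon>))"

lemma inf_conv_attained:
  fixes u :: "real^'n \<Rightarrow> real"
  assumes uc: "continuous_on (cball 0 1) u" and e: "0 < \<epsilon>"
  shows "\<exists>z\<in>cball 0 1. inf_conv \<epsilon> u x = u z + (norm (x - z))\<^sup>2 / (2 * \<epsilon>)"
    and "y \<in> cball 0 1 \<Longrightarrow> inf_conv \<epsilon> u x \<le> u y + (norm (x - y))\<^sup>2 / (2 * \<epsilon>)"
proof -
  let ?f = "\<lambda>z. u z + (norm (x - z))\<^sup>2 / (2 * \<epsilon>)"
  have "continuous_on (cball 0 1) ?f" using e by (intro continuous_intros uc) auto
  then obtain z where z: "z \<in> cball 0 1" "\<And>y. y \<in> cball 0 1 \<Longrightarrow> ?f z \<le> ?f y"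
    using continuous_attains_inf[of "cball 0 1 :: (real^'n) set" ?f] by auto
  have "inf_conv \<epsilon> u x = ?f z"
    unfolding inf_conv_def by (rule cInf_eq_minimum) (use z in auto)
  then show "\<exists>z\<in>cball 0 1. inf_conv \<epsilon> u x = ?f z" "y \<in> cball 0 1 \<Longrightarrow> inf_conv \<epsilon> u x \<le> ?f y"
    using z by auto
qed

text \<open>The minimizer for y is a competitor for x; since it lies in the unit ball, the
  difference of the two penalties is bounded by |x - y| times a factor growing linearly in |x| and
  |y|.\<close>

lemma inf_conv_continuous:
  fixes u :: "real^'n \<Rightarrow> real"
  assumes uc: "continuous_on (cball 0 1) u" and e: "0 < \<epsilon>"
  shows "continuous_on UNIV (inf_conv \<epsilon> u)"
proof -
  let ?w = "inf_conv \<epsilon> u"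
  have le: "?w x \<le> ?w y + norm (x - y) * (norm x + norm y + 2) / (2 * \<epsilon>)" for x y
  proof -
    obtain z where z: "z \<in> cball 0 1" "?w y = u z + (norm (y - z))\<^sup>2 / (2 * \<epsilon>)"
      using inf_conv_attained(1)[OF uc e] by blast
    have "(norm (x - z))\<^sup>2 - (norm (y - z))\<^sup>2 = (norm (x - z) - norm (y - z)) * (norm (x - z) + norm (y - z))"
      by (simp add: power2_eq_square algebra_simps)
    also have "\<dots> \<le> norm (x - y) * (norm x + norm y + 2)"
    proof (rule mult_mono)
      show "norm (x - z) - norm (y - z) \<le> norm (x - y)" using norm_triangle_ineq2[of "x - z" "y - z"] by simp
      show "norm (x - z) + norm (y - z) \<le> norm x + norm y + 2"
        using norm_triangle_ineq4[of x z] norm_triangle_ineq4[of y z] z(1) by simp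
    qed auto
    finally have "(norm (x - z))\<^sup>2 / (2 * \<epsilon>) \<le> (norm (y - z))\<^sup>2 / (2 * \<epsilon>) + norm (x - y) * (norm x + norm y + 2) / (2 * \<epsilon>)"
      unfolding add_divide_distrib[symmetric] using e by (intro divide_right_mono) auto
    then show ?thesis using inf_conv_attained(2)[OF uc e z(1), of x] z(2) by simp
  qed
  show ?thesis
    unfolding continuous_on_eq_continuous_at[OF open_UNIV] isCont_def
  proof
    fix x :: "real^'n"
    have "((\<lambda>y. norm (y - x) * (norm y + norm x + 2) / (2 * \<epsilon>)) \<longlongrightarrow> norm (x - x) * (norm x + norm x + 2) / (2 * \<epsilon>)) (at x)"
      using e by (intro tendsto_intros) auto
    then have lim: "((\<lambda>y. norm (y - x) * (norm y + norm x + 2) / (2 * \<epsilon>)) \<longlongrightarrow> 0) (at x)" by simp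
    have bd: "norm (?w y - ?w x) \<le> norm (y - x) * (norm y + norm x + 2) / (2 * \<epsilon>)" for y
    proof -
      have "norm (x - y) * (norm x + norm y + 2) = norm (y - x) * (norm y + norm x + 2)"
        by (simp only: norm_minus_commute[of x y] add.commute[of "norm x"])
      then show ?thesis using le[of x y] le[of y x] unfolding real_norm_def abs_le_iff by simp
    qed
    have "((\<lambda>y. ?w y - ?w x) \<longlongrightarrow> 0) (at x)"
      by (rule Lim_null_comparison[OF _ lim]) (rule always_eventually, use bd in blast)
    then show "(?w \<longlongrightarrow> ?w x) (at x)" by (rule LIM_zero_cancel)
  qed
qed

text \<open>The minimizer for x competes at x + h and at x - h, and the parallelogram identity
  computes the excess.\<close>

lemma inf_conv_semiconcave:
  fixes u :: "real^'n \<Rightarrow> real"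
  assumes uc: "continuous_on (cball 0 1) u" and e: "0 < \<epsilon>"
  shows "inf_conv \<epsilon> u (x + h) + inf_conv \<epsilon> u (x - h) \<le> 2 * inf_conv \<epsilon> u x + (1 / \<epsilon>) * (norm h)\<^sup>2"
proof -
  obtain z where z: "z \<in> cball 0 1" "inf_conv \<epsilon> u x = u z + (norm (x - z))\<^sup>2 / (2 * \<epsilon>)"
    using inf_conv_attained(1)[OF uc e] by blast
  have "(norm (x + h - z))\<^sup>2 + (norm (x - h - z))\<^sup>2 = 2 * (norm (x - z))\<^sup>2 + 2 * (norm h)\<^sup>2"
    by (simp add: power2_norm_eq_inner inner_add_left inner_add_right inner_diff_left inner_diff_right inner_commute)
  then have "(norm (x + h - z))\<^sup>2 / (2 * \<epsilon>) + (norm (x - h - z))\<^sup>2 / (2 * \<epsilon>) = 2 * ((norm (x - z))\<^sup>2 / (2 * \<epsilon>)) + (1 / \<epsilon>) * (norm h)\<^sup>2"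
    using e by (simp add: field_simps)
  then show ?thesis
    using inf_conv_attained(2)[OF uc e z(1), of "x + h"] inf_conv_attained(2)[OF uc e z(1), of "x - h"] z(2) by simp
qed

lemma inf_conv_bounds:
  fixes u :: "real^'n \<Rightarrow> real"
  assumes uc: "continuous_on (cball 0 1) u" and e: "0 < \<epsilon>" and b: "\<And>z. z \<in> cball 0 1 \<Longrightarrow> \<bar>u z\<bar> \<le> 1"
  shows "-1 \<le> inf_conv \<epsilon> u x" "x \<in> cball 0 1 \<Longrightarrow> inf_conv \<epsilon> u x \<le> u x" "x \<in> cball 0 1 \<Longrightarrow> inf_conv \<epsilon> u x \<le> 1"
    and "x \<in> cball 0 1 \<Longrightarrow> \<exists>z\<in>cball 0 1. inf_conv \<epsilon> u x = u z + (norm (x - z))\<^sup>2 / (2 * \<epsilon>) \<and> norm (x - z) \<le> 2 * sqrt \<epsilon>"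
proof -
  obtain z where z: "z \<in> cball 0 1" "inf_conv \<epsilon> u x = u z + (norm (x - z))\<^sup>2 / (2 * \<epsilon>)"
    using inf_conv_attained(1)[OF uc e] by blast
  have "0 \<le> (norm (x - z))\<^sup>2 / (2 * \<epsilon>)" using e by simp
  then show "-1 \<le> inf_conv \<epsilon> u x" using z b[OF z(1)] by (simp add: abs_le_iff)
  show le: "x \<in> cball 0 1 \<Longrightarrow> inf_conv \<epsilon> u x \<le> u x" using inf_conv_attained(2)[OF uc e, of x x] by simp
  show le1: "x \<in> cball 0 1 \<Longrightarrow> inf_conv \<epsilon> u x \<le> 1" using le b[of x] by (simp add: abs_le_iff)
  assume "x \<in> cball 0 1"
  \<comment> \<open>The penalty is at most the oscillation of u, which is 2.\<close>
  then have "(norm (x - z))\<^sup>2 / (2 * \<epsilon>) \<le> 2" using le1 z b[OF z(1)] by (simp add: abs_le_iff)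
  then have "(norm (x - z))\<^sup>2 \<le> (2 * sqrt \<epsilon>)\<^sup>2" using e by (simp add: divide_le_eq power_mult_distrib)
  then have "norm (x - z) \<le> 2 * sqrt \<epsilon>" by (rule power2_le_imp_le) (use e in simp)
  then show "\<exists>z\<in>cball 0 1. inf_conv \<epsilon> u x = u z + (norm (x - z))\<^sup>2 / (2 * \<epsilon>) \<and> norm (x - z) \<le> 2 * sqrt \<epsilon>"
    using z by blast
qed

text \<open>A quadratic touching the inf-convolution from below at x, translated by z - x, touches u
  from below at the minimizer z with the same Hessian. The distance from x to z is at most 1/8, so z
  stays in the open unit ball.\<close>

lemma inf_conv_supersolution:
  fixes u :: "real^'n \<Rightarrow> real"
  assumes uc: "continuous_on (cball 0 1) u" and e: "0 < \<epsilon>" "2 * sqrt \<epsilon> \<le> 1/8" and b: "\<And>z. z \<in> cball 0 1 \<Longrightarrow> \<bar>u z\<bar> \<le> 1"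
    and sup: "quad_supersolution lam Lam (ball 0 1) u"
  shows "quad_supersolution lam Lam (ball 0 (7/8)) (inf_conv \<epsilon> u)"
  unfolding quad_supersolution_def
proof (intro ballI allI impI)
  let ?w = "inf_conv \<epsilon> u"
  fix x p and H :: "real^'n^'n"
  assume x: "x \<in> ball 0 (7/8)" and H: "transpose H = H"
    and ev: "\<forall>\<^sub>F y in at x. ?w x + p \<bullet> (y - x) + (y - x) \<bullet> (H *v (y - x)) / 2 \<le> ?w y"
  obtain z where z: "?w x = u z + (norm (x - z))\<^sup>2 / (2 * \<epsilon>)" "norm (x - z) \<le> 2 * sqrt \<epsilon>"
    using inf_conv_bounds(4)[OF uc e(1) b, of x] x by auto
  have zb: "z \<in> ball 0 1"
    using z(2) e(2) x norm_triangle_ineq4[of x "x - z"] by simp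
  obtain d where d: "0 < d" "\<And>y. y \<noteq> x \<Longrightarrow> dist y x < d \<Longrightarrow> ?w x + p \<bullet> (y - x) + (y - x) \<bullet> (H *v (y - x)) / 2 \<le> ?w y"
    using ev unfolding eventually_at by auto
  have "\<forall>\<^sub>F y in at z. y \<in> ball 0 1" using zb open_ball by (intro eventually_at_in_open') auto
  moreover have "\<forall>\<^sub>F y in at z. y \<noteq> z \<and> dist y z < d"
    unfolding eventually_at using d(1) by auto
  ultimately have "\<forall>\<^sub>F y in at z. u z + p \<bullet> (y - z) + (y - z) \<bullet> (H *v (y - z)) / 2 \<le> u y"
  proof eventually_elim
    case (elim y)
    have "?w x + p \<bullet> (y - z) + (y - z) \<bullet> (H *v (y - z)) / 2 \<le> ?w (x + (y - z))"
      using d(2)[of "x + (y - z)"] elim by (simp add: dist_norm)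
    also have "\<dots> \<le> u y + (norm (x - z))\<^sup>2 / (2 * \<epsilon>)"
      using inf_conv_attained(2)[OF uc e(1), of y "x + (y - z)"] elim by simp
    finally show ?case using z(1) by simp
  qed
  then show "pucci_minus lam Lam H \<le> 0"
    using sup zb H unfolding quad_supersolution_def by blast
qed

text \<open>The contact point minimizes w + A/2 |x - y|^2. Beyond distance 2 / sqrt A from the
  vertex y the quadratic part exceeds 2, which is at least w y minus the lower bound -1, so the
  minimum over the ball is global.\<close>

lemma contact_point:
  fixes w :: "real^'n \<Rightarrow> real"
  assumes wc: "continuous_on UNIV w" and lo: "\<And>y. -1 \<le> w y" and A: "0 < A" and y: "w y \<le> 1"
  shows "\<exists>x. norm (x - y) \<le> 2 / sqrt A \<and> touches w A x (A *\<^sub>R (y - x))"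
proof -
  let ?f = "\<lambda>x. w x + A / 2 * (norm (x - y))\<^sup>2"
  let ?B = "cball y (2 / sqrt A)"
  have "continuous_on ?B ?f" by (intro continuous_intros continuous_on_subset[OF wc]) auto
  moreover have yB: "y \<in> ?B" using A by simp
  ultimately obtain x where x: "x \<in> ?B" "\<And>z. z \<in> ?B \<Longrightarrow> ?f x \<le> ?f z"
    using continuous_attains_inf[of ?B ?f] by auto
  have min: "?f x \<le> ?f z" for z
  proof (cases "z \<in> ?B")
    case False
    then have "2 / sqrt A < norm (z - y)" by (simp add: dist_norm norm_minus_commute)
    then have "(2 / sqrt A)\<^sup>2 < (norm (z - y))\<^sup>2" using A by (intro power_strict_mono) auto
    then have "2 < A / 2 * (norm (z - y))\<^sup>2" using A by (simp add: power_divide field_simps)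
    then show ?thesis using x(2)[OF yB] y lo[of z] by simp
  qed (rule x(2))
  have "touches w A x (A *\<^sub>R (y - x))"
    unfolding touches_def
  proof
    fix z
    have e1: "(norm (z - y))\<^sup>2 = (norm (x - y))\<^sup>2 + 2 * ((x - y) \<bullet> (z - x)) + (norm (z - x))\<^sup>2"
      by (simp add: power2_norm_eq_inner inner_diff_left inner_diff_right inner_commute)
    have sg: "(y - x) \<bullet> (z - x) = - ((x - y) \<bullet> (z - x))" by (simp add: inner_diff_left)
    have "A / 2 * (norm (z - y))\<^sup>2 = A / 2 * (norm (x - y))\<^sup>2 - A * ((y - x) \<bullet> (z - x)) + A / 2 * (norm (z - x))\<^sup>2"
      unfolding e1 sg by (simp add: field_simps)
    then show "w x + A *\<^sub>R (y - x) \<bullet> (z - x) - A / 2 * (norm (z - x))\<^sup>2 \<le> w z"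
      using min[of z] unfolding inner_scaleR_left by linarith
  qed
  then show ?thesis using x(1) by (intro exI[of _ x]) (auto simp: dist_norm norm_minus_commute)
qed

text \<open>Moving from x by r = 1/(4 sqrt A) along p stays in the unit ball, where w rises by at
  most 2, while the paraboloid loses 1/32. Thus r |p| <= 2 + 1/32 <= 9/4.\<close>

lemma touches_slope_bound:
  fixes w :: "real^'n \<Rightarrow> real"
  assumes lo: "-1 \<le> w x" and up: "\<And>y. y \<in> cball 0 1 \<Longrightarrow> w y \<le> 1" and x: "norm x \<le> 3/4"
    and A: "1 \<le> A" and t: "touches w A x p"
  shows "norm p \<le> 9 * sqrt A"
proof (cases "p = 0")
  case False
  define r where "r = 1 / (4 * sqrt A)"
  have sA: "1 \<le> sqrt A" using A by simp
  then have r: "0 < r" "r \<le> 1/4" by (auto simp: r_def field_simps)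
  define y where "y = x + (r / norm p) *\<^sub>R p"
  have nr: "norm (y - x) = r" using False r by (simp add: y_def)
  have "norm y \<le> 1" using norm_triangle_ineq[of x "y - x"] nr r x by simp
  then have "w y \<le> 1" by (intro up) simp
  moreover have "p \<bullet> (y - x) = r * norm p"
    using False by (simp add: y_def dot_square_norm power2_eq_square)
  ultimately have "r * norm p \<le> 2 + A / 2 * r\<^sup>2"
    using t[unfolded touches_def, rule_format, of y] lo nr by simp
  moreover have "A / 2 * r\<^sup>2 = 1/32" using A by (simp add: r_def power_divide power_mult_distrib)
  ultimately have "r * norm p \<le> 9/4" by simp
  then show ?thesis using sA by (simp add: r_def field_simps)
qed (use A in simp)

lemma touches_mono: "touches w A x p \<Longrightarrow> A \<le> B \<Longrightarrow> touches w B x p"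
proof -
  assume t: "touches w A x p" and le: "A \<le> B"
  show "touches w B x p"
    unfolding touches_def
  proof
    fix y
    have "A / 2 * (norm (y - x))\<^sup>2 \<le> B / 2 * (norm (y - x))\<^sup>2" using le by (intro mult_right_mono) auto
    then show "w x + p \<bullet> (y - x) - B / 2 * (norm (y - x))\<^sup>2 \<le> w y"
      using t[unfolded touches_def, rule_format, of y] by linarith
  qed
qed

subsection \<open>The estimate for semiconcave supersolutions\<close>

text \<open>The least opening from below, truncated to \<open>[a, N]\<close>; inserting \<open>N\<close> also avoids the infimum of
  the empty set.\<close>

definition touch_opening :: "(real^'n \<Rightarrow> real) \<Rightarrow> real \<Rightarrow> real \<Rightarrow> real^'n \<Rightarrow> real" where
  "touch_opening w a N x = Inf (insert N {A. a \<le> A \<and> A < N \<and> (\<exists>p. touches w A x p)})"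

lemma opening_bounds:
  assumes "a \<le> N"
  shows "a \<le> touch_opening w a N x" "touch_opening w a N x \<le> N"
    and opening_le: "a \<le> A \<Longrightarrow> A < N \<Longrightarrow> touches w A x p \<Longrightarrow> touch_opening w a N x \<le> A"
proof -
  let ?S = "insert N {A. a \<le> A \<and> A < N \<and> (\<exists>p. touches w A x p)}"
  have bdd: "bdd_below ?S" using assms by (intro bdd_belowI[of _ a]) auto
  show "a \<le> touch_opening w a N x" unfolding touch_opening_def by (rule cInf_greatest) (use assms in auto)
  show "touch_opening w a N x \<le> N" unfolding touch_opening_def by (rule cInf_lower[OF _ bdd]) simp
  show "touch_opening w a N x \<le> A" if "a \<le> A" "A < N" "touches w A x p"
    unfolding touch_opening_def by (rule cInf_lower[OF _ bdd]) (use that in auto)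
qed

definition cutoff :: "real \<Rightarrow> real^'n \<Rightarrow> real" where
  "cutoff R y = max 0 (min 1 ((R + 1/16 - norm y) * 16))"

lemma cutoff_props:
  shows "0 \<le> cutoff R y" "cutoff R y \<le> 1" "norm y \<le> R \<Longrightarrow> cutoff R y = 1"
    "cutoff R y \<noteq> 0 \<Longrightarrow> norm y < R + 1/16" "cutoff R x \<le> cutoff R y + 16 * norm (x - y)"
    "continuous_on S (cutoff R)"
proof -
  show "0 \<le> cutoff R y" "cutoff R y \<le> 1" "norm y \<le> R \<Longrightarrow> cutoff R y = 1"
    "cutoff R y \<noteq> 0 \<Longrightarrow> norm y < R + 1/16"
    by (auto simp: cutoff_def min_def max_def split: if_splits)
  have "norm y \<le> norm x + norm (x - y)" using norm_triangle_ineq2[of y x] by (simp add: norm_minus_commute)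
  moreover have "max 0 (min 1 ((R + 1/16 - a) * 16)) \<le> max 0 (min 1 ((R + 1/16 - b) * 16)) + 16 * d"
    if "b \<le> a + d" "0 \<le> d" for a b d :: real
    using that unfolding max_def min_def by (auto split: if_splits)
  ultimately show "cutoff R x \<le> cutoff R y + 16 * norm (x - y)"
    unfolding cutoff_def by simp
  show "continuous_on S (cutoff R)" unfolding cutoff_def by (intro continuous_intros)
qed

text \<open>The interface between the envelope and the integral estimates: s is the gradient of the
  envelope for openings up to N and M its derivative off the null set Z. The estimates proved here
  have constants free of L, Z and N.\<close>

locale contact_structure =
  fixes w :: "real^'n \<Rightarrow> real" and s :: "real^'n \<Rightarrow> real^'n" and L :: real
    and M :: "real^'n \<Rightarrow> real^'n^'n" and Z :: "(real^'n) set" and \<kappa> N :: real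
  assumes wc: "continuous_on UNIV w" and lo: "\<And>y. -1 \<le> w y" and up: "\<And>y. y \<in> cball 0 1 \<Longrightarrow> w y \<le> 1"
    and sl: "L-lipschitz_on UNIV s"
    and slope: "\<And>A x p. A \<le> N \<Longrightarrow> touches w A x p \<Longrightarrow> s x = p"
    and Z: "Z \<in> null_sets lborel"
    and Mm: "\<And>i j. (\<lambda>x. M x $ i $ j) \<in> borel_measurable borel"
    and Md: "\<And>x. x \<notin> Z \<Longrightarrow> (s has_derivative (\<lambda>h. M x *v h)) (at x)"
    and hess: "\<And>A x. x \<notin> Z \<Longrightarrow> norm x < 7/8 \<Longrightarrow> A \<le> N \<Longrightarrow> touches w A x (s x) \<Longrightarrow>
      \<exists>v \<mu>. eigen_family (M x) v \<mu> \<and> (\<forall>i. - A \<le> \<mu> i) \<and>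
        (\<Sum>i\<in>UNIV. max 0 (\<mu> i)) \<le> \<kappa> * (\<Sum>i\<in>UNIV. max 0 (- \<mu> i))"
    and kap: "1 \<le> \<kappa>" and N: "1024 < N"
begin

text \<open>For \<open>A \<ge> 1024\<close> a contact point is within \<open>2 / sqrt A \<le> 1/16\<close> of its vertex, which is the width of
  the cutoff's transition layer.\<close>

abbreviation "\<theta> \<equiv> touch_opening w 1024 N"

text \<open>The absolute Jacobian of the contact map x + s x / A at points outside Z.\<close>

definition jac :: "real \<Rightarrow> real^'n \<Rightarrow> real" where
  "jac A x = \<bar>det (mat 1 + (1/A) *\<^sub>R M x)\<bar>"

lemma sc: "continuous_on S s"
  using lipschitz_on_continuous_on[OF sl] continuous_on_subset by blast

lemma theta_bounds: "1024 \<le> \<theta> x" "\<theta> x \<le> N"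
  using opening_bounds[OF less_imp_le[OF N]] by auto

text \<open>The infimum is attained because all openings up to N share the slope \<open>s x\<close>,
  and for a fixed slope touching is a closed condition on the opening. The value N is inserted
  artificially in the infimum, whence A < N.\<close>

lemma theta_le_iff:
  assumes A: "1024 \<le> A" "A < N"
  shows "\<theta> x \<le> A \<longleftrightarrow> touches w A x (s x)"
proof
  assume "touches w A x (s x)"
  then show "\<theta> x \<le> A" using opening_le[OF _ A] N by auto
next
  assume le: "\<theta> x \<le> A"
  have tB: "touches w B x (s x)" if B: "A < B" "B < N" for B
  proof -
    let ?S = "insert N {A. 1024 \<le> A \<and> A < N \<and> (\<exists>p. touches w A x p)}"
    have "\<theta> x < B" using le B by simp
    moreover have "?S \<noteq> {}" "bdd_below ?S" using N by (auto intro!: bdd_belowI[of _ 1024])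
    ultimately obtain A' where "A' \<in> ?S" "A' < B" unfolding touch_opening_def using cInf_less_iff[of ?S B] by blast
    then obtain p where "touches w A' x p" "A' < B" using B by auto
    moreover from this have "s x = p" using slope[of A' x p] B by simp
    ultimately show ?thesis using touches_mono[of w A' x p B] by simp
  qed
  show "touches w A x (s x)"
    unfolding touches_def
  proof
    fix y
    have "((\<lambda>B. w x + s x \<bullet> (y - x) - B / 2 * (norm (y - x))\<^sup>2) \<longlongrightarrow> w x + s x \<bullet> (y - x) - A / 2 * (norm (y - x))\<^sup>2) (at_right A)"
      by (intro tendsto_intros) auto
    moreover have "\<forall>\<^sub>F B in at_right A. w x + s x \<bullet> (y - x) - B / 2 * (norm (y - x))\<^sup>2 \<le> w y"
      unfolding eventually_at_right[OF A(2)] using tB A(2) by (intro exI[of _ N]) (auto simp: touches_def)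
    ultimately show "w x + s x \<bullet> (y - x) - A / 2 * (norm (y - x))\<^sup>2 \<le> w y"
      by (rule tendsto_upperbound) simp
  qed
qed

lemma closed_touches: "closed {x. touches w A x (s x)}"
proof -
  have "{x. touches w A x (s x)} = (\<Inter>y. {x. w x + s x \<bullet> (y - x) - A / 2 * (norm (y - x))\<^sup>2 \<le> w y})"
    by (auto simp: touches_def)
  then show ?thesis
    by (auto intro!: closed_INT closed_Collect_le continuous_intros wc sc)
qed

lemma theta_measurable [measurable]: "\<theta> \<in> borel_measurable borel"
proof (rule borel_measurableI_le)
  fix A
  consider "A < 1024" | "1024 \<le> A" "A < N" | "N \<le> A" by linarith
  then have "{x. \<theta> x \<le> A} \<in> sets borel"
  proof cases
    case 1
    then have "{x. \<theta> x \<le> A} = {}" using theta_bounds(1) by (auto simp: not_le intro: less_le_trans)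
    then show ?thesis by simp
  next
    case 2
    then show ?thesis using closed_touches[of A] by (simp add: theta_le_iff)
  next
    case 3
    then have "{x. \<theta> x \<le> A} = UNIV" using theta_bounds(2) by (auto intro: order_trans)
    then show ?thesis by simp
  qed
  then show "{x \<in> space borel. \<theta> x \<le> A} \<in> sets borel" by simp
qed

lemma touches_theta: "\<theta> x < N \<Longrightarrow> touches w (\<theta> x) x (s x)"
  using theta_le_iff[of "\<theta> x" x] theta_bounds[of x] by simp

lemma slope_le: "\<theta> x < N \<Longrightarrow> norm x \<le> 3/4 \<Longrightarrow> norm (s x) \<le> 9 * sqrt (\<theta> x)"
  using touches_slope_bound[OF lo up _ _ touches_theta] theta_bounds(1)[of x] by simp

text \<open>One family of eigenvalues serves all A >= \<open>\<theta> x\<close>, since M x comes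
  from a single envelope. The crude bound, from eigenvalues at most \<open>\<kappa>\<close> n
  \<open>\<theta> x\<close>, is meant for the displacement error.\<close>

lemma jac_eq_prod:
  assumes "x \<notin> Z" "norm x < 7/8" "\<theta> x < N"
  obtains \<mu> :: "'n \<Rightarrow> real" where "\<And>i. - \<theta> x \<le> \<mu> i"
    "(\<Sum>i\<in>UNIV. max 0 (\<mu> i)) \<le> \<kappa> * (\<Sum>i\<in>UNIV. max 0 (- \<mu> i))"
    "\<And>A. \<theta> x \<le> A \<Longrightarrow> jac A x = (\<Prod>i\<in>UNIV. 1 + \<mu> i / A)"
    "\<And>A. \<theta> x \<le> A \<Longrightarrow> jac A x \<le> (1 + \<kappa> * real CARD('n)) ^ CARD('n)"
proof -
  obtain v \<mu> where ev: "eigen_family (M x) v \<mu>" and low: "\<And>i. - \<theta> x \<le> \<mu> i"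
    and puc: "(\<Sum>i\<in>UNIV. max 0 (\<mu> i)) \<le> \<kappa> * (\<Sum>i\<in>UNIV. max 0 (- \<mu> i))"
    using hess[OF assms(1,2) theta_bounds(2) touches_theta[OF assms(3)]] by blast
  have t0: "0 < \<theta> x" using theta_bounds(1)[of x] by simp
  have fac: "0 \<le> 1 + \<mu> i / A" if "\<theta> x \<le> A" for i A
    using low[of i] that t0 by (simp add: field_simps)
  have prod: "jac A x = (\<Prod>i\<in>UNIV. 1 + \<mu> i / A)" if "\<theta> x \<le> A" for A
  proof -
    have "eigen_family (mat 1 + (1/A) *\<^sub>R M x) v (\<lambda>i. 1 + \<mu> i / A)"
      using eigen_family_affine[OF ev, of 1 "1/A"] by simp
    from eigen_family_det[OF this] show ?thesis
      unfolding jac_def using fac[OF that] by (simp add: prod_nonneg abs_of_nonneg)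
  qed
  have "jac A x \<le> (1 + \<kappa> * real CARD('n)) ^ CARD('n)" if A: "\<theta> x \<le> A" for A
  proof -
    have A0: "0 < A" using A t0 by simp
    have "(\<Sum>i\<in>UNIV. max 0 (- \<mu> i)) \<le> (\<Sum>i\<in>(UNIV :: 'n set). \<theta> x)"
      using low t0 by (intro sum_mono) (simp add: minus_le_iff)
    also have "\<dots> = real CARD('n) * \<theta> x" by simp
    also have "\<dots> \<le> real CARD('n) * A" using A by (rule mult_left_mono) simp
    finally have S: "(\<Sum>i\<in>UNIV. max 0 (- \<mu> i)) \<le> real CARD('n) * A" .
    have "1 + \<mu> i / A \<le> 1 + \<kappa> * real CARD('n)" for i
    proof -
      have "\<mu> i \<le> max 0 (\<mu> i)" by simp
      also have "\<dots> \<le> (\<Sum>i\<in>UNIV. max 0 (\<mu> i))"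
        by (rule member_le_sum) auto
      also have "\<dots> \<le> \<kappa> * (real CARD('n) * A)"
        using puc S kap mult_left_mono[OF S, of \<kappa>] by linarith
      finally show ?thesis using A0 by (simp add: divide_le_eq mult.assoc)
    qed
    then have "(\<Prod>i\<in>(UNIV :: 'n set). 1 + \<mu> i / A) \<le> (\<Prod>i\<in>(UNIV :: 'n set). 1 + \<kappa> * real CARD('n))"
      using fac[OF A] by (intro prod_mono) auto
    then show ?thesis using prod[OF A] by simp
  qed
  then show thesis using that[OF low puc prod] by blast
qed

lemma jac_measurable: "(\<lambda>z. jac (fst z) (snd z)) \<in> borel_measurable (borel \<Otimes>\<^sub>M borel)"
proof -
  have [measurable]: "(\<lambda>x. M x $ i $ j) \<in> borel_measurable borel" for i j by (rule Mm)
  have "(\<lambda>z. det (mat 1 + (1 / fst z) *\<^sub>R M (snd z))) \<in> borel_measurable (borel \<Otimes>\<^sub>M borel)"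
  proof (rule borel_measurable_det)
    fix i j
    have "(\<lambda>z. (mat 1 :: real^'n^'n) $ i $ j + (1 / fst z) * (M (snd z) $ i $ j)) \<in> borel_measurable (borel \<Otimes>\<^sub>M borel)"
      by measurable
    then show "(\<lambda>z. (mat 1 + (1 / fst z) *\<^sub>R M (snd z)) $ i $ j) \<in> borel_measurable (borel \<Otimes>\<^sub>M borel)"
      by simp
  qed
  then show ?thesis unfolding jac_def by measurable
qed

lemma jac_measurable' [measurable]:
  assumes [measurable]: "f \<in> borel_measurable P" "g \<in> P \<rightarrow>\<^sub>M borel"
  shows "(\<lambda>z. jac (f z) (g z)) \<in> borel_measurable P"
  using measurable_compose[OF _ jac_measurable, of "\<lambda>z. (f z, g z)" P] by simp

text \<open>Every vertex in the support of the cutoff is the image of a contact point, so the area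
  inequality bounds the mass of the cutoff by an integral over the contact set.\<close>

lemma contact_area:
  assumes R: "0 \<le> R" "R \<le> 5/8" and A: "1024 \<le> A" "A < N"
  shows "(\<integral>\<^sup>+y. ennreal (cutoff R (y :: real^'n)) \<partial>lborel) \<le>
    (\<integral>\<^sup>+x. ennreal ((cutoff R x + 144 * sqrt (\<theta> x) / A) * jac A x) *
       ((if \<theta> x \<le> A then 1 else 0) * indicator (cball 0 (R + 1/8)) x) \<partial>lborel)"
proof -
  define S where "S = cball 0 (R + 1/8) \<inter> {x. touches w A x (s x)}"
  define g where "g = (\<lambda>x. x + (1/A) *\<^sub>R s x)"
  have A0: "0 < A" using A by simp
  have S: "compact S" unfolding S_def by (intro compact_Int_closed compact_cball closed_touches)
  have gl: "(1 + \<bar>1/A\<bar> * L)-lipschitz_on UNIV g"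
    unfolding g_def by (rule lipschitz_on_add[OF lipschitz_on_id lipschitz_on_cmult[OF sl]])
  have cover: "y \<in> g ` S" if "cutoff R y \<noteq> 0" for y :: "real^'n"
  proof -
    have y: "norm y < R + 1/16" using cutoff_props(4)[OF that] .
    then have "w y \<le> 1" using R by (intro up) simp
    then obtain x where x: "norm (x - y) \<le> 2 / sqrt A" "touches w A x (A *\<^sub>R (y - x))"
      using contact_point[OF wc lo A0] by blast
    have sx: "s x = A *\<^sub>R (y - x)" using slope[OF _ x(2)] A by simp
    \<comment> \<open>1024 = 32^2, so a contact point is within 1/16 of its vertex; together with
      the cutoff's layer of width 1/16 this enlarges the radius by 1/8.\<close>
    have "32 \<le> sqrt A" by (rule real_le_rsqrt) (use A(1) in simp)
    then have "2 / sqrt A \<le> 2 / 32" using A0 by (intro divide_left_mono) auto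
    then have "norm x \<le> R + 1/8" using x(1) y norm_triangle_ineq[of y "x - y"] by simp
    then have "x \<in> S" using x(2) sx by (simp add: S_def)
    moreover have "g x = y" using A0 by (simp add: g_def sx)
    ultimately show ?thesis by blast
  qed
  have "(\<integral>\<^sup>+y. ennreal (cutoff R (y :: real^'n)) \<partial>lborel) = (\<integral>\<^sup>+y. ennreal (cutoff R y) * indicator (g ` S) y \<partial>lborel)"
  proof (rule nn_integral_cong)
    fix y :: "real^'n"
    show "ennreal (cutoff R y) = ennreal (cutoff R y) * indicator (g ` S) y"
      using cover[of y] by (cases "cutoff R y = 0") simp_all
  qed
  also have "\<dots> \<le> (\<integral>\<^sup>+x. ennreal (cutoff R (g x) * \<bar>det (mat 1 + (1/A) *\<^sub>R M x)\<bar>) * indicator S x \<partial>lborel)"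
  proof (rule area_le[OF S gl Z])
    show "(\<lambda>x. (mat 1 + (1/A) *\<^sub>R M x) $ i $ j) \<in> borel_measurable borel" for i j
      using Mm by simp
    show "(g has_derivative (\<lambda>h. (mat 1 + (1/A) *\<^sub>R M x) *v h)) (at x)" if "x \<in> S - Z" for x
    proof -
      have "(g has_derivative (\<lambda>h. h + (1/A) *\<^sub>R (M x *v h))) (at x)"
        unfolding g_def using Md[of x] that by (intro derivative_intros) auto
      then show ?thesis
        by (simp add: matrix_vector_mult_add_rdistrib scaleR_matrix_vector_assoc[symmetric])
    qed
  qed (rule cutoff_props)+
  also have "\<dots> \<le> (\<integral>\<^sup>+x. ennreal ((cutoff R x + 144 * sqrt (\<theta> x) / A) * jac A x) *
       ((if \<theta> x \<le> A then 1 else 0) * indicator (cball 0 (R + 1/8)) x) \<partial>lborel)"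
  proof (rule nn_integral_mono)
    fix x
    show "ennreal (cutoff R (g x) * \<bar>det (mat 1 + (1/A) *\<^sub>R M x)\<bar>) * indicator S x \<le>
      ennreal ((cutoff R x + 144 * sqrt (\<theta> x) / A) * jac A x) * ((if \<theta> x \<le> A then 1 else 0) * indicator (cball 0 (R + 1/8)) x)"
    proof (cases "x \<in> S")
      case True
      then have x: "x \<in> cball 0 (R + 1/8)" "\<theta> x \<le> A" using theta_le_iff[OF A] by (auto simp: S_def)
      have "norm (s x) \<le> 9 * sqrt (\<theta> x)" using slope_le[of x] x A R by simp
      then have "norm (g x - x) \<le> 9 * sqrt (\<theta> x) / A" using A0 by (simp add: g_def divide_right_mono)
      \<comment> \<open>144 = 16 * 9: the Lipschitz constant of the cutoff times the constant in the
        slope bound.\<close>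
      then have "cutoff R (g x) \<le> cutoff R x + 144 * sqrt (\<theta> x) / A"
        using cutoff_props(5)[of R "g x" x] by simp
      then have "cutoff R (g x) * \<bar>det (mat 1 + (1/A) *\<^sub>R M x)\<bar> \<le> (cutoff R x + 144 * sqrt (\<theta> x) / A) * jac A x"
        unfolding jac_def by (rule mult_right_mono) simp
      then show ?thesis using True x by (simp add: ennreal_leI)
    qed simp
  qed
  finally show ?thesis .
qed

text \<open>For fixed x the undisplaced part is the weighted eigenvalue integral. The displacement
  adds a multiple of sqrt \<open>\<theta>\<close> / A with the Jacobian bounded, and the integral of
  p A^(p-2) from \<open>\<theta>\<close> on is at most p/(1-p) \<open>\<theta>\<close>^(p-1), so
  half a power is gained.\<close>

lemma inner_integral:
  assumes p: "0 < p" "p < 1" and c: "0 \<le> c" "c < 1"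
    and main: "\<And>(\<mu> :: 'n \<Rightarrow> real) t. 0 < t \<Longrightarrow> t \<le> N \<Longrightarrow> (\<And>i. - t \<le> \<mu> i) \<Longrightarrow>
      (\<Sum>i\<in>UNIV. max 0 (\<mu> i)) \<le> \<kappa> * (\<Sum>i\<in>UNIV. max 0 (- \<mu> i)) \<Longrightarrow>
      (\<integral>\<^sup>+A. ennreal (p * A powr (p - 1) * (\<Prod>i\<in>UNIV. 1 + \<mu> i / A)) * indicator {t..N} A \<partial>lborel)
        \<le> ennreal (N powr p - (1 - c) * t powr p)"
    and x: "x \<notin> Z" "norm x < 7/8" and e: "0 \<le> e"
  shows "(\<integral>\<^sup>+A. ennreal (p * A powr (p - 1)) * indicator {1024..<N} A *
      (ennreal ((e + 144 * sqrt (\<theta> x) / A) * jac A x) * (if \<theta> x \<le> A then 1 else 0)) \<partial>lborel)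
    \<le> ennreal (e * (N powr p - (1 - c) * \<theta> x powr p)) +
      ennreal (144 * (1 + \<kappa> * real CARD('n)) ^ CARD('n) * (p / (1 - p)) * \<theta> x powr (p - 1/2))"
    (is "?lhs \<le> _ + ennreal ?r")
proof (cases "\<theta> x < N")
  case True
  define K where "K = (1 + \<kappa> * real CARD('n)) ^ CARD('n)"
  have K0: "0 \<le> K" using kap by (simp add: K_def)
  have t0: "0 < \<theta> x" using theta_bounds(1)[of x] by simp
  obtain \<mu> :: "'n \<Rightarrow> real" where \<mu>: "\<And>i. - \<theta> x \<le> \<mu> i"
    "(\<Sum>i\<in>UNIV. max 0 (\<mu> i)) \<le> \<kappa> * (\<Sum>i\<in>UNIV. max 0 (- \<mu> i))"
    "\<And>A. \<theta> x \<le> A \<Longrightarrow> jac A x = (\<Prod>i\<in>UNIV. 1 + \<mu> i / A)"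
    "\<And>A. \<theta> x \<le> A \<Longrightarrow> jac A x \<le> K"
    unfolding K_def using jac_eq_prod[OF x True] by blast
  have fac: "0 \<le> (\<Prod>i\<in>UNIV. 1 + \<mu> i / A)" if "\<theta> x \<le> A" for A
    using \<mu>(3)[OF that] by (simp add: jac_def)
  let ?f1 = "\<lambda>A. ennreal e * (ennreal (p * A powr (p - 1) * (\<Prod>i\<in>UNIV. 1 + \<mu> i / A)) * indicator {\<theta> x..N} A)"
  let ?f2 = "\<lambda>A. ennreal (144 * sqrt (\<theta> x) * K) * (ennreal (p * A powr (p - 2)) * indicator {\<theta> x..N} A)"
  have L1: "?lhs \<le> (\<integral>\<^sup>+A. ?f1 A + ?f2 A \<partial>lborel)"
  proof (rule nn_integral_mono)
    fix A :: real
    show "ennreal (p * A powr (p - 1)) * indicator {1024..<N} A *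
      (ennreal ((e + 144 * sqrt (\<theta> x) / A) * jac A x) * (if \<theta> x \<le> A then 1 else 0)) \<le> ?f1 A + ?f2 A"
    proof (cases "\<theta> x \<le> A \<and> A < N")
      case A: True
      have A0: "0 < A" using A t0 by simp
      have pw: "A powr (p - 1) / A = A powr (p - 2)"
        using A0 powr_diff[of A "p - 1" 1] by simp
      have "p * A powr (p - 1) * ((e + 144 * sqrt (\<theta> x) / A) * jac A x) =
          e * (p * A powr (p - 1) * jac A x) + 144 * sqrt (\<theta> x) * jac A x * (p * (A powr (p - 1) / A))"
        by (simp add: algebra_simps)
      also have "\<dots> \<le> e * (p * A powr (p - 1) * jac A x) + 144 * sqrt (\<theta> x) * K * (p * (A powr (p - 1) / A))"
        using \<mu>(4)[of A] A t0 p A0 by (intro add_left_mono mult_right_mono mult_left_mono) auto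
      finally have "ennreal (p * A powr (p - 1) * ((e + 144 * sqrt (\<theta> x) / A) * jac A x)) \<le>
          ennreal (e * (p * A powr (p - 1) * (\<Prod>i\<in>UNIV. 1 + \<mu> i / A)) + 144 * sqrt (\<theta> x) * K * (p * A powr (p - 2)))"
        using \<mu>(3)[of A] A by (intro ennreal_leI) (simp add: pw)
      also have "\<dots> = ennreal e * ennreal (p * A powr (p - 1) * (\<Prod>i\<in>UNIV. 1 + \<mu> i / A)) + ennreal (144 * sqrt (\<theta> x) * K) * ennreal (p * A powr (p - 2))"
        using e p K0 t0 fac[of A] A by (simp add: ennreal_mult ennreal_plus)
      finally have main_le: "ennreal (p * A powr (p - 1) * ((e + 144 * sqrt (\<theta> x) / A) * jac A x)) \<le>
          ennreal e * ennreal (p * A powr (p - 1) * (\<Prod>i\<in>UNIV. 1 + \<mu> i / A)) + ennreal (144 * sqrt (\<theta> x) * K) * ennreal (p * A powr (p - 2))" .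
      have "1024 \<le> A" using A theta_bounds(1)[of x] by simp
      then show ?thesis
        using main_le A p by (simp add: ennreal_mult'[symmetric])
    qed (auto simp: indicator_def)
  qed
  have L2: "(\<integral>\<^sup>+A. ?f1 A + ?f2 A \<partial>lborel) = (\<integral>\<^sup>+A. ?f1 A \<partial>lborel) + (\<integral>\<^sup>+A. ?f2 A \<partial>lborel)"
    by (rule nn_integral_add) measurable
  have "(\<integral>\<^sup>+A. ?f1 A \<partial>lborel) = ennreal e * (\<integral>\<^sup>+A. ennreal (p * A powr (p - 1) * (\<Prod>i\<in>UNIV. 1 + \<mu> i / A)) * indicator {\<theta> x..N} A \<partial>lborel)"
    by (rule nn_integral_cmult) measurable
  also have "\<dots> \<le> ennreal e * ennreal (N powr p - (1 - c) * \<theta> x powr p)"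
    by (intro mult_left_mono main t0 theta_bounds(2) \<mu>) auto
  also have "\<dots> = ennreal (e * (N powr p - (1 - c) * \<theta> x powr p))"
    using e by (rule ennreal_mult'[symmetric])
  finally have I1: "(\<integral>\<^sup>+A. ?f1 A \<partial>lborel) \<le> ennreal (e * (N powr p - (1 - c) * \<theta> x powr p))" .
  have f2: "(\<integral>\<^sup>+A. ?f2 A \<partial>lborel) = ennreal (144 * sqrt (\<theta> x) * K) * (\<integral>\<^sup>+A. ennreal (p * A powr (p - 2)) * indicator {\<theta> x..N} A \<partial>lborel)"
    by (rule nn_integral_cmult) measurable
  have "(\<integral>\<^sup>+A. ennreal (p * A powr (p - 2)) * indicator {\<theta> x..N} A \<partial>lborel) =
      ennreal (- (p / (1 - p)) * N powr (p - 1) - (- (p / (1 - p)) * \<theta> x powr (p - 1)))"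
  proof (rule nn_integral_FTC_Icc)
    fix A assume A: "A \<in> {\<theta> x..N}"
    then have A0: "0 < A" using t0 by simp
    have "((\<lambda>A. - (p / (1 - p)) * A powr (p - 1)) has_real_derivative - (p / (1 - p)) * ((p - 1) * A powr (p - 1 - 1))) (at A)"
      by (intro DERIV_cmult has_real_derivative_powr A0)
    moreover have "- (p / (1 - p)) * ((p - 1) * A powr (p - 1 - 1)) = p * A powr (p - 2)"
      using p by (simp add: field_simps)
    ultimately show "((\<lambda>A. - (p / (1 - p)) * A powr (p - 1)) has_real_derivative p * A powr (p - 2)) (at A)" by simp
  qed (use p theta_bounds(2) in auto)
  also have "\<dots> \<le> ennreal (p / (1 - p) * \<theta> x powr (p - 1))"
    using p by (intro ennreal_leI) simp
  finally have I2: "(\<integral>\<^sup>+A. ?f2 A \<partial>lborel) \<le> ennreal (144 * sqrt (\<theta> x) * K) * ennreal (p / (1 - p) * \<theta> x powr (p - 1))"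
    unfolding f2 by (rule mult_left_mono) simp
  have "?lhs \<le> ennreal (e * (N powr p - (1 - c) * \<theta> x powr p)) +
      ennreal (144 * sqrt (\<theta> x) * K) * ennreal (p / (1 - p) * \<theta> x powr (p - 1))"
    using L1 unfolding L2 by (rule order_trans[OF _ add_mono[OF I1 I2]])
  also have "ennreal (144 * sqrt (\<theta> x) * K) * ennreal (p / (1 - p) * \<theta> x powr (p - 1)) = ennreal (144 * sqrt (\<theta> x) * K * (p / (1 - p) * \<theta> x powr (p - 1)))"
    using K0 t0 by (intro ennreal_mult'[symmetric]) simp
  also have "144 * sqrt (\<theta> x) * K * (p / (1 - p) * \<theta> x powr (p - 1)) = 144 * K * (p / (1 - p)) * (\<theta> x powr (1/2) * \<theta> x powr (p - 1))"
    using t0 by (simp add: powr_half_sqrt)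
  also have "\<theta> x powr (1/2) * \<theta> x powr (p - 1) = \<theta> x powr (p - 1/2)"
    by (simp add: powr_add[symmetric])
  finally show ?thesis by (simp add: K_def)
next
  case False
  \<comment> \<open>At a point with opening N the conditions \<open>\<theta> x\<close> <= A and A <
    N exclude each other.\<close>
  then have "?lhs = (\<integral>\<^sup>+A. 0 \<partial>(lborel :: real measure))"
    by (intro nn_integral_cong) (auto simp: indicator_def)
  then show ?thesis by simp
qed

text \<open>\<open>contact_area\<close> is integrated against p A^(p-1) and the order of integration
  is exchanged. The power p is thereby controlled by the power p - 1/2 on a ball larger by
  1/8.\<close>

theorem opening_power_step:
  assumes p: "0 < p" "p < 1" and c: "0 \<le> c" "c < 1"
    and main: "\<And>(\<mu> :: 'n \<Rightarrow> real) t. 0 < t \<Longrightarrow> t \<le> N \<Longrightarrow> (\<And>i. - t \<le> \<mu> i) \<Longrightarrow>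
      (\<Sum>i\<in>UNIV. max 0 (\<mu> i)) \<le> \<kappa> * (\<Sum>i\<in>UNIV. max 0 (- \<mu> i)) \<Longrightarrow>
      (\<integral>\<^sup>+A. ennreal (p * A powr (p - 1) * (\<Prod>i\<in>UNIV. 1 + \<mu> i / A)) * indicator {t..N} A \<partial>lborel)
        \<le> ennreal (N powr p - (1 - c) * t powr p)"
    and R: "0 \<le> R" "R \<le> 5/8"
  shows "ennreal (1 - c) * (\<integral>\<^sup>+x. ennreal (\<theta> x powr p) * indicator (cball 0 R) x \<partial>lborel) \<le>
    ennreal (1024 powr p) * emeasure lborel (cball 0 1 :: (real^'n) set) +
    ennreal (144 * (1 + \<kappa> * real CARD('n)) ^ CARD('n) * (p / (1 - p))) *
      (\<integral>\<^sup>+x. ennreal (\<theta> x powr (p - 1/2)) * indicator (cball 0 (R + 1/8)) x \<partial>lborel)"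
proof -
  define K where "K = 144 * (1 + \<kappa> * real CARD('n)) ^ CARD('n) * (p / (1 - p))"
  have K0: "0 \<le> K" using kap p by (simp add: K_def)
  define \<eta> :: "real^'n \<Rightarrow> real" where "\<eta> = cutoff R"
  have \<eta>: "0 \<le> \<eta> x" "\<eta> x \<le> 1" for x unfolding \<eta>_def by (rule cutoff_props)+
  have [measurable]: "\<eta> \<in> borel_measurable borel"
    unfolding \<eta>_def by (rule borel_measurable_continuous_onI[OF cutoff_props(6)])
  have \<eta>s: "\<eta> x = 0" if "x \<notin> cball 0 (R + 1/8)" for x
    using cutoff_props(4)[of R x] that by (force simp: \<eta>_def)
  define E where "E = (\<integral>\<^sup>+y. ennreal (\<eta> y) \<partial>lborel)"
  have E_le: "E \<le> emeasure lborel (cball 0 1 :: (real^'n) set)"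
  proof -
    have "E \<le> (\<integral>\<^sup>+y. indicator (cball 0 1) y \<partial>(lborel :: (real^'n) measure))"
      unfolding E_def
    proof (rule nn_integral_mono)
      fix y :: "real^'n"
      show "ennreal (\<eta> y) \<le> indicator (cball 0 1) y"
        using \<eta>s[of y] \<eta>(2)[of y] R by (cases "y \<in> cball 0 1") (auto simp: indicator_def intro: ennreal_le_1[THEN iffD2])
    qed
    then show ?thesis by simp
  qed
  have E_fin: "E < \<infinity>" using E_le emeasure_lborel_cball_finite[of "0 :: real^'n" 1] by (rule le_less_trans)
  define Y where "Y = (\<integral>\<^sup>+x. ennreal (\<theta> x powr (p - 1/2)) * indicator (cball 0 (R + 1/8)) x \<partial>lborel)"
  define X where "X = (\<integral>\<^sup>+x. ennreal (\<eta> x * ((1 - c) * \<theta> x powr p)) \<partial>lborel)"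
  let ?g = "\<lambda>A x. ennreal ((\<eta> x + 144 * sqrt (\<theta> x) / A) * jac A x) *
       ((if \<theta> x \<le> A then 1 else 0) * indicator (cball 0 (R + 1/8)) x)"
  let ?f = "\<lambda>A x. ennreal (p * A powr (p - 1)) * indicator {1024..<N} A * ?g A x"
  have [measurable]: "cball (0 :: real^'n) (R + 1/8) \<in> sets borel" "cball (0 :: real^'n) R \<in> sets borel" by simp_all
  have fm: "case_prod (\<lambda>x A. ?f A x) \<in> borel_measurable (lborel \<Otimes>\<^sub>M lborel)"
    by measurable
  have "ennreal (N powr p - 1024 powr p) * E = (\<integral>\<^sup>+A. ennreal (p * A powr (p - 1)) * indicator {1024..N} A \<partial>lborel) * E"
  proof -
    have "(\<integral>\<^sup>+A. ennreal (p * A powr (p - 1)) * indicator {1024..N} A \<partial>lborel) = ennreal (N powr p - 1024 powr p)"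
      by (rule nn_integral_FTC_Icc) (use p N in \<open>auto intro!: has_real_derivative_powr\<close>)
    then show ?thesis by simp
  qed
  also have "\<dots> = (\<integral>\<^sup>+A. ennreal (p * A powr (p - 1)) * indicator {1024..N} A * E \<partial>lborel)"
    by (rule nn_integral_multc[symmetric]) measurable
  also have "\<dots> \<le> (\<integral>\<^sup>+A. (\<integral>\<^sup>+x. ?f A x \<partial>lborel) \<partial>lborel)"
  proof (rule nn_integral_mono_AE)
    \<comment> \<open>\<open>contact_area\<close> covers A < N; the endpoint N is a null set of
      openings.\<close>
    have "AE A in lborel. A \<noteq> N" by (rule AE_lborel_singleton)
    then show "AE A in lborel. ennreal (p * A powr (p - 1)) * indicator {1024..N} A * E \<le> (\<integral>\<^sup>+x. ?f A x \<partial>lborel)"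
    proof eventually_elim
      case (elim A)
      show ?case
      proof (cases "1024 \<le> A \<and> A < N")
        case True
        have "E \<le> (\<integral>\<^sup>+x. ?g A x \<partial>lborel)"
          unfolding E_def \<eta>_def using contact_area[OF R, of A] True by simp
        then have "ennreal (p * A powr (p - 1)) * E \<le> ennreal (p * A powr (p - 1)) * (\<integral>\<^sup>+x. ?g A x \<partial>lborel)"
          by (rule mult_left_mono) simp
        also have "\<dots> = (\<integral>\<^sup>+x. ennreal (p * A powr (p - 1)) * ?g A x \<partial>lborel)"
          by (rule nn_integral_cmult[symmetric]) measurable
        finally show ?thesis using True by simp
      next
        case False
        then have "A \<notin> {1024..N}" using elim by auto
        then show ?thesis by simp
      qed
    qed
  qed
  also have "\<dots> = (\<integral>\<^sup>+x. (\<integral>\<^sup>+A. ?f A x \<partial>lborel) \<partial>lborel)"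
    by (rule lborel_pair.Fubini'[OF fm])
  also have "\<dots> \<le> (\<integral>\<^sup>+x. ennreal (\<eta> x * (N powr p - (1 - c) * \<theta> x powr p)) +
      ennreal K * (ennreal (\<theta> x powr (p - 1/2)) * indicator (cball 0 (R + 1/8)) x) \<partial>lborel)"
  proof (rule nn_integral_mono_AE)
    show "AE x in lborel. (\<integral>\<^sup>+A. ?f A x \<partial>lborel) \<le> ennreal (\<eta> x * (N powr p - (1 - c) * \<theta> x powr p)) +
      ennreal K * (ennreal (\<theta> x powr (p - 1/2)) * indicator (cball 0 (R + 1/8)) x)"
      using AE_not_in[OF Z]
    proof eventually_elim
      case (elim x)
      show ?case
      proof (cases "x \<in> cball 0 (R + 1/8)")
        case True
        then have x: "norm x < 7/8" using R by simp
        have "(\<integral>\<^sup>+A. ?f A x \<partial>lborel) = (\<integral>\<^sup>+A. ennreal (p * A powr (p - 1)) * indicator {1024..<N} A *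
           (ennreal ((\<eta> x + 144 * sqrt (\<theta> x) / A) * jac A x) * (if \<theta> x \<le> A then 1 else 0)) \<partial>lborel)"
          using True by (intro nn_integral_cong) simp
        also have "\<dots> \<le> ennreal (\<eta> x * (N powr p - (1 - c) * \<theta> x powr p)) + ennreal (K * \<theta> x powr (p - 1/2))"
          unfolding K_def by (rule inner_integral[OF p c main elim x \<eta>(1)])
        also have "ennreal (K * \<theta> x powr (p - 1/2)) = ennreal K * ennreal (\<theta> x powr (p - 1/2))"
          using K0 by (rule ennreal_mult')
        finally show ?thesis using True by simp
      qed simp
    qed
  qed
  also have "\<dots> = (\<integral>\<^sup>+x. ennreal (\<eta> x * (N powr p - (1 - c) * \<theta> x powr p)) \<partial>lborel) + ennreal K * Y"
    unfolding Y_def by (subst nn_integral_add) (auto simp: nn_integral_cmult)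
  finally have ineq: "ennreal (N powr p - 1024 powr p) * E \<le>
     (\<integral>\<^sup>+x. ennreal (\<eta> x * (N powr p - (1 - c) * \<theta> x powr p)) \<partial>lborel) + ennreal K * Y" .
  have tp: "(1 - c) * \<theta> x powr p \<le> N powr p" for x
  proof -
    have "\<theta> x powr p \<le> N powr p" using theta_bounds[of x] p by (intro powr_mono2) auto
    moreover have "(1 - c) * \<theta> x powr p \<le> 1 * \<theta> x powr p" using c by (intro mult_right_mono) auto
    ultimately show ?thesis by simp
  qed
  \<comment> \<open>Instead of subtracting in \<open>ennreal\<close>, X is added to both sides of
    \<open>ineq\<close>. This completes the right side to N^p E, whose finite part (N^p - 1024^p) E
    is then cancelled.\<close>
  have sumE: "(\<integral>\<^sup>+x. ennreal (\<eta> x * (N powr p - (1 - c) * \<theta> x powr p)) \<partial>lborel) + X = ennreal (N powr p) * E"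
  proof -
    have "(\<integral>\<^sup>+x. ennreal (\<eta> x * (N powr p - (1 - c) * \<theta> x powr p)) \<partial>lborel) + X =
        (\<integral>\<^sup>+x. ennreal (\<eta> x * (N powr p - (1 - c) * \<theta> x powr p)) + ennreal (\<eta> x * ((1 - c) * \<theta> x powr p)) \<partial>lborel)"
      unfolding X_def by (rule nn_integral_add[symmetric]) measurable
    also have "\<dots> = (\<integral>\<^sup>+x. ennreal (N powr p) * ennreal (\<eta> x) \<partial>lborel)"
    proof (rule nn_integral_cong)
      fix x
      have "0 \<le> \<eta> x * (N powr p - (1 - c) * \<theta> x powr p)" "0 \<le> \<eta> x * ((1 - c) * \<theta> x powr p)"
        using \<eta>(1)[of x] tp[of x] c by auto
      then have "ennreal (\<eta> x * (N powr p - (1 - c) * \<theta> x powr p)) + ennreal (\<eta> x * ((1 - c) * \<theta> x powr p)) =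
         ennreal (\<eta> x * (N powr p - (1 - c) * \<theta> x powr p) + \<eta> x * ((1 - c) * \<theta> x powr p))"
        by (rule ennreal_plus[symmetric])
      also have "\<dots> = ennreal (N powr p * \<eta> x)" by (simp add: algebra_simps)
      also have "\<dots> = ennreal (N powr p) * ennreal (\<eta> x)" by (rule ennreal_mult') simp
      finally show "ennreal (\<eta> x * (N powr p - (1 - c) * \<theta> x powr p)) + ennreal (\<eta> x * ((1 - c) * \<theta> x powr p)) =
        ennreal (N powr p) * ennreal (\<eta> x)" .
    qed
    also have "\<dots> = ennreal (N powr p) * E" unfolding E_def by (rule nn_integral_cmult) measurable
    finally show ?thesis .
  qed
  have NE: "ennreal (N powr p) * E = ennreal (N powr p - 1024 powr p) * E + ennreal (1024 powr p) * E"
  proof -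
    have "0 \<le> N powr p - 1024 powr p" using N p by (simp add: powr_mono2)
    then have "ennreal (N powr p) = ennreal (N powr p - 1024 powr p) + ennreal (1024 powr p)"
      by (subst ennreal_plus[symmetric]) auto
    then show ?thesis by (simp add: distrib_right)
  qed
  have "ennreal (N powr p - 1024 powr p) * E + X \<le> ennreal (N powr p - 1024 powr p) * E + (ennreal (1024 powr p) * E + ennreal K * Y)"
  proof -
    have "ennreal (N powr p - 1024 powr p) * E + X \<le>
       ((\<integral>\<^sup>+x. ennreal (\<eta> x * (N powr p - (1 - c) * \<theta> x powr p)) \<partial>lborel) + ennreal K * Y) + X"
      using ineq by (rule add_right_mono)
    also have "\<dots> = ennreal (N powr p) * E + ennreal K * Y" unfolding sumE[symmetric] by (simp add: ac_simps)
    finally show ?thesis unfolding NE by (simp add: ac_simps)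
  qed
  moreover have "ennreal (N powr p - 1024 powr p) * E < \<infinity>" using E_fin by (simp add: ennreal_mult_less_top)
  ultimately have XE: "X \<le> ennreal (1024 powr p) * E + ennreal K * Y"
    by (auto simp: ennreal_add_left_cancel_le)
  have "ennreal (1 - c) * (\<integral>\<^sup>+x. ennreal (\<theta> x powr p) * indicator (cball 0 R) x \<partial>lborel) =
      (\<integral>\<^sup>+x. ennreal (1 - c) * (ennreal (\<theta> x powr p) * indicator (cball 0 R) x) \<partial>lborel)"
    by (rule nn_integral_cmult[symmetric]) measurable
  also have "\<dots> \<le> X"
    unfolding X_def
  proof (rule nn_integral_mono)
    fix x
    show "ennreal (1 - c) * (ennreal (\<theta> x powr p) * indicator (cball 0 R) x) \<le> ennreal (\<eta> x * ((1 - c) * \<theta> x powr p))"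
    proof (cases "x \<in> cball 0 R")
      case True
      then have "\<eta> x = 1" unfolding \<eta>_def by (intro cutoff_props(3)) simp
      then show ?thesis using True c by (simp add: ennreal_mult'[symmetric])
    qed simp
  qed
  also have "\<dots> \<le> ennreal (1024 powr p) * E + ennreal K * Y" by (rule XE)
  also have "\<dots> \<le> ennreal (1024 powr p) * emeasure lborel (cball 0 1 :: (real^'n) set) + ennreal K * Y"
    by (intro add_right_mono mult_left_mono E_le) simp
  finally show ?thesis unfolding K_def Y_def .
qed

end

lemma opening_power_step_uniform:
  fixes \<kappa> p :: real
  assumes n: "2 \<le> CARD('n::finite)" and k: "1 \<le> \<kappa>" and p: "0 < p" "p < p_lower CARD('n) \<kappa>"
  shows "\<exists>D\<ge>0. \<forall>(w :: real^'n \<Rightarrow> real) s L M Z N R. contact_structure w s L M Z \<kappa> N \<longrightarrow> 0 \<le> R \<longrightarrow> R \<le> 5/8 \<longrightarrow>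
    (\<integral>\<^sup>+x. ennreal (touch_opening w 1024 N x powr p) * indicator (cball 0 R) x \<partial>lborel) \<le>
    ennreal D * (1 + (\<integral>\<^sup>+x. ennreal (touch_opening w 1024 N x powr (p - 1/2)) * indicator (cball 0 (R + 1/8)) x \<partial>lborel))"
proof -
  have p1: "p < 1" using p p_lower_properties(2)[OF n k] by simp
  obtain c where c: "0 \<le> c" "c < 1" and main: "\<And>(\<mu> :: 'n \<Rightarrow> real) t N. 0 < t \<Longrightarrow> t \<le> N \<Longrightarrow> (\<And>i. - t \<le> \<mu> i) \<Longrightarrow>
      (\<Sum>i\<in>UNIV. max 0 (\<mu> i)) \<le> \<kappa> * (\<Sum>i\<in>UNIV. max 0 (- \<mu> i)) \<Longrightarrow>
      (\<integral>\<^sup>+A. ennreal (p * A powr (p - 1) * (\<Prod>i\<in>UNIV. 1 + \<mu> i / A)) * indicator {t..N} A \<partial>lborel)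
        \<le> ennreal (N powr p - (1 - c) * t powr p)"
    using weighted_eigenvalue_integral[OF n k p] by blast
  define V where "V = measure lborel (cball 0 1 :: (real^'n) set)"
  have V: "emeasure lborel (cball 0 1 :: (real^'n) set) = ennreal V"
    unfolding V_def using emeasure_lborel_cball_finite[of "0 :: real^'n" 1] by (intro emeasure_eq_ennreal_measure) simp
  have V0: "0 \<le> V" by (simp add: V_def)
  define K where "K = 144 * (1 + \<kappa> * real CARD('n)) ^ CARD('n) * (p / (1 - p))"
  have K0: "0 \<le> K" using k p p1 by (simp add: K_def)
  define D where "D = (1024 powr p * V + K) / (1 - c)"
  have D0: "0 \<le> D" using V0 K0 c by (simp add: D_def)
  have "(\<integral>\<^sup>+x. ennreal (touch_opening w 1024 N x powr p) * indicator (cball 0 R) x \<partial>lborel) \<le>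
    ennreal D * (1 + (\<integral>\<^sup>+x. ennreal (touch_opening w 1024 N x powr (p - 1/2)) * indicator (cball 0 (R + 1/8)) x \<partial>lborel))"
    (is "?I \<le> ennreal D * (1 + ?Y)")
    if cs: "contact_structure w s L M Z \<kappa> N" and R: "0 \<le> R" "R \<le> 5/8" for w :: "real^'n \<Rightarrow> real" and s L M Z N R
  proof -
    have "ennreal (1 - c) * ?I \<le> ennreal (1024 powr p) * ennreal V + ennreal K * ?Y"
      using contact_structure.opening_power_step[OF cs p(1) p1 c main R] unfolding V K_def by blast
    also have "\<dots> = ennreal (1024 powr p * V) + ennreal K * ?Y" by (simp add: ennreal_mult')
    also have "\<dots> \<le> ennreal (1024 powr p * V + K) * (1 + ?Y)"
    proof -
      have "ennreal (1024 powr p * V) \<le> ennreal (1024 powr p * V) * (1 + ?Y)"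
        using mult_left_mono[of 1 "1 + ?Y" "ennreal (1024 powr p * V)"] by simp
      moreover have "ennreal K * ?Y \<le> ennreal K * (1 + ?Y)" by (rule mult_left_mono) auto
      ultimately show ?thesis
        using V0 K0 by (subst ennreal_plus) (auto simp: distrib_right intro: add_mono)
    qed
    finally have le: "ennreal (1 - c) * ?I \<le> ennreal (1024 powr p * V + K) * (1 + ?Y)" .
    have "?I = ennreal (1 / (1 - c)) * (ennreal (1 - c) * ?I)"
      using c by (simp add: mult.assoc[symmetric] ennreal_mult[symmetric])
    also have "\<dots> \<le> ennreal (1 / (1 - c)) * (ennreal (1024 powr p * V + K) * (1 + ?Y))"
      by (rule mult_left_mono[OF le]) simp
    also have "\<dots> = ennreal D * (1 + ?Y)"
    proof -
      have "D = 1 / (1 - c) * (1024 powr p * V + K)" by (simp add: D_def)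
      moreover have "ennreal (1 / (1 - c) * (1024 powr p * V + K)) = ennreal (1 / (1 - c)) * ennreal (1024 powr p * V + K)"
        by (rule ennreal_mult) (use c V0 K0 in auto)
      ultimately have "ennreal D = ennreal (1 / (1 - c)) * ennreal (1024 powr p * V + K)" by (simp only:)
      then show ?thesis by (simp only: mult.assoc)
    qed
    finally show ?thesis .
  qed
  then show ?thesis using D0 by blast
qed

text \<open>Since p < 1, at most two steps bring the exponent to a nonpositive power of
  \<open>\<theta>\<close> >= 1, whose integral is bounded by the volume of the unit ball. The radii
  run through 1/2, 5/8 and 3/4; for p <= 1/2 one step is enough.\<close>

theorem opening_integral_uniform:
  fixes \<kappa> p :: real
  assumes n: "2 \<le> CARD('n::finite)" and k: "1 \<le> \<kappa>" and p: "0 < p" "p < p_lower CARD('n) \<kappa>"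
  shows "\<exists>C\<ge>0. \<forall>(w :: real^'n \<Rightarrow> real) s L M Z N. contact_structure w s L M Z \<kappa> N \<longrightarrow>
    (\<integral>\<^sup>+x. ennreal (touch_opening w 1024 N x powr p) * indicator (cball 0 (1/2)) x \<partial>lborel) \<le> ennreal C"
proof -
  define V where "V = measure lborel (cball 0 1 :: (real^'n) set)"
  have V: "emeasure lborel (cball 0 1 :: (real^'n) set) = ennreal V"
    unfolding V_def using emeasure_lborel_cball_finite[of "0 :: real^'n" 1] by (intro emeasure_eq_ennreal_measure) simp
  have V0: "0 \<le> V" by (simp add: V_def)
  have low: "(\<integral>\<^sup>+x. ennreal (touch_opening w 1024 N x powr (q - 1/2)) * indicator (cball 0 R) x \<partial>lborel) \<le> ennreal V"
    if cs: "contact_structure w s L M Z \<kappa> N" and R: "R \<le> 1" and q: "q \<le> 1/2" for w :: "real^'n \<Rightarrow> real" and s L M Z N R q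
  proof -
    have "(\<integral>\<^sup>+x. ennreal (touch_opening w 1024 N x powr (q - 1/2)) * indicator (cball 0 R) x \<partial>lborel) \<le>
       (\<integral>\<^sup>+x. indicator (cball 0 1) x \<partial>(lborel :: (real^'n) measure))"
    proof (rule nn_integral_mono)
      fix x :: "real^'n"
      have "1 \<le> touch_opening w 1024 N x" using contact_structure.theta_bounds(1)[OF cs, of x] by simp
      then have "touch_opening w 1024 N x powr (q - 1/2) \<le> touch_opening w 1024 N x powr 0"
        using q by (intro powr_mono) auto
      then have "ennreal (touch_opening w 1024 N x powr (q - 1/2)) \<le> 1"
        using \<open>1 \<le> touch_opening w 1024 N x\<close> by simp
      then show "ennreal (touch_opening w 1024 N x powr (q - 1/2)) * indicator (cball 0 R) x \<le> indicator (cball 0 1) x"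
        using R by (auto simp: indicator_def)
    qed
    then show ?thesis by (simp add: V)
  qed
  obtain D where D: "0 \<le> D" and Dstep: "\<And>(w :: real^'n \<Rightarrow> real) s L M Z N R. contact_structure w s L M Z \<kappa> N \<Longrightarrow> 0 \<le> R \<Longrightarrow> R \<le> 5/8 \<Longrightarrow>
    (\<integral>\<^sup>+x. ennreal (touch_opening w 1024 N x powr p) * indicator (cball 0 R) x \<partial>lborel) \<le>
    ennreal D * (1 + (\<integral>\<^sup>+x. ennreal (touch_opening w 1024 N x powr (p - 1/2)) * indicator (cball 0 (R + 1/8)) x \<partial>lborel))"
    using opening_power_step_uniform[OF n k p] by blast
  show ?thesis
  proof (cases "p \<le> 1/2")
    case True
    have "(\<integral>\<^sup>+x. ennreal (touch_opening w 1024 N x powr p) * indicator (cball 0 (1/2)) x \<partial>lborel) \<le> ennreal (D * (1 + V))"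
      if cs: "contact_structure w s L M Z \<kappa> N" for w :: "real^'n \<Rightarrow> real" and s L M Z N
    proof -
      have "(\<integral>\<^sup>+x. ennreal (touch_opening w 1024 N x powr p) * indicator (cball 0 (1/2)) x \<partial>lborel) \<le>
         ennreal D * (1 + (\<integral>\<^sup>+x. ennreal (touch_opening w 1024 N x powr (p - 1/2)) * indicator (cball 0 (1/2 + 1/8)) x \<partial>lborel))"
        by (rule Dstep[OF cs]) auto
      also have "\<dots> \<le> ennreal D * (1 + ennreal V)"
        by (intro mult_left_mono add_left_mono low[OF cs _ True]) auto
      also have "\<dots> = ennreal (D * (1 + V))" using D V0 by (simp add: ennreal_mult ennreal_plus)
      finally show ?thesis .
    qed
    then show ?thesis using D V0 by (intro exI[of _ "D * (1 + V)"]) auto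
  next
    case False
    define q where "q = p - 1/2"
    have p1: "p < 1" using p p_lower_properties(2)[OF n k] by simp
    have q: "0 < q" "q < p_lower CARD('n) \<kappa>" "q \<le> 1/2" using False p p1 by (auto simp: q_def)
    obtain D' where D': "0 \<le> D'" and Dstep': "\<And>(w :: real^'n \<Rightarrow> real) s L M Z N R. contact_structure w s L M Z \<kappa> N \<Longrightarrow> 0 \<le> R \<Longrightarrow> R \<le> 5/8 \<Longrightarrow>
      (\<integral>\<^sup>+x. ennreal (touch_opening w 1024 N x powr q) * indicator (cball 0 R) x \<partial>lborel) \<le>
      ennreal D' * (1 + (\<integral>\<^sup>+x. ennreal (touch_opening w 1024 N x powr (q - 1/2)) * indicator (cball 0 (R + 1/8)) x \<partial>lborel))"
      using opening_power_step_uniform[OF n k q(1,2)] by blast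
    have "(\<integral>\<^sup>+x. ennreal (touch_opening w 1024 N x powr p) * indicator (cball 0 (1/2)) x \<partial>lborel) \<le> ennreal (D * (1 + D' * (1 + V)))"
      if cs: "contact_structure w s L M Z \<kappa> N" for w :: "real^'n \<Rightarrow> real" and s L M Z N
    proof -
      have "(\<integral>\<^sup>+x. ennreal (touch_opening w 1024 N x powr q) * indicator (cball 0 (5/8)) x \<partial>lborel) \<le>
         ennreal D' * (1 + (\<integral>\<^sup>+x. ennreal (touch_opening w 1024 N x powr (q - 1/2)) * indicator (cball 0 (5/8 + 1/8)) x \<partial>lborel))"
        by (rule Dstep'[OF cs]) auto
      also have "\<dots> \<le> ennreal D' * (1 + ennreal V)"
        by (intro mult_left_mono add_left_mono low[OF cs _ q(3)]) auto
      also have "\<dots> = ennreal (D' * (1 + V))" using D' V0 by (simp add: ennreal_mult ennreal_plus)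
      finally have Y: "(\<integral>\<^sup>+x. ennreal (touch_opening w 1024 N x powr q) * indicator (cball 0 (5/8)) x \<partial>lborel) \<le> ennreal (D' * (1 + V))" .
      have "(\<integral>\<^sup>+x. ennreal (touch_opening w 1024 N x powr p) * indicator (cball 0 (1/2)) x \<partial>lborel) \<le>
         ennreal D * (1 + (\<integral>\<^sup>+x. ennreal (touch_opening w 1024 N x powr (p - 1/2)) * indicator (cball 0 (1/2 + 1/8)) x \<partial>lborel))"
        by (rule Dstep[OF cs]) auto
      also have "\<dots> = ennreal D * (1 + (\<integral>\<^sup>+x. ennreal (touch_opening w 1024 N x powr q) * indicator (cball 0 (5/8)) x \<partial>lborel))"
        by (simp add: q_def)
      also have "\<dots> \<le> ennreal D * (1 + ennreal (D' * (1 + V)))"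
        by (intro mult_left_mono add_left_mono Y) auto
      also have "\<dots> = ennreal (D * (1 + D' * (1 + V)))" using D D' V0 by (simp add: ennreal_mult ennreal_plus)
      finally show ?thesis .
    qed
    then show ?thesis using D D' V0 by (intro exI[of _ "D * (1 + D' * (1 + V))"]) auto
  qed
qed

lemma contact_structure_inf_conv:
  fixes u :: "real^'n \<Rightarrow> real"
  assumes uc: "continuous_on (cball 0 1) u" and b: "\<And>z. z \<in> cball 0 1 \<Longrightarrow> \<bar>u z\<bar> \<le> 1"
    and sup: "quad_supersolution lam Lam (ball 0 1) u" and lam: "0 < lam" "lam \<le> Lam"
    and e: "0 < \<epsilon>" "2 * sqrt \<epsilon> \<le> 1/8" and N: "1024 < N"
  shows "\<exists>s L M Z. contact_structure (inf_conv \<epsilon> u) s L M Z (Lam / lam) N"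
proof -
  let ?w = "inf_conv \<epsilon> u"
  note wc = inf_conv_continuous[OF uc e(1)] and lo = inf_conv_bounds(1)[OF uc e(1) b]
  have N0: "0 \<le> N" and K0: "0 \<le> 1 / \<epsilon>" using N e(1) by auto
  obtain \<gamma> s L where env: "\<And>x. (\<gamma> has_derivative (\<lambda>h. s x \<bullet> h)) (at x)" "L-lipschitz_on UNIV s"
    "\<And>x. \<gamma> x \<le> ?w x"
    "\<And>A x p. A \<le> N \<Longrightarrow> touches ?w A x p \<Longrightarrow> \<gamma> x = ?w x \<and> s x = p \<and> touches \<gamma> A x p"
  proof (rule paraboloid_envelope[OF wc lo N0 K0 inf_conv_semiconcave[OF uc e(1)]])
    fix \<gamma> s L
    assume env: "\<And>x. (\<gamma> has_derivative (\<lambda>h. s x \<bullet> h)) (at x)" "L-lipschitz_on UNIV s" "\<And>x. \<gamma> x \<le> ?w x"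
      "\<And>A x p. A \<le> N \<Longrightarrow> touches ?w A x p \<Longrightarrow> \<gamma> x = ?w x \<and> s x = p \<and> touches \<gamma> A x p"
    show thesis by (rule that[OF env])
  qed
  obtain M Z where MZ: "Z \<in> null_sets lborel" "\<And>i j. (\<lambda>x. M x $ i $ j) \<in> borel_measurable borel"
    "\<And>x. x \<notin> Z \<Longrightarrow> (s has_derivative (\<lambda>h. M x *v h)) (at x)"
  proof (rule lipschitz_jacobian[OF env(2)])
    fix M Z
    assume MZ: "Z \<in> null_sets lborel" "\<And>i j. (\<lambda>x. M x $ i $ j) \<in> borel_measurable borel"
      "\<And>x. x \<notin> Z \<Longrightarrow> (s has_derivative (\<lambda>h. M x *v h)) (at x)"
    show thesis by (rule that[OF MZ])
  qed
  have sup': "quad_supersolution lam Lam (ball 0 (7/8)) ?w"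
    by (rule inf_conv_supersolution[OF uc e b sup])
  have "contact_structure ?w s L M Z (Lam / lam) N"
  proof
    show "1 \<le> Lam / lam" using lam by simp
    show "?w y \<le> 1" if "y \<in> cball 0 1" for y by (rule inf_conv_bounds(3)[OF uc e(1) b that])
    show "s x = p" if "A \<le> N" "touches ?w A x p" for A x p using env(4)[OF that] by simp
    fix A x assume x: "x \<notin> Z" "norm x < 7/8" and A: "A \<le> N" and t: "touches ?w A x (s x)"
    from env(4)[OF A t] have eq: "\<gamma> x = ?w x" and t': "touches \<gamma> A x (s x)" by auto
    show "\<exists>v \<mu>. eigen_family (M x) v \<mu> \<and> (\<forall>i. - A \<le> \<mu> i) \<and>
        (\<Sum>i\<in>UNIV. max 0 (\<mu> i)) \<le> Lam / lam * (\<Sum>i\<in>UNIV. max 0 (- \<mu> i))"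
      by (rule envelope_hessian[OF env(1,3) eq t' MZ(3)[OF x(1)] sup' _ lam(1)]) (use x(2) in simp)
  qed (rule wc lo env(2) MZ N | assumption)+
  then show ?thesis by blast
qed

subsection \<open>Passage to the limit\<close>

text \<open>The slopes of paraboloids of opening B are bounded by 9 sqrt B uniformly in the
  regularization, so they converge along a subsequence. The inf-convolutions converge to u at x
  because their minimizers tend to x, and at the other points of the ball they lie below u. Touching
  for infinitely many indices is assumed, as this is what a bound on a limit inferior
  provides.\<close>

lemma touches_limit:
  fixes u :: "real^'n \<Rightarrow> real"
  assumes uc: "continuous_on (cball 0 1) u" and b: "\<And>z. z \<in> cball 0 1 \<Longrightarrow> \<bar>u z\<bar> \<le> 1"
    and e: "\<And>k. 0 < \<epsilon> k" "\<epsilon> \<longlonglongrightarrow> 0" and x: "norm x \<le> 1/2" and B: "1 \<le> B"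
    and inf: "\<And>j::nat. \<exists>k\<ge>j. \<exists>p. touches (inf_conv (\<epsilon> k) u) B x p"
  shows "\<exists>p. \<forall>y\<in>cball 0 1. u x + p \<bullet> (y - x) - B / 2 * (norm (y - x))\<^sup>2 \<le> u y"
proof -
  let ?w = "\<lambda>k. inf_conv (\<epsilon> k) u"
  have xb: "x \<in> cball 0 1" using x by simp
  obtain K where K: "\<And>j. j \<le> K j \<and> (\<exists>p. touches (?w (K j)) B x p)"
    using choice[of "\<lambda>j k. j \<le> k \<and> (\<exists>p. touches (?w k) B x p)"] inf by blast
  obtain P where P: "\<And>j. touches (?w (K j)) B x (P j)"
    using choice[of "\<lambda>j p. touches (?w (K j)) B x p"] K by blast
  have "P j \<in> cball 0 (9 * sqrt B)" for j
    using touches_slope_bound[OF inf_conv_bounds(1)[OF uc e(1) b] inf_conv_bounds(3)[OF uc e(1) b] _ B P[of j]] x by simp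
  then obtain p r where r: "strict_mono r" "(P \<circ> r) \<longlonglongrightarrow> p"
    using compact_imp_seq_compact[OF compact_cball[of "0::real^'n" "9 * sqrt B"]] unfolding seq_compact_def by blast
  have Kr: "filterlim (\<lambda>j. K (r j)) at_top sequentially"
  proof (rule filterlim_at_top_mono[OF filterlim_subseq[OF r(1)]])
    show "\<forall>\<^sub>F j in sequentially. r j \<le> K (r j)" using K by simp
  qed
  have eKr: "(\<lambda>j. \<epsilon> (K (r j))) \<longlonglongrightarrow> 0" using filterlim_compose[OF e(2) Kr] .
  have "\<forall>j. \<exists>z. z \<in> cball 0 1 \<and> u z \<le> ?w (K (r j)) x \<and> norm (x - z) \<le> 2 * sqrt (\<epsilon> (K (r j)))"
  proof
    fix j
    obtain z where z: "z \<in> cball 0 1" "?w (K (r j)) x = u z + (norm (x - z))\<^sup>2 / (2 * \<epsilon> (K (r j)))"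
      "norm (x - z) \<le> 2 * sqrt (\<epsilon> (K (r j)))"
      using inf_conv_bounds(4)[OF uc e(1) b xb] by blast
    have "0 \<le> (norm (x - z))\<^sup>2 / (2 * \<epsilon> (K (r j)))" using e(1)[of "K (r j)"] by simp
    then show "\<exists>z. z \<in> cball 0 1 \<and> u z \<le> ?w (K (r j)) x \<and> norm (x - z) \<le> 2 * sqrt (\<epsilon> (K (r j)))"
      using z by (intro exI[of _ z]) simp
  qed
  then obtain z where z: "\<And>j. z j \<in> cball 0 1" "\<And>j. u (z j) \<le> ?w (K (r j)) x" "\<And>j. norm (x - z j) \<le> 2 * sqrt (\<epsilon> (K (r j)))"
    using choice[of "\<lambda>j z. z \<in> cball 0 1 \<and> u z \<le> ?w (K (r j)) x \<and> norm (x - z) \<le> 2 * sqrt (\<epsilon> (K (r j)))"] by blast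
  have "(\<lambda>j. 2 * sqrt (\<epsilon> (K (r j)))) \<longlonglongrightarrow> 2 * sqrt 0" by (intro tendsto_intros eKr)
  then have "(\<lambda>j. x - z j) \<longlonglongrightarrow> 0"
    by (intro Lim_null_comparison[of "\<lambda>j. x - z j" "\<lambda>j. 2 * sqrt (\<epsilon> (K (r j)))"]) (use z(3) in auto)
  then have "(\<lambda>j. x - (x - z j)) \<longlonglongrightarrow> x - 0" by (intro tendsto_intros)
  then have "z \<longlonglongrightarrow> x" by simp
  then have uz: "(\<lambda>j. u (z j)) \<longlonglongrightarrow> u x"
    by (intro continuous_on_tendsto_compose[OF uc _ xb]) (use z(1) in auto)
  have wx: "(\<lambda>j. ?w (K (r j)) x) \<longlonglongrightarrow> u x"
    by (rule tendsto_sandwich[OF _ _ uz tendsto_const]) (use z(2) inf_conv_bounds(2)[OF uc e(1) b xb] in auto)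
  have "u x + p \<bullet> (y - x) - B / 2 * (norm (y - x))\<^sup>2 \<le> u y" if y: "y \<in> cball 0 1" for y
  proof (rule LIMSEQ_le_const2)
    have "(\<lambda>j. P (r j)) \<longlonglongrightarrow> p" using r(2) by (simp add: o_def)
    then show "(\<lambda>j. ?w (K (r j)) x + P (r j) \<bullet> (y - x) - B / 2 * (norm (y - x))\<^sup>2) \<longlonglongrightarrow> u x + p \<bullet> (y - x) - B / 2 * (norm (y - x))\<^sup>2"
      by (intro tendsto_intros wx)
    have "?w (K (r j)) x + P (r j) \<bullet> (y - x) - B / 2 * (norm (y - x))\<^sup>2 \<le> u y" for j
    proof -
      have "?w (K (r j)) x + P (r j) \<bullet> (y - x) - B / 2 * (norm (y - x))\<^sup>2 \<le> ?w (K (r j)) y"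
        using P[of "r j"] by (simp add: touches_def)
      also have "\<dots> \<le> u y" by (rule inf_conv_bounds(2)[OF uc e(1) b y])
      finally show ?thesis .
    qed
    then show "\<exists>j0. \<forall>j\<ge>j0. ?w (K (r j)) x + P (r j) \<bullet> (y - x) - B / 2 * (norm (y - x))\<^sup>2 \<le> u y" by blast
  qed
  then show ?thesis by blast
qed

text \<open>Undoes the normalization by m and rewrites the paraboloid based at x in the form with
  its quadratic part centred at 0.\<close>

lemma Theta_lower_le:
  fixes u :: "real^'n \<Rightarrow> real"
  assumes m: "0 < m" and B: "0 \<le> B"
    and t: "\<And>y. y \<in> cball 0 1 \<Longrightarrow> u x / m + p \<bullet> (y - x) - B / 2 * (norm (y - x))\<^sup>2 \<le> u y / m"
  shows "Theta_lower u (ball 0 1) x \<le> ennreal (m * B)"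
proof -
  define P where "P = (\<lambda>y. u x + m * (p \<bullet> (y - x)) - (m * B) / 2 * (norm (y - x))\<^sup>2)"
  have Pe: "P = (\<lambda>y. - ((m * B) / 2) * (norm y)\<^sup>2 +
      ((m *\<^sub>R p + (m * B) *\<^sub>R x) \<bullet> y + (u x - m * (p \<bullet> x) - (m * B) / 2 * (norm x)\<^sup>2)))"
    unfolding P_def power2_norm_eq_inner
    by (simp add: fun_eq_iff inner_diff_left inner_diff_right inner_add_left inner_commute algebra_simps diff_divide_distrib add_divide_distrib)
  have "paraboloid (m * B) P"
    unfolding paraboloid_def by (intro exI) (rule Pe)
  moreover have "P y \<le> u y" if "y \<in> closure (ball 0 1)" for y
  proof -
    have "y \<in> cball 0 1" using that by simp
    from mult_left_mono[OF t[OF this], of m] m show ?thesis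
      by (simp add: P_def algebra_simps)
  qed
  moreover have "P x = u x" by (simp add: P_def)
  ultimately show ?thesis
    unfolding Theta_lower_def using m B
    by (intro Inf_lower CollectI exI[of _ "m * B"] conjI exI[of _ P] refl) auto
qed

section \<open>Powers, the supremum norm and the final estimate\<close>

lemma ennreal_powr_mono: "0 < p \<Longrightarrow> a \<le> b \<Longrightarrow> ennreal_powr a p \<le> ennreal_powr b p"
  by (auto simp: ennreal_powr_def top_unique less_top intro!: ennreal_leI powr_mono2 enn2real_mono)

lemma ennreal_powr_ennreal: "0 \<le> r \<Longrightarrow> ennreal_powr (ennreal r) p = ennreal (r powr p)"
  by (simp add: ennreal_powr_def)

text \<open>If |u| exceeded the essential supremum at a point of the closed ball, continuity would
  make it do so on a nonempty open subset of the open ball, which is not null.\<close>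

lemma abs_le_Linf_norm:
  fixes u :: "real^'n \<Rightarrow> real"
  assumes uc: "continuous_on (cball 0 1) u" and x: "x \<in> cball 0 1"
  shows "ennreal \<bar>u x\<bar> \<le> Linf_norm (ball 0 1) u"
proof (rule ccontr)
  assume "\<not> ?thesis"
  then have lt: "Linf_norm (ball 0 1) u < ennreal \<bar>u x\<bar>" by simp
  then obtain t where t: "Linf_norm (ball 0 1) u = ennreal t" "0 \<le> t"
    by (cases "Linf_norm (ball 0 1) u") (auto simp: top_unique)
  then have tx: "t < \<bar>u x\<bar>" using lt by (simp add: ennreal_less_iff)
  define W where "W = ball 0 1 \<inter> (\<lambda>y. \<bar>u y\<bar>) -` {t<..}"
  have "continuous_on (ball 0 1) (\<lambda>y. \<bar>u y\<bar>)"
    by (intro continuous_intros continuous_on_subset[OF uc]) auto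
  then have W: "open W" unfolding W_def by (rule continuous_open_preimage) auto
  obtain d where d: "0 < d" "\<And>y. y \<in> cball 0 1 \<Longrightarrow> dist y x < d \<Longrightarrow> dist (u y) (u x) < \<bar>u x\<bar> - t"
    using uc x tx unfolding continuous_on_iff by (metis diff_gt_0_iff_gt)
  have "x \<in> closure (ball 0 1)" using x by simp
  then obtain y where y: "y \<in> ball 0 1" "dist y x < d" using d(1) unfolding closure_approachable by blast
  have "y \<in> W"
  proof -
    have "dist (u y) (u x) < \<bar>u x\<bar> - t" using d(2)[of y] y by simp
    then show ?thesis using y(1) by (auto simp: W_def dist_real_def)
  qed
  moreover have "negligible W"
  proof -
    have "AE y in lebesgue_on (ball 0 1). ennreal \<bar>u y\<bar> \<le> ennreal t"
      using esssup_AE[of "\<lambda>x. ennreal \<bar>u x\<bar>" "lebesgue_on (ball 0 1)"] t(1) by (simp add: Linf_norm_def)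
    then have "AE y in lebesgue. y \<in> ball 0 1 \<longrightarrow> \<bar>u y\<bar> \<le> t"
      by (subst (asm) AE_restrict_space_iff) (auto elim!: eventually_mono simp: ennreal_le_iff2 t(2))
    then have "AE y in lebesgue. y \<notin> W" by eventually_elim (auto simp: W_def)
    moreover have "W \<in> sets lebesgue" using W by simp
    ultimately show ?thesis by (simp add: AE_iff_null_sets negligible_iff_null_sets)
  qed
  ultimately show False using open_not_negligible[OF W] by blast
qed

text \<open>u is divided by its maximum modulus m and regularized; Fatou's lemma transfers the
  uniform estimate to the limit inferior of the truncated openings, which majorizes the power of
  \<open>Theta_lower\<close> after scaling.\<close>

theorem theta_integral_estimate:
  fixes \<kappa> p :: real
  assumes n: "2 \<le> CARD('n::finite)" and k: "1 \<le> \<kappa>" and p: "0 < p" "p < p_lower CARD('n) \<kappa>"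
  shows "\<exists>C\<ge>0. \<forall>lam Lam. \<forall>u :: real^'n \<Rightarrow> real.
     0 < lam \<and> lam \<le> Lam \<and> \<kappa> = Lam / lam \<and> continuous_on (closure (ball 0 1)) u \<and>
     pucci_supersolution lam Lam (ball 0 1) u \<longrightarrow>
     (\<integral>\<^sup>+x\<in>ball 0 (1/2). ennreal_powr (Theta_lower u (ball 0 1) x) p \<partial>lebesgue)
       \<le> ennreal C * ennreal_powr (Linf_norm (ball 0 1) u) p"
proof -
  obtain C where C: "0 \<le> C" "\<And>(w :: real^'n \<Rightarrow> real) s L M Z N. contact_structure w s L M Z \<kappa> N \<Longrightarrow>
    (\<integral>\<^sup>+x. ennreal (touch_opening w 1024 N x powr p) * indicator (cball 0 (1/2)) x \<partial>lborel) \<le> ennreal C"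
    using opening_integral_uniform[OF n k p] by blast
  have "(\<integral>\<^sup>+x\<in>ball 0 (1/2). ennreal_powr (Theta_lower u (ball 0 1) x) p \<partial>lebesgue)
       \<le> ennreal C * ennreal_powr (Linf_norm (ball 0 1) u) p"
    if lam: "0 < lam" "lam \<le> Lam" and kap: "\<kappa> = Lam / lam" and uc': "continuous_on (closure (ball 0 1)) u"
      and visc: "pucci_supersolution lam Lam (ball 0 1) u" for lam Lam and u :: "real^'n \<Rightarrow> real"
  proof -
    have uc: "continuous_on (cball 0 1) u" using uc' by simp
    have "continuous_on (cball 0 1) (\<lambda>x. \<bar>u x\<bar>)" by (intro continuous_intros uc)
    then obtain x0 where x0: "x0 \<in> cball 0 1" "\<And>y. y \<in> cball 0 1 \<Longrightarrow> \<bar>u y\<bar> \<le> \<bar>u x0\<bar>"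
      using continuous_attains_sup[of "cball 0 1 :: (real^'n) set" "\<lambda>x. \<bar>u x\<bar>"] by auto
    define m where "m = \<bar>u x0\<bar>"
    have mL: "ennreal m \<le> Linf_norm (ball 0 1) u" unfolding m_def by (rule abs_le_Linf_norm[OF uc x0(1)])
    have mp: "ennreal (m powr p) \<le> ennreal_powr (Linf_norm (ball 0 1) u) p"
      using ennreal_powr_mono[OF p(1) mL] by (simp add: ennreal_powr_ennreal m_def)
    show ?thesis
    proof (cases "m = 0")
      case True
      \<comment> \<open>m = 0 excludes the normalization, but then u vanishes on the closed ball and
        the zero paraboloid touches it everywhere.\<close>
      have "Theta_lower u (ball 0 1) x = 0" if "x \<in> ball 0 (1/2)" for x
      proof -
        have z: "u y = 0" if "y \<in> cball 0 1" for y using x0(2)[OF that] True by (simp add: m_def)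
        have "Theta_lower u (ball 0 1) x \<le> ennreal (1 * 0)"
          by (rule Theta_lower_le[where p=0]) (use z that in auto)
        then show ?thesis by simp
      qed
      then have "(\<integral>\<^sup>+x\<in>ball 0 (1/2). ennreal_powr (Theta_lower u (ball 0 1) x) p \<partial>lebesgue) = (\<integral>\<^sup>+x. 0 \<partial>(lebesgue :: (real^'n) measure))"
        by (intro nn_integral_cong) (auto simp: indicator_def ennreal_powr_def)
      then show ?thesis by simp
    next
      case False
      then have m: "0 < m" by (simp add: m_def)
      define v where "v = (\<lambda>x. (1/m) * u x)"
      have vc: "continuous_on (cball 0 1) v" unfolding v_def by (intro continuous_intros uc)
      have vb: "\<bar>v z\<bar> \<le> 1" if "z \<in> cball 0 1" for z
        using x0(2)[OF that] m by (simp add: v_def abs_mult divide_le_eq m_def)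
      have vsup: "quad_supersolution lam Lam (ball 0 1) v"
        unfolding v_def by (rule quad_supersolution_scale[OF quad_supersolution_of_viscosity[OF visc]]) (use m in auto)
      \<comment> \<open>The factor 1/256 = (1/16)^2 ensures 2 sqrt \<open>\<epsilon>\<close> <= 1/8.
        The truncations N below start above 1024 and tend to infinity, so every fixed opening is
        eventually admissible.\<close>
      define \<epsilon> :: "nat \<Rightarrow> real" where "\<epsilon> = (\<lambda>j. inverse (real (Suc j)) / 256)"
      define N :: "nat \<Rightarrow> real" where "N = (\<lambda>j. 1025 + real j)"
      have e0: "0 < \<epsilon> j" for j by (simp add: \<epsilon>_def)
      have e1: "2 * sqrt (\<epsilon> j) \<le> 1/8" for j
      proof -
        have "\<epsilon> j \<le> (1/16)\<^sup>2" by (simp add: \<epsilon>_def power2_eq_square inverse_le_1_iff)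
        from real_sqrt_le_mono[OF this] have "sqrt (\<epsilon> j) \<le> 1/16" by simp
        then show ?thesis by simp
      qed
      have elim: "\<epsilon> \<longlonglongrightarrow> 0"
        unfolding \<epsilon>_def using tendsto_divide[OF LIMSEQ_inverse_real_of_nat tendsto_const[of "256::real"]] by simp
      define \<theta> where "\<theta> = (\<lambda>j. touch_opening (inf_conv (\<epsilon> j) v) 1024 (N j))"
      have cs: "\<exists>s L M Z. contact_structure (inf_conv (\<epsilon> j) v) s L M Z \<kappa> (N j)" for j
        unfolding kap by (rule contact_structure_inf_conv[OF vc vb vsup lam e0 e1]) (simp_all add: N_def)
      have \<theta>m[measurable]: "\<theta> j \<in> borel_measurable borel" for j
        unfolding \<theta>_def using cs[of j] contact_structure.theta_measurable by blast
      have \<theta>C: "(\<integral>\<^sup>+x. ennreal (\<theta> j x powr p) * indicator (cball 0 (1/2)) x \<partial>lborel) \<le> ennreal C" for j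
        unfolding \<theta>_def using cs[of j] C(2) by blast
      have \<theta>1: "1024 \<le> \<theta> j x" for j x
        unfolding \<theta>_def using cs[of j] contact_structure.theta_bounds(1) by blast
      have \<theta>t: "\<exists>q. touches (inf_conv (\<epsilon> j) v) B x q" if "\<theta> j x \<le> B" "B < N j" for j x B
      proof -
        obtain s L M Z where c: "contact_structure (inf_conv (\<epsilon> j) v) s L M Z \<kappa> (N j)" using cs[of j] by blast
        have "touches (inf_conv (\<epsilon> j) v) B x (s x)"
          using contact_structure.theta_le_iff[OF c, of B x] that \<theta>1[of j x] by (simp add: \<theta>_def)
        then show ?thesis ..
      qed
      define F where "F = (\<lambda>x. liminf (\<lambda>j. ennreal (\<theta> j x powr p) * indicator (cball 0 (1/2)) x))"
      have [measurable]: "cball (0 :: real^'n) (1/2) \<in> sets borel" by simp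
      have Fm[measurable]: "F \<in> borel_measurable borel" unfolding F_def by measurable
      have FC: "(\<integral>\<^sup>+x. F x \<partial>lborel) \<le> ennreal C"
      proof -
        have "(\<integral>\<^sup>+x. F x \<partial>lborel) \<le> liminf (\<lambda>j. \<integral>\<^sup>+x. ennreal (\<theta> j x powr p) * indicator (cball 0 (1/2)) x \<partial>lborel)"
          unfolding F_def by (rule nn_integral_liminf) measurable
        also have "\<dots> \<le> liminf (\<lambda>j::nat. ennreal C)"
          by (rule Liminf_mono) (simp add: \<theta>C)
        also have "\<dots> = ennreal C" by (simp add: Liminf_const)
        finally show ?thesis .
      qed
      have pt: "ennreal_powr (Theta_lower u (ball 0 1) x) p \<le> ennreal (m powr p) * F x" if x: "x \<in> ball 0 (1/2)" for x
      proof (cases "F x")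
        case (real l)
        \<comment> \<open>If the limit inferior is below b, then \<open>\<theta> j x\<close> < B
          with B^p = b for infinitely many j. For large such j the truncation exceeds B, so
          paraboloids of opening -B touch the inf-convolutions at x, and
          \<open>touches_limit\<close> passes this on to v.\<close>
        have bnd: "ennreal_powr (Theta_lower u (ball 0 1) x) p \<le> ennreal (m powr p * b)" if b: "l < b" for b
        proof -
          have b0: "0 < b" using b real by simp
          define B where "B = b powr (1/p)"
          have Bp: "B powr p = b" using b0 p by (simp add: B_def powr_powr)
          have Fb: "F x < ennreal b" using real b b0 by (simp add: ennreal_less_iff)
          have "\<exists>\<^sub>F j in sequentially. ennreal (\<theta> j x powr p) * indicator (cball 0 (1/2)) x < ennreal b"
          proof (rule ccontr)
            assume "\<not> ?thesis"
            then have "\<forall>\<^sub>F j in sequentially. ennreal b \<le> ennreal (\<theta> j x powr p) * indicator (cball 0 (1/2)) x"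
              by (simp only: not_frequently not_less)
            from Liminf_bounded[OF this] Fb show False by (simp add: F_def)
          qed
          then have fr: "\<exists>\<^sub>F j in sequentially. \<theta> j x < B"
          proof (rule frequently_elim1)
            fix j assume "ennreal (\<theta> j x powr p) * indicator (cball 0 (1/2)) x < ennreal b"
            then have "\<theta> j x powr p < B powr p" using x b0 Bp by (simp add: ennreal_less_iff)
            moreover have "0 \<le> B" by (simp add: B_def)
            ultimately show "\<theta> j x < B" using powr_mono2[of p B "\<theta> j x"] p(1) by linarith
          qed
          have B1: "1 \<le> B"
          proof -
            obtain j where "\<theta> j x < B" using frequently_ex[OF fr] by blast
            then show ?thesis using \<theta>1[of j x] by simp
          qed
          have "\<exists>q. \<forall>y\<in>cball 0 1. v x + q \<bullet> (y - x) - B / 2 * (norm (y - x))\<^sup>2 \<le> v y"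
          proof (rule touches_limit[OF vc vb e0 elim _ B1])
            show "norm x \<le> 1/2" using x by simp
            fix i :: nat
            obtain i0 :: nat where i0: "B \<le> real i0" using real_arch_simple by blast
            obtain j where j: "max i i0 \<le> j" "\<theta> j x < B"
              using fr unfolding frequently_sequentially by blast
            have "B < N j" using i0 j(1) by (simp add: N_def)
            then have "\<exists>q. touches (inf_conv (\<epsilon> j) v) B x q" using \<theta>t[of j x B] j(2) by simp
            then show "\<exists>j\<ge>i. \<exists>q. touches (inf_conv (\<epsilon> j) v) B x q" using j(1) by (intro exI[of _ j]) simp
          qed
          then obtain q where q: "\<forall>y\<in>cball 0 1. v x + q \<bullet> (y - x) - B / 2 * (norm (y - x))\<^sup>2 \<le> v y" by blast
          have "u x / m + q \<bullet> (y - x) - B / 2 * (norm (y - x))\<^sup>2 \<le> u y / m" if "y \<in> cball 0 1" for y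
            using q[rule_format, OF that] by (simp add: v_def)
          from Theta_lower_le[OF m _ this] have "Theta_lower u (ball 0 1) x \<le> ennreal (m * B)"
            using B1 by simp
          then have "ennreal_powr (Theta_lower u (ball 0 1) x) p \<le> ennreal_powr (ennreal (m * B)) p"
            by (rule ennreal_powr_mono[OF p(1)])
          also have "\<dots> = ennreal (m powr p * b)"
            using m B1 by (simp add: ennreal_powr_ennreal powr_mult Bp)
          finally show ?thesis .
        qed
        have "ennreal_powr (Theta_lower u (ball 0 1) x) p \<le> ennreal (m powr p * l)"
        proof (rule ennreal_le_epsilon)
          fix e :: real assume "0 < e"
          have mp0: "0 < m powr p" using m by simp
          have "ennreal_powr (Theta_lower u (ball 0 1) x) p \<le> ennreal (m powr p * (l + e / (m powr p)))"
            using bnd[of "l + e / (m powr p)"] \<open>0 < e\<close> mp0 by simp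
          also have "m powr p * (l + e / (m powr p)) = m powr p * l + e" using mp0 by (simp add: field_simps)
          also have "ennreal (m powr p * l + e) = ennreal (m powr p * l) + ennreal e"
            using real \<open>0 < e\<close> by (intro ennreal_plus) auto
          finally show "ennreal_powr (Theta_lower u (ball 0 1) x) p \<le> ennreal (m powr p * l) + ennreal e" .
        qed
        then show ?thesis using real by (simp add: ennreal_mult')
      next
        case top
        then show ?thesis using m by (simp add: ennreal_mult_top)
      qed
      have "(\<integral>\<^sup>+x\<in>ball 0 (1/2). ennreal_powr (Theta_lower u (ball 0 1) x) p \<partial>lebesgue) \<le> (\<integral>\<^sup>+x. ennreal (m powr p) * F x \<partial>lebesgue)"
        by (rule nn_integral_mono) (use pt in \<open>auto simp: indicator_def\<close>)
      also have "\<dots> = (\<integral>\<^sup>+x. ennreal (m powr p) * F x \<partial>lborel)"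
        by (rule nn_integral_completion)
      also have "\<dots> = ennreal (m powr p) * (\<integral>\<^sup>+x. F x \<partial>lborel)"
        by (rule nn_integral_cmult) measurable
      also have "\<dots> \<le> ennreal (m powr p) * ennreal C" by (rule mult_left_mono[OF FC]) simp
      also have "\<dots> \<le> ennreal_powr (Linf_norm (ball 0 1) u) p * ennreal C" by (rule mult_right_mono[OF mp]) simp
      finally show ?thesis by (simp add: mult.commute)
    qed
  qed
  then show ?thesis using C(1) by blast
qed

theorem theorem1p3:
  fixes \<kappa> :: real
  assumes "CARD('n::finite) \<ge> 2" and "\<kappa> \<ge> 1"
  shows "(\<forall>p. 0 < p \<and> p < p_lower CARD('n) \<kappa> \<longrightarrow>
            (\<exists>C\<ge>0. \<forall>lam Lam. \<forall>u :: real^'n \<Rightarrow> real.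
               0 < lam \<and> lam \<le> Lam \<and> \<kappa> = Lam / lam \<and> continuous_on (closure (ball 0 1)) u \<and>
               pucci_supersolution lam Lam (ball 0 1) u \<longrightarrow>
               (\<integral>\<^sup>+x\<in>ball 0 (1/2). ennreal_powr (Theta_lower u (ball 0 1) x) p \<partial>lebesgue)
                 \<le> ennreal C * ennreal_powr (Linf_norm (ball 0 1) u) p))
         \<and> eps_exponent TYPE('n) \<kappa> \<ge> ereal (p_lower CARD('n) \<kappa>)"
proof
  show est: "\<forall>p. 0 < p \<and> p < p_lower CARD('n) \<kappa> \<longrightarrow>
            (\<exists>C\<ge>0. \<forall>lam Lam. \<forall>u :: real^'n \<Rightarrow> real.
               0 < lam \<and> lam \<le> Lam \<and> \<kappa> = Lam / lam \<and> continuous_on (closure (ball 0 1)) u \<and>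
               pucci_supersolution lam Lam (ball 0 1) u \<longrightarrow>
               (\<integral>\<^sup>+x\<in>ball 0 (1/2). ennreal_powr (Theta_lower u (ball 0 1) x) p \<partial>lebesgue)
                 \<le> ennreal C * ennreal_powr (Linf_norm (ball 0 1) u) p)"
    using theta_integral_estimate[OF assms] by blast
  have le: "ereal q \<le> eps_exponent TYPE('n) \<kappa>" if q: "0 < q" "q < p_lower CARD('n) \<kappa>" for q
    unfolding eps_exponent_def by (rule Sup_upper) (use q est in blast)
  show "ereal (p_lower CARD('n) \<kappa>) \<le> eps_exponent TYPE('n) \<kappa>"
  proof (rule dense_le)
    fix z assume "z < ereal (p_lower CARD('n) \<kappa>)"
    then obtain r where r: "z < ereal r" "ereal r < ereal (p_lower CARD('n) \<kappa>)" using ereal_dense2 by blast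
    \<comment> \<open>Raising r to at least half of \<open>p_lower\<close> makes the exponent
      positive even when z is negative.\<close>
    define q where "q = max r (p_lower CARD('n) \<kappa> / 2)"
    have "0 < q" "q < p_lower CARD('n) \<kappa>"
      using r(2) p_lower_properties(1)[OF assms] by (auto simp: q_def)
    from le[OF this] have "ereal q \<le> eps_exponent TYPE('n) \<kappa>" .
    moreover have "z \<le> ereal q" using r(1) by (auto simp: q_def intro: order_trans[OF less_imp_le])
    ultimately show "z \<le> eps_exponent TYPE('n) \<kappa>" by (rule order_trans[rotated])
  qed
qed

end
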